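(* Consider the urn model described in the context. Assume that there is an integer constant $C$ with $A_n\vee B_n\vee N_n\le C$ for all $n\ge 1$; that $E[A_n]=E[B_n]=m_n$ for all $n$, with $m_n\to m\in(0,+\infty)$; that $E[N_n|\mathcal F_{n-1}]\to N$ and $E[N_n^2|\mathcal F_{n-1}]\to Q$ almost surely, where $N$ and $Q$ are strictly positive finite random variables; and that $E[A_n^2]\to q_A$, $E[B_n^2]\to q_B$, $E[A_nB_n]\to q_{AB}$, where $q_A,q_B,q_{AB}$ are strictly positive finite constants. Let $Z$ be the almost sure limit of $Z_n$ (which exists under these assumptions). Set $$\widehat m_n=\frac1n\sum_{j=1}^nA_j,\quad \widehat q_{A,n}=\frac1n\sum_{j=1}^nA_j^2,\quad \widehat q_{B,n}=\frac1n\sum_{j=1}^nB_j^2,\quad \widehat q_{AB,n}=\frac1n\sum_{j=1}^nA_jB_j,\quad \widehat\mu_n=\frac1n\sum_{j=1}^nN_j,\quad \widehat q_{N,n}=\frac1n\sum_{j=1}^nN_j^2,$$ and $$V_n=Z_n(1-Z_n)\,\frac{(1-Z_n)\widehat q_{A,n}[(1-Z_n)\widehat\mu_n+Z_n\widehat q_{N,n}]+Z_n\widehat q_{B,n}[Z_n\widehat\mu_n+(1-Z_n)\widehat q_{N,n}]-2Z_n(1-Z_n)\widehat q_{AB,n}(\widehat q_{N,n}-\widehat\mu_n)}{(\widehat m_n\widehat\mu_n)^2}.$$ Then, for every $\alpha\in(0,1)$, $Z_n\pm q_{1-\frac\alpha2}\sqrt{V_n/n}$ is an asymptotic confidence interval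 for $Z$ of level $1-\alpha$, i.e. $$\lim_{n\to\infty}P\Bigl(|Z_n-Z|\le q_{1-\frac\alpha2}\sqrt{V_n/n}\Bigr)=1-\alpha,$$ where $q_{1-\frac\alpha2}$ is the quantile of order $1-\frac\alpha2$ of the standard normal distribution.
   Context: Urn model. An urn initially contains $a\ge 1$ balls of color A and $b\ge 1$ balls of color B ($a,b$ integers). On a probability space $(\Omega,\mathcal A,P)$ there are random variables $N_n,X_n,A_n,B_n$, $n\ge 1$, where $N_n$ is the size of the sample drawn without replacement at time $n$, $X_n$ is the number of sampled balls of color A, and after the draw the sampled balls are returned together with $A_nX_n$ new balls of color A and $B_n(N_n-X_n)$ new balls of color B. Put, for $n\ge 0$, $H_n=a+\sum_{j=1}^n A_jX_j$ (balls of color A), $K_n=b+\sum_{j=1}^n B_j(N_j-X_j)$ (balls of color B), $S_n=H_n+K_n$. For each $n\ge1$: (A1) the conditional distribution of $N_n$ given $[N_1,X_1,A_1,B_1,\dots,N_{n-1},X_{n-1},A_{n-1},B_{n-1}]$ is concentrated on $\{1,\dots,S_{n-1}\}$; (A2) the conditional distribution of $X_n$ given $[N_1,X_1,A_1,B_1,\dots,N_{n-1},X_{n-1},A_{n-1},B_{n-1},N_n]$ is hypergeometric with parameters $N_n,S_{n-1},H_{n-1}$, i.e. it gives mass $\binom{H_{n-1}}{k}\binom{S_{n-1}-H_{n-1}}{N_n-k}/\binom{S_{n-1}}{N_n}$ to $k$; (A3) the random vector $[A_n,B_n]$ takes values in $(\mathbb N\setminus\{0\})^2$ and is independent of $[N_1,X_1,A_1,B_1,\dots,N_{n-1},X_{n-1},A_{n-1},B_{n-1},N_n,X_n]$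 ($A_n$ and $B_n$ may be correlated with each other and their law may depend on $n$). The proportion of balls of color A is $Z_n=H_n/S_n$, $n\ge0$. Filtration: $\mathcal F_0=\{\emptyset,\Omega\}$, $\mathcal F_n=\sigma(N_1,X_1,A_1,B_1,\dots,N_n,X_n,A_n,B_n)$ for $n\ge1$. *)

theory Defs
  imports "HOL-Probability.Probability"
begin

text \<open>
  All processes are indexed by \<^typ>\<open>nat\<close>, but time starts at 1: the values of \<open>N\<close>, \<open>X\<close>, \<open>A\<close>, \<open>B\<close>
  at index 0 are never used.
\<close>

definition urn_H :: "nat \<Rightarrow> (nat \<Rightarrow> 'a \<Rightarrow> nat) \<Rightarrow> (nat \<Rightarrow> 'a \<Rightarrow> nat) \<Rightarrow> nat \<Rightarrow> 'a \<Rightarrow> nat" where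
  "urn_H a X A n \<omega> = a + (\<Sum>j=1..n. A j \<omega> * X j \<omega>)"

text \<open>
  The hypergeometric law of the model below makes \<open>X j \<le> N j\<close> almost sure, so the subtraction of
  natural numbers truncates at most on a null set.
\<close>

definition urn_K ::
  "nat \<Rightarrow> (nat \<Rightarrow> 'a \<Rightarrow> nat) \<Rightarrow> (nat \<Rightarrow> 'a \<Rightarrow> nat) \<Rightarrow> (nat \<Rightarrow> 'a \<Rightarrow> nat) \<Rightarrow> nat \<Rightarrow> 'a \<Rightarrow> nat" where
  "urn_K b N X B n \<omega> = b + (\<Sum>j=1..n. B j \<omega> * (N j \<omega> - X j \<omega>))"

definition urn_S ::
  "nat \<Rightarrow> nat \<Rightarrow> (nat \<Rightarrow> 'a \<Rightarrow> nat) \<Rightarrow> (nat \<Rightarrow> 'a \<Rightarrow> nat) \<Rightarrow> (nat \<Rightarrow> 'a \<Rightarrow> nat) \<Rightarrow> (nat \<Rightarrow> 'a \<Rightarrow> nat)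
    \<Rightarrow> nat \<Rightarrow> 'a \<Rightarrow> nat" where
  "urn_S a b N X A B n \<omega> = urn_H a X A n \<omega> + urn_K b N X B n \<omega>"

definition urn_Z ::
  "nat \<Rightarrow> nat \<Rightarrow> (nat \<Rightarrow> 'a \<Rightarrow> nat) \<Rightarrow> (nat \<Rightarrow> 'a \<Rightarrow> nat) \<Rightarrow> (nat \<Rightarrow> 'a \<Rightarrow> nat) \<Rightarrow> (nat \<Rightarrow> 'a \<Rightarrow> nat)
    \<Rightarrow> nat \<Rightarrow> 'a \<Rightarrow> real" where
  "urn_Z a b N X A B n \<omega> = real (urn_H a X A n \<omega>) / real (urn_S a b N X A B n \<omega>)"

text \<open>
  The random vector \<open>[N\<^sub>1, X\<^sub>1, A\<^sub>1, B\<^sub>1, \<dots>, N\<^sub>n, X\<^sub>n, A\<^sub>n, B\<^sub>n]\<close>, as a list of length \<open>n\<close>. It takes values in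
  a countable type, so the discrete sigma-algebra on that type is the product sigma-algebra.
\<close>

definition urn_history ::
  "(nat \<Rightarrow> 'a \<Rightarrow> nat) \<Rightarrow> (nat \<Rightarrow> 'a \<Rightarrow> nat) \<Rightarrow> (nat \<Rightarrow> 'a \<Rightarrow> nat) \<Rightarrow> (nat \<Rightarrow> 'a \<Rightarrow> nat)
    \<Rightarrow> nat \<Rightarrow> 'a \<Rightarrow> (nat \<times> nat \<times> nat \<times> nat) list" where
  "urn_history N X A B n \<omega> = map (\<lambda>j. (N j \<omega>, X j \<omega>, A j \<omega>, B j \<omega>)) [1..<Suc n]"

definition generated_by :: "'a measure \<Rightarrow> ('a \<Rightarrow> 'b) \<Rightarrow> 'a measure" where
  "generated_by M Y = vimage_algebra (space M) Y (count_space UNIV)"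

definition urn_filtration ::
  "'a measure \<Rightarrow> (nat \<Rightarrow> 'a \<Rightarrow> nat) \<Rightarrow> (nat \<Rightarrow> 'a \<Rightarrow> nat) \<Rightarrow> (nat \<Rightarrow> 'a \<Rightarrow> nat) \<Rightarrow> (nat \<Rightarrow> 'a \<Rightarrow> nat)
    \<Rightarrow> nat \<Rightarrow> 'a measure" where
  "urn_filtration M N X A B n = generated_by M (urn_history N X A B n)"

text \<open>The mass given to \<open>k\<close> by the conditional distribution of \<open>Y\<close> given the sigma-algebra \<open>G\<close>.\<close>

definition cond_mass :: "'a measure \<Rightarrow> 'a measure \<Rightarrow> ('a \<Rightarrow> nat) \<Rightarrow> nat \<Rightarrow> 'a \<Rightarrow> real" where
  "cond_mass M G Y k = real_cond_exp M G (indicator {\<omega> \<in> space M. Y \<omega> = k})"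

text \<open>
  Sample size \<open>n\<close>, population size \<open>s\<close>, \<open>h\<close> balls of the counted colour. The case distinction
  implements the convention that a binomial coefficient with negative lower entry vanishes.
\<close>

definition hypergeometric_mass :: "nat \<Rightarrow> nat \<Rightarrow> nat \<Rightarrow> nat \<Rightarrow> real" where
  "hypergeometric_mass n s h k =
    (if k \<le> n then real (h choose k) * real ((s - h) choose (n - k)) / real (s choose n) else 0)"

locale urn_model = prob_space M for M :: "'a measure" +
  fixes a b :: nat and N X A B :: "nat \<Rightarrow> 'a \<Rightarrow> nat"
  assumes a_ge_1: "1 \<le> a" and b_ge_1: "1 \<le> b"
    and random_variables: "\<And>n. 1 \<le> n \<Longrightarrow>
      random_variable (count_space UNIV) (N n) \<and> random_variable (count_space UNIV) (X n) \<and>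
      random_variable (count_space UNIV) (A n) \<and> random_variable (count_space UNIV) (B n)"
    and sample_size: "\<And>n. 1 \<le> n \<Longrightarrow>
      AE \<omega> in M. (\<Sum>k=1..urn_S a b N X A B (n - 1) \<omega>.
        cond_mass M (urn_filtration M N X A B (n - 1)) (N n) k \<omega>) = 1"
    and sample_composition: "\<And>n. 1 \<le> n \<Longrightarrow>
      AE \<omega> in M. \<forall>k.
        cond_mass M (generated_by M (\<lambda>\<omega>. (urn_history N X A B (n - 1) \<omega>, N n \<omega>))) (X n) k \<omega> =
        hypergeometric_mass (N n \<omega>) (urn_S a b N X A B (n - 1) \<omega>) (urn_H a X A (n - 1) \<omega>) k"
    and additions_pos: "\<And>n. 1 \<le> n \<Longrightarrow> AE \<omega> in M. 1 \<le> A n \<omega> \<and> 1 \<le> B n \<omega>"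
    and additions_indep: "\<And>n. 1 \<le> n \<Longrightarrow>
      indep_set (sets (generated_by M (\<lambda>\<omega>. (A n \<omega>, B n \<omega>))))
        (sets (generated_by M (\<lambda>\<omega>. (urn_history N X A B (n - 1) \<omega>, N n \<omega>, X n \<omega>))))"

definition empirical_mean :: "(nat \<Rightarrow> 'a \<Rightarrow> real) \<Rightarrow> nat \<Rightarrow> 'a \<Rightarrow> real" where
  "empirical_mean Y n \<omega> = (\<Sum>j=1..n. Y j \<omega>) / real n"

definition urn_V ::
  "nat \<Rightarrow> nat \<Rightarrow> (nat \<Rightarrow> 'a \<Rightarrow> nat) \<Rightarrow> (nat \<Rightarrow> 'a \<Rightarrow> nat) \<Rightarrow> (nat \<Rightarrow> 'a \<Rightarrow> nat) \<Rightarrow> (nat \<Rightarrow> 'a \<Rightarrow> nat)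
    \<Rightarrow> nat \<Rightarrow> 'a \<Rightarrow> real" where
  "urn_V a b N X A B n \<omega> =
    (let z = urn_Z a b N X A B n \<omega>;
         m = empirical_mean (\<lambda>j \<omega>. real (A j \<omega>)) n \<omega>;
         qA = empirical_mean (\<lambda>j \<omega>. (real (A j \<omega>))\<^sup>2) n \<omega>;
         qB = empirical_mean (\<lambda>j \<omega>. (real (B j \<omega>))\<^sup>2) n \<omega>;
         qAB = empirical_mean (\<lambda>j \<omega>. real (A j \<omega>) * real (B j \<omega>)) n \<omega>;
         \<mu> = empirical_mean (\<lambda>j \<omega>. real (N j \<omega>)) n \<omega>;
         qN = empirical_mean (\<lambda>j \<omega>. (real (N j \<omega>))\<^sup>2) n \<omega>
     in z * (1 - z) *
        (((1 - z) * qA * ((1 - z) * \<mu> + z * qN)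
          + z * qB * (z * \<mu> + (1 - z) * qN)
          - 2 * z * (1 - z) * qAB * (qN - \<mu>)) / (m * \<mu>)\<^sup>2))"

definition quantile :: "real measure \<Rightarrow> real \<Rightarrow> real" where
  "quantile D p = Inf {x. p \<le> cdf D x}"

end

theory Submission
  imports Defs "HOL-Real_Asymp.Real_Asymp"
begin

text \<open>
  With \<open>D\<^sub>n\<close> denoting \<open>(1 - Z\<^sub>n) A X - Z\<^sub>n B (N - X)\<close> at time \<open>n + 1\<close>, the equality of the means of \<open>A\<close>
  and \<open>B\<close> makes \<open>D\<^sub>n\<close> conditionally centered, and \<open>Z\<^sub>n\<^sub>+\<^sub>1 - Z\<^sub>n = D\<^sub>n / S\<^sub>n + O(n\<^sup>-\<^sup>2)\<close> because \<open>S\<^sub>n\<close> grows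
  linearly. So \<open>Z\<^sub>n\<close> converges, and \<open>\<surd>n (Z\<^sub>n - Z)\<close> is, up to a vanishing error, minus \<open>\<surd>n\<close> times the tail
  sum of the \<open>D\<^sub>j / S\<^sub>j\<close> with \<open>j \<ge> n\<close>. The law of large numbers for bounded centered increments shows that
  \<open>n\<close> times the tail sum of the \<open>(D\<^sub>j / S\<^sub>j)\<^sup>2\<close> and the estimator \<open>V\<^sub>n\<close> have the same limit. As \<open>V\<^sub>n\<close> is
  known at time \<open>n\<close>, before the tail starts, the tail can be rescaled by it inside the martingale, and
  McLeish's factorization \<open>e\<^sup>i\<^sup>x = (1 + i x) e\<^sup>-\<^sup>x\<^sup>x\<^sup>/\<^sup>2 (1 + O(x\<^sup>3))\<close> gives a standard normal limit; no stable
  convergence is needed. The limit of \<open>V\<^sub>n\<close> is positive because \<open>Z\<close> has no atom at 0 or 1: the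
  expectation of \<open>- ln Z\<^sub>n\<close> stays bounded, and likewise for the other colour.
\<close>

section \<open>Elementary analysis\<close>

text \<open>The tail is cut at a finite horizon \<open>k n\<close>: at least
  \<open>n\<^sup>2\<close>, so that the squares beyond it are o(1/n), and so late that E|Z - Z_k| is
  at most 1/(n+1), which vanishes even after multiplication by the square root of n. Hence only
  finite sums and products occur. The obstacle is that 1/sqrt V_n is unbounded. The limit theorem is
  therefore proved with \<open>max (V n w) \<delta>\<close>, for which the scaled increments, and
  with them the product martingale, are bounded by constants independent of n. The characteristic
  function is compared with the expectation of a random L_n that equals exp(-t^2/2) wherever V_n is
  at least \<delta>; positivity of the limit makes the complementary event improbable for small
  \<delta>. The constants go back to one fact: every draw takes at least one ball and adds at least
  one, so S_n >= n + 2 and |D_n / S_n| <= C^2/(n+1). For increments of this size, second moments and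
  dominated convergence with constant bounds suffice.\<close>

lemma floor_cube_root:
  fixes n :: nat
  shows "\<exists>k. k ^ 3 \<le> n \<and> n < Suc k ^ 3"
proof (induction n)
  case 0
  then show ?case by (intro exI[of _ 0]) simp
next
  case (Suc n)
  then obtain k where k: "k ^ 3 \<le> n" "n < Suc k ^ 3" by blast
  show ?case
  proof (cases "Suc n < Suc k ^ 3")
    case True
    with k show ?thesis by (intro exI[of _ k]) auto
  next
    case False
    with k have "Suc n = Suc k ^ 3" by simp
    moreover have "Suc k ^ 3 < Suc (Suc k) ^ 3" by (intro power_strict_mono) auto
    ultimately show ?thesis by (intro exI[of _ "Suc k"]) auto
  qed
qed

text \<open>A block between consecutive cubes has 3k^2 + 3k + 1 <= 7k^2 steps, each of size at most
  c / k^3. This is the origin of the 7, and it makes the oscillation inside a block vanish.\<close>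

lemma cube_block_oscillation:
  fixes u :: "nat \<Rightarrow> real"
  assumes step: "\<And>n. \<bar>u (Suc n) - u n\<bar> \<le> c / real (Suc n)" and "0 \<le> c"
    and "0 < k" "k ^ 3 \<le> n" "n \<le> Suc k ^ 3"
  shows "\<bar>u n - u (k ^ 3)\<bar> \<le> 7 * c / real k"
proof -
  have "\<bar>u (k ^ 3 + i) - u (k ^ 3)\<bar> \<le> real i * (c / real k ^ 3)" for i
  proof (induction i)
    case (Suc i)
    have "\<bar>u (Suc (k ^ 3 + i)) - u (k ^ 3 + i)\<bar> \<le> c / real (Suc (k ^ 3 + i))" by (rule step)
    also have "\<dots> \<le> c / real k ^ 3"
      using \<open>0 < k\<close> \<open>0 \<le> c\<close> by (intro divide_left_mono) (auto intro!: mult_pos_pos add_pos_nonneg)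
    finally have "\<bar>u (Suc (k ^ 3 + i)) - u (k ^ 3 + i)\<bar> \<le> c / real k ^ 3" .
    moreover have "real (Suc i) * (c / real k ^ 3) = real i * (c / real k ^ 3) + c / real k ^ 3"
      by (simp add: distrib_right add_divide_distrib)
    ultimately show ?case using Suc by simp
  qed simp
  from this[of "n - k ^ 3"] have "\<bar>u n - u (k ^ 3)\<bar> \<le> real (n - k ^ 3) * (c / real k ^ 3)"
    using assms by simp
  also have "\<dots> \<le> (7 * real k ^ 2) * (c / real k ^ 3)"
  proof (intro mult_right_mono)
    have "n \<le> k ^ 3 + 3 * k ^ 2 + 3 * k + 1" using assms by (simp add: power3_eq_cube power2_eq_square algebra_simps)
    then have "n - k ^ 3 \<le> 3 * k ^ 2 + 3 * k + 1" by simp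
    also have "\<dots> \<le> 7 * k ^ 2"
      using \<open>0 < k\<close> by (cases k) (auto simp: power2_eq_square algebra_simps)
    finally have "real (n - k ^ 3) \<le> real (7 * k ^ 2)" by (rule of_nat_mono)
    then show "real (n - k ^ 3) \<le> 7 * real k ^ 2" by simp
  qed (use assms in auto)
  also have "\<dots> = 7 * c / real k" using \<open>0 < k\<close> by (simp add: power3_eq_cube power2_eq_square)
  finally show ?thesis .
qed

text \<open>
  Along the cubes second moments of order \<open>1 / n\<close> are summable, so that almost sure convergence needs
  no maximal inequality.
\<close>

lemma LIMSEQ_from_cubes:
  fixes u :: "nat \<Rightarrow> real"
  assumes lim: "(\<lambda>k. u (k ^ 3)) \<longlonglongrightarrow> L"
    and step: "\<And>n. \<bar>u (Suc n) - u n\<bar> \<le> c / real (Suc n)"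
  shows "u \<longlonglongrightarrow> L"
proof (rule LIMSEQ_I)
  fix e :: real assume "0 < e"
  have c: "0 \<le> c" using step[of 0] by simp
  have "(\<lambda>k. 7 * c / real k) \<longlonglongrightarrow> 0" by (rule lim_const_over_n)
  then obtain k1 where k1: "\<And>k. k1 \<le> k \<Longrightarrow> norm (7 * c / real k - 0) < e / 2"
    using LIMSEQ_D[of _ 0 "e/2"] \<open>0 < e\<close> by (metis half_gt_zero)
  obtain k2 where k2: "\<And>k. k2 \<le> k \<Longrightarrow> norm (u (k ^ 3) - L) < e / 2"
    using LIMSEQ_D[OF lim, of "e/2"] \<open>0 < e\<close> by (metis half_gt_zero)
  define k0 where "k0 = Suc (max k1 k2)"
  show "\<exists>n0. \<forall>n\<ge>n0. norm (u n - L) < e"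
  proof (intro exI[of _ "k0 ^ 3"] allI impI)
    fix n assume n: "k0 ^ 3 \<le> n"
    obtain k where k: "k ^ 3 \<le> n" "n < Suc k ^ 3" using floor_cube_root by blast
    have "k0 \<le> k"
    proof (rule ccontr)
      assume "\<not> k0 \<le> k"
      then have "Suc k ^ 3 \<le> k0 ^ 3" by (intro power_mono) auto
      with n k show False by simp
    qed
    then have *: "k1 \<le> k" "k2 \<le> k" "0 < k" by (auto simp: k0_def)
    have "\<bar>u n - u (k ^ 3)\<bar> \<le> 7 * c / real k"
      using k * c by (intro cube_block_oscillation step) auto
    moreover have "7 * c / real k < e / 2" using k1[of k] * by (simp del: abs_divide add: abs_less_iff)
    moreover have "\<bar>u (k ^ 3) - L\<bar> < e / 2" using k2[of k] * by simp
    moreover have "\<bar>u n - L\<bar> \<le> \<bar>u n - u (k ^ 3)\<bar> + \<bar>u (k ^ 3) - L\<bar>" by simp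
    ultimately show "norm (u n - L) < e" unfolding real_norm_def by linarith
  qed
qed

text \<open>Unlike the inverse squares, these weights telescope to a closed form; the tails of order
  1/n below are measured with them.\<close>

lemma sum_inverse_consecutive:
  fixes n k :: nat
  assumes "n \<le> k"
  shows "(\<Sum>j=n..<k. 1 / (real (j + 1) * real (j + 2))) = 1 / real (n + 1) - 1 / real (k + 1)"
  using assms
proof (induction k rule: dec_induct)
  case (step k)
  have "1 / (x * (x + 1)) = 1 / x - 1 / (x + 1)" if "0 < x" for x :: real
    using that by (simp add: field_simps)
  from this[of "real (k + 1)"] step show ?case by (simp add: add_ac)
qed simp

text \<open>Abel summation: from one index to the next the weight 1/((j+1)(j+2)) decreases by
  2/((j+1)(j+2)(j+3)), so that bounds on the partial sums \<open>P\<close> can replace bounds on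
  single terms.\<close>

lemma tail_sum_summation_by_parts:
  fixes P :: "nat \<Rightarrow> real"
  assumes "n \<le> k"
  shows "(\<Sum>j=n..<k. (P (Suc j) - P j) / (real (j + 1) * real (j + 2))) =
    P k / (real (k + 1) * real (k + 2)) - P n / (real (n + 1) * real (n + 2)) +
    (\<Sum>j=n..<k. 2 * P (Suc j) / (real (j + 1) * real (j + 2) * real (j + 3)))"
  using assms
proof (induction k rule: dec_induct)
  case (step k)
  have "(p - q) / (x * (x+1)) + q / (x * (x + 1)) = p / ((x+1) * (x + 2)) + 2 * p / (x * (x+1) * (x+2))"
    if "0 < x" for p q x :: real
    using that by (simp add: divide_simps) algebra
  from this[of "real (k + 1)" "P (Suc k)" "P k"] step show ?case
    by (simp add: add_ac)
qed simp

text \<open>After summation by parts each of the two boundary terms is at most e/(n+1) and the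
  remaining sum at most 2e/(n+1), hence the factor 4, uniformly in the upper end
  \<open>k\<close>.\<close>

lemma tail_sum_bound:
  fixes P :: "nat \<Rightarrow> real"
  assumes bound: "\<And>j. n \<le> j \<Longrightarrow> \<bar>P j\<bar> \<le> e * real j" and "n \<le> k" "0 \<le> e"
  shows "real n * \<bar>\<Sum>j=n..<k. (P (Suc j) - P j) / (real (j + 1) * real (j + 2))\<bar> \<le> 4 * e"
proof -
  have A: "\<bar>P j / (real (j + 1) * real (j + 2))\<bar> \<le> e / real (n + 1)" if "n \<le> j" for j
  proof -
    have "\<bar>P j / (real (j + 1) * real (j + 2))\<bar> \<le> e * real j / (real (j + 1) * real (j + 2))"
      using bound[OF that] by (simp add: divide_right_mono abs_mult)
    also have "\<dots> = e / real (j + 1) * (real j / real (j + 2))" by simp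
    also have "\<dots> \<le> e / real (j + 1) * 1" using \<open>0 \<le> e\<close> by (intro mult_left_mono) auto
    also have "\<dots> \<le> e / real (n + 1)" using that \<open>0 \<le> e\<close> by (auto intro!: divide_left_mono)
    finally show ?thesis .
  qed
  have "\<bar>\<Sum>j=n..<k. 2 * P (Suc j) / (real (j + 1) * real (j + 2) * real (j + 3))\<bar>
    \<le> (\<Sum>j=n..<k. 2 * e * (1 / (real (j + 1) * real (j + 2))))"
  proof (intro order_trans[OF sum_abs] sum_mono)
    fix j assume "j \<in> {n..<k}"
    then have b: "\<bar>P (Suc j)\<bar> \<le> e * real (Suc j)" by (intro bound) auto
    have "\<bar>2 * P (Suc j) / (real (j + 1) * real (j + 2) * real (j + 3))\<bar>
        = 2 * \<bar>P (Suc j)\<bar> / (real (j + 1) * real (j + 2) * real (j + 3))"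
      by (simp add: abs_mult)
    also have "\<dots> \<le> 2 * (e * real (j + 1)) / (real (j + 1) * real (j + 2) * real (j + 3))"
      using b by (intro divide_right_mono mult_left_mono) auto
    also have "\<dots> = 2 * e * (1 / (real (j + 2) * real (j + 3)))" by simp
    also have "\<dots> \<le> 2 * e * (1 / (real (j + 1) * real (j + 2)))"
      using \<open>0 \<le> e\<close> by (intro mult_left_mono divide_left_mono) (auto intro!: mult_mono)
    finally show "\<bar>2 * P (Suc j) / (real (j + 1) * real (j + 2) * real (j + 3))\<bar>
      \<le> 2 * e * (1 / (real (j + 1) * real (j + 2)))" .
  qed
  also have "\<dots> = 2 * e * (1 / real (n + 1) - 1 / real (k + 1))"
    by (simp only: sum_distrib_left[symmetric] sum_inverse_consecutive[OF \<open>n \<le> k\<close>])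
  also have "\<dots> \<le> 2 * e * (1 / real (n + 1))" using \<open>0 \<le> e\<close> by (intro mult_left_mono) auto
  finally have S: "\<bar>\<Sum>j=n..<k. 2 * P (Suc j) / (real (j + 1) * real (j + 2) * real (j + 3))\<bar>
    \<le> 2 * e * (1 / real (n + 1))" .
  have "\<bar>\<Sum>j=n..<k. (P (Suc j) - P j) / (real (j + 1) * real (j + 2))\<bar> \<le> 4 * (e / real (n + 1))"
  proof -
    have "\<bar>p - q + r\<bar> \<le> 4 * w" if "\<bar>p\<bar> \<le> w" "\<bar>q\<bar> \<le> w" "\<bar>r\<bar> \<le> 2 * e * (1 / real (n + 1))" "w = e / real (n + 1)"
      for p q r w :: real
      using that by (simp add: abs_le_iff)
    then show ?thesis
      unfolding tail_sum_summation_by_parts[OF \<open>n \<le> k\<close>] using A[of k] A[of n] \<open>n \<le> k\<close> S by blast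
  qed
  then have "real n * \<bar>\<Sum>j=n..<k. (P (Suc j) - P j) / (real (j + 1) * real (j + 2))\<bar>
    \<le> real n * (4 * (e / real (n + 1)))" by (intro mult_left_mono) auto
  also have "\<dots> = 4 * e * (real n / real (n + 1))" by simp
  also have "\<dots> \<le> 4 * e * 1" using \<open>0 \<le> e\<close> by (intro mult_left_mono) auto
  finally show ?thesis by simp
qed

text \<open>Centering the terms at \<open>V\<close> leaves partial sums \<open>P\<close> of size
  o(n), to which \<open>tail_sum_bound\<close> applies. The constant part contributes V (n/(n+1) -
  n/(k n + 1)), and k n >= n^2 removes the second fraction.\<close>

lemma Cesaro_imp_scaled_tail:
  fixes x :: "nat \<Rightarrow> real"
  assumes avg: "(\<lambda>n. (\<Sum>j<n. x j) / real n) \<longlonglongrightarrow> V" and k: "\<And>n. n ^ 2 \<le> k n"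
  shows "(\<lambda>n. real n * (\<Sum>j=n..<k n. x j / (real (j + 1) * real (j + 2)))) \<longlonglongrightarrow> V"
proof -
  define P where "P n = (\<Sum>j<n. x j) - real n * V" for n
  have nk: "n \<le> k n" for n using k[of n] by (meson le_trans self_le_power zero_less_numeral
        bot_nat_0.extremum less_one not_le le_square power2_nat_le_imp_le)
  have Psuc: "P (Suc j) - P j = x j - V" for j by (simp add: P_def algebra_simps)
  have "(\<lambda>n. real n * (\<Sum>j=n..<k n. (P (Suc j) - P j) / (real (j + 1) * real (j + 2)))) \<longlonglongrightarrow> 0"
  proof (rule LIMSEQ_I)
    fix e :: real assume "0 < e"
    have "(\<lambda>n. P n / real n) \<longlonglongrightarrow> V - V"
    proof (rule Lim_transform_eventually[OF tendsto_diff[OF avg tendsto_const[of V]]])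
      show "\<forall>\<^sub>F n in sequentially. (\<Sum>j<n. x j) / real n - V = P n / real n"
        using eventually_gt_at_top[of 0] by eventually_elim (simp add: P_def field_simps)
    qed
    then obtain n0 where n0: "\<And>n. n0 \<le> n \<Longrightarrow> norm (P n / real n - (V - V)) < e / 8"
      using LIMSEQ_D[of _ "V - V" "e / 8"] \<open>0 < e\<close> by (meson zero_less_divide_iff zero_less_numeral)
    have "norm (real n * (\<Sum>j=n..<k n. (P (Suc j) - P j) / (real (j + 1) * real (j + 2))) - 0) < e"
      if "n0 \<le> n" for n
    proof -
      have "\<bar>P j\<bar> \<le> e / 8 * real j" if "n \<le> j" for j
        using n0[of j] that \<open>n0 \<le> n\<close> by (cases "j = 0") (auto simp: P_def field_simps abs_divide)
      from tail_sum_bound[of n P "e/8", OF this nk] \<open>0 < e\<close>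
      show ?thesis by (auto simp: abs_mult)
    qed
    then show "\<exists>n0. \<forall>n\<ge>n0. norm (real n * (\<Sum>j=n..<k n. (P (Suc j) - P j) / (real (j + 1) * real (j + 2))) - 0) < e"
      by blast
  qed
  moreover have "(\<lambda>n. V * (real n / real (n + 1) - real n / real (k n + 1))) \<longlonglongrightarrow> V * (1 - 0)"
  proof (intro tendsto_intros)
    show "(\<lambda>n. real n / real (n + 1)) \<longlonglongrightarrow> 1" using LIMSEQ_n_over_Suc_n by simp
    show "(\<lambda>n. real n / real (k n + 1)) \<longlonglongrightarrow> 0"
    proof (rule tendsto_sandwich[OF _ _ tendsto_const lim_1_over_n])
      show "\<forall>\<^sub>F n in sequentially. real n / real (k n + 1) \<le> 1 / real n"
        using eventually_gt_at_top[of 0]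
      proof eventually_elim
        case (elim n)
        have "real (n ^ 2) \<le> real (k n)" using k of_nat_mono by blast
        with elim show ?case by (auto simp: divide_simps power2_eq_square)
      qed
    qed auto
  qed
  ultimately have "(\<lambda>n. real n * (\<Sum>j=n..<k n. (P (Suc j) - P j) / (real (j + 1) * real (j + 2)))
    + V * (real n / real (n + 1) - real n / real (k n + 1))) \<longlonglongrightarrow> 0 + V * (1 - 0)"
    by (rule tendsto_add)
  moreover have "real n * (\<Sum>j=n..<k n. (P (Suc j) - P j) / (real (j + 1) * real (j + 2)))
    + V * (real n / real (n + 1) - real n / real (k n + 1))
    = real n * (\<Sum>j=n..<k n. x j / (real (j + 1) * real (j + 2)))" for n
  proof -
    have "V * (real n / real (n + 1) - real n / real (k n + 1))
      = real n * (V * (1 / real (n + 1) - 1 / real (k n + 1)))" by (simp add: algebra_simps)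
    also have "\<dots> = real n * (\<Sum>j=n..<k n. V / (real (j + 1) * real (j + 2)))"
      by (simp only: sum_inverse_consecutive[OF nk, symmetric] sum_distrib_left) simp
    finally show ?thesis
      by (simp add: Psuc diff_divide_distrib sum_subtractf algebra_simps)
  qed
  ultimately show ?thesis by simp
qed

lemma Cesaro_mean:
  fixes y :: "nat \<Rightarrow> real"
  assumes "y \<longlonglongrightarrow> L"
  shows "(\<lambda>n. (\<Sum>j<n. y j) / real n) \<longlonglongrightarrow> L"
proof (rule LIMSEQ_I)
  fix e :: real assume "0 < e"
  then obtain n0 where n0: "\<And>j. n0 \<le> j \<Longrightarrow> norm (y j - L) < e / 2"
    using LIMSEQ_D[OF assms, of "e / 2"] by (metis half_gt_zero)
  define s where "s = (\<Sum>j<n0. \<bar>y j - L\<bar>)"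
  obtain n1 where n1: "2 * s / e < real n1" using reals_Archimedean2 by blast
  have "norm ((\<Sum>j<n. y j) / real n - L) < e" if n: "max (Suc n0) n1 \<le> n" for n
  proof -
    have "\<bar>(\<Sum>j<n. y j) - real n * L\<bar> = \<bar>\<Sum>j<n. y j - L\<bar>" by (simp add: sum_subtractf)
    also have "\<dots> \<le> (\<Sum>j<n. \<bar>y j - L\<bar>)" by (rule sum_abs)
    also have "\<dots> = s + (\<Sum>j=n0..<n. \<bar>y j - L\<bar>)"
      unfolding s_def lessThan_atLeast0 using n by (subst sum.atLeastLessThan_concat) auto
    also have "\<dots> \<le> s + (\<Sum>j=n0..<n. e / 2)" using n0 by (intro add_left_mono sum_mono) (auto intro: less_imp_le)
    also have "\<dots> \<le> s + real n * (e / 2)" using \<open>0 < e\<close> by (auto intro!: mult_right_mono)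
    also have "\<dots> < e * real n"
    proof -
      have "2 * s < e * real n1" using n1 \<open>0 < e\<close> by (simp add: field_simps)
      also have "\<dots> \<le> e * real n" using n \<open>0 < e\<close> by simp
      finally show ?thesis by (simp add: mult.commute)
    qed
    finally have "\<bar>(\<Sum>j<n. y j) - real n * L\<bar> < e * real n" .
    moreover have "(\<Sum>j<n. y j) / real n - L = ((\<Sum>j<n. y j) - real n * L) / real n"
      using n by (simp add: field_simps)
    ultimately show ?thesis using n by (simp add: abs_divide pos_divide_less_eq)
  qed
  then show "\<exists>n0. \<forall>n\<ge>n0. norm ((\<Sum>j<n. y j) / real n - L) < e" by blast
qed

text \<open>The upper half comes from exp y >= 1 + y + y^2/2 and (1 + y + y^2/2)(1 - y + y^2/2) = 1
  + y^4/4 >= 1.\<close>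

lemma exp_minus_Taylor_bound:
  fixes y :: real
  assumes "0 \<le> y"
  shows "\<bar>exp (- y) - (1 - y)\<bar> \<le> y\<^sup>2 / 2"
proof -
  have lower: "1 - y \<le> exp (- y)" using exp_ge_add_one_self[of "- y"] by simp
  have "1 \<le> exp y * (1 - y + y\<^sup>2 / 2)"
  proof (rule order_trans[OF _ mult_right_mono[OF exp_lower_Taylor_quadratic[OF assms]]])
    have "0 \<le> y ^ 4 / 4" by simp
    also have "y ^ 4 / 4 = (1 + y + y\<^sup>2 / 2) * (1 - y + y\<^sup>2 / 2) - 1" by (simp add: power2_eq_square power4_eq_xxxx field_simps)
    finally show "1 \<le> (1 + y + y\<^sup>2 / 2) * (1 - y + y\<^sup>2 / 2)" by simp
    have "0 \<le> (1 - y)\<^sup>2 / 2 + 1 / 2" by simp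
    then show "0 \<le> 1 - y + y\<^sup>2 / 2" by (simp add: power2_eq_square field_simps)
  qed
  then have "exp (- y) \<le> 1 - y + y\<^sup>2 / 2" by (simp add: exp_minus field_simps)
  with lower show ?thesis by auto
qed

text \<open>Since (1 + ix)(1 - x^2/2) differs from the quadratic Taylor polynomial of exp(ix) only
  by -i x^3/2, three errors remain: the Taylor error \<open>T\<close> (1/6), this cubic term (1/2),
  and the error \<open>E\<close> of the Gaussian factor (1/4). The three coefficients of |x|^3 add
  up to 11/12.\<close>

lemma iexp_factorization_bound:
  fixes x :: real
  assumes "\<bar>x\<bar> \<le> 1"
  shows "cmod (iexp x - (1 + \<i> * x) * exp (- (x\<^sup>2) / 2)) \<le> \<bar>x\<bar> ^ 3"
proof -
  define E where "E = exp (- (x\<^sup>2 / 2)) - (1 - x\<^sup>2 / 2)"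
  define T where "T = iexp x - (\<Sum>k\<le>2. (\<i> * x) ^ k / fact k)"
  have split: "iexp x - (1 + \<i> * x) * exp (- (x\<^sup>2) / 2)
    = T + \<i> * of_real (x ^ 3 / 2) - (1 + \<i> * x) * of_real E"
    unfolding T_def E_def
    by (simp add: numeral_2_eq_2 algebra_simps power2_eq_square power3_eq_cube exp_of_real[symmetric])
  have T: "cmod T \<le> \<bar>x\<bar> ^ 3 / 6"
    using iexp_approx1[of x 2] unfolding T_def by (simp add: eval_nat_numeral)
  have "cmod ((1 + \<i> * x) * of_real E) \<le> 2 * ((x\<^sup>2 / 2)\<^sup>2 / 2)"
  proof -
    have "cmod (1 + \<i> * x) \<le> 1 + \<bar>x\<bar>" using norm_triangle_ineq[of 1 "\<i> * x"] by (simp add: norm_mult)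
    then show ?thesis using exp_minus_Taylor_bound[of "x\<^sup>2 / 2"] assms
      unfolding norm_mult E_def[symmetric] by (intro mult_mono) auto
  qed
  also have "2 * ((x\<^sup>2 / 2)\<^sup>2 / 2) = \<bar>x\<bar> ^ 3 * (\<bar>x\<bar> / 4)"
    by (simp add: power2_eq_square power3_eq_cube abs_mult[symmetric])
  also have "\<dots> \<le> \<bar>x\<bar> ^ 3 * (1 / 4)" using assms by (intro mult_left_mono) auto
  finally have E: "cmod ((1 + \<i> * x) * of_real E) \<le> \<bar>x\<bar> ^ 3 * (1 / 4)" .
  have C: "cmod (\<i> * of_real (x ^ 3 / 2)) = \<bar>x\<bar> ^ 3 / 2" by (simp add: norm_mult power_abs norm_power)
  have "cmod (T + \<i> * of_real (x ^ 3 / 2) - (1 + \<i> * x) * of_real E)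
    \<le> \<bar>x\<bar> ^ 3 / 6 + \<bar>x\<bar> ^ 3 / 2 + \<bar>x\<bar> ^ 3 * (1 / 4)"
    using T E C by (intro order_trans[OF norm_triangle_ineq4] order_trans[OF norm_triangle_ineq] add_mono) auto
  also have "\<dots> \<le> \<bar>x\<bar> ^ 3" by simp
  finally show ?thesis unfolding split .
qed

section \<open>Increments with vanishing conditional mean\<close>

text \<open>The integral of the sum is the sum of the integrals, so the sum is finite almost
  everywhere. This takes the role of a Borel-Cantelli argument.\<close>

lemma AE_summable_if_summable_integrals:
  fixes u :: "nat \<Rightarrow> 'a \<Rightarrow> real"
  assumes int: "\<And>k. integrable M (u k)" and nonneg: "\<And>k. AE w in M. 0 \<le> u k w"
    and summable: "summable (\<lambda>k. \<integral>w. u k w \<partial>M)"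
  shows "AE w in M. summable (\<lambda>k. u k w)"
proof -
  have [measurable]: "u k \<in> borel_measurable M" for k using int by auto
  have "(\<integral>\<^sup>+w. (\<Sum>k. ennreal (u k w)) \<partial>M) = (\<Sum>k. \<integral>\<^sup>+w. ennreal (u k w) \<partial>M)"
    by (rule nn_integral_suminf) measurable
  also have "\<dots> = (\<Sum>k. ennreal (\<integral>w. u k w \<partial>M))"
    by (intro suminf_cong nn_integral_eq_integral int nonneg)
  also have "\<dots> \<noteq> \<infinity>"
    using summable by (subst suminf_ennreal2) (auto intro!: integral_nonneg_AE nonneg)
  finally have "AE w in M. (\<Sum>k. ennreal (u k w)) \<noteq> \<infinity>"
    by (intro nn_integral_noteq_infinite) auto
  moreover have "AE w in M. \<forall>k. 0 \<le> u k w" using nonneg by (simp add: AE_all_countable)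
  ultimately show ?thesis
    by eventually_elim (auto intro: summable_suminf_not_top)
qed

locale filtered_prob_space = prob_space M for M :: "'a measure" +
  fixes F :: "nat \<Rightarrow> 'a measure"
  assumes subalgebra_F: "subalgebra M (F n)"
    and subalgebra_Suc: "subalgebra (F (Suc n)) (F n)"
begin

lemma F_measurable: "f \<in> measurable (F n) S \<Longrightarrow> f \<in> measurable M S"
  by (rule measurable_from_subalg[OF subalgebra_F])

lemma F_measurable_mono: "f \<in> measurable (F m) S \<Longrightarrow> m \<le> n \<Longrightarrow> f \<in> measurable (F n) S"
proof (induction n rule: nat_induct)
  case (Suc n)
  then show ?case
    by (cases "m = Suc n") (auto intro: measurable_from_subalg[OF subalgebra_Suc])
qed auto

sublocale cond: sigma_finite_subalgebra M "F n" for n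
proof -
  have "finite_measure_subalgebra M (F n)"
    by unfold_locales (rule subalgebra_F)
  then show "sigma_finite_subalgebra M (F n)" by (rule finite_measure_subalgebra_is_sigma_finite)
qed

lemma integrable_AE_bounded:
  fixes f :: "'a \<Rightarrow> 'b :: {banach, second_countable_topology}"
  assumes "f \<in> borel_measurable M" "AE w in M. norm (f w) \<le> c"
  shows "integrable M f"
  using assms by (intro integrable_const_bound)

end

text \<open>With constants \<open>c n\<close> as bounds, products of increments with bounded factors
  are integrable at once.\<close>

locale bounded_increments = filtered_prob_space M F for M :: "'a measure" and F +
  fixes d :: "nat \<Rightarrow> 'a \<Rightarrow> real" and c :: "nat \<Rightarrow> real"
  assumes adapted: "d n \<in> borel_measurable (F (Suc n))"
    and bounded: "AE w in M. \<bar>d n w\<bar> \<le> c n"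
    and centered: "AE w in M. real_cond_exp M (F n) (d n) w = 0"
begin

lemma d_measurable [measurable]: "d n \<in> borel_measurable M"
  by (rule F_measurable[OF adapted])

lemma c_nonneg: "0 \<le> c n"
proof -
  have "AE w in M. 0 \<le> c n" using bounded[of n] by eventually_elim auto
  then show ?thesis by simp
qed

lemma bounded_all: "AE w in M. \<forall>n. \<bar>d n w\<bar> \<le> c n"
  using bounded by (simp add: AE_all_countable)

text \<open>The vanishing conditional mean enters the estimates only through this orthogonality:
  with \<open>g\<close> a partial sum it gives the variance bound, and its complex version keeps the
  expectation of a product martingale constant.\<close>

lemma orthogonal:
  assumes g: "g \<in> borel_measurable (F n)" and b: "AE w in M. \<bar>g w\<bar> \<le> b"
  shows "(\<integral>w. g w * d n w \<partial>M) = 0"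
proof -
  have [measurable]: "g \<in> borel_measurable M" by (rule F_measurable[OF g])
  have "integrable M (\<lambda>w. g w * d n w)"
  proof (rule integrable_AE_bounded[where c = "b * c n"])
    show "AE w in M. norm (g w * d n w) \<le> b * c n"
      using b bounded[of n] by eventually_elim (auto simp: abs_mult intro!: mult_mono)
  qed measurable
  then have "(\<integral>w. g w * d n w \<partial>M) = (\<integral>w. g w * real_cond_exp M (F n) (d n) w \<partial>M)"
    using g by (intro cond.real_cond_exp_intg(2)[symmetric]) auto
  also have "\<dots> = (\<integral>w. 0 \<partial>M)"
    using centered[of n] by (intro integral_cong_AE) (auto intro: F_measurable borel_measurable_cond_exp)
  finally show ?thesis by simp
qed

lemma orthogonal_complex:
  fixes g :: "'a \<Rightarrow> complex"
  assumes g: "g \<in> borel_measurable (F n)" and b: "AE w in M. cmod (g w) \<le> b"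
  shows "(\<integral>w. g w * of_real (d n w) \<partial>M) = 0"
proof -
  have [measurable]: "g \<in> borel_measurable M" by (rule F_measurable[OF g])
  have int: "integrable M (\<lambda>w. g w * of_real (d n w))"
  proof (rule integrable_AE_bounded[where c = "b * c n"])
    show "AE w in M. cmod (g w * of_real (d n w)) \<le> b * c n"
      using b bounded[of n]
    proof eventually_elim
      case (elim w)
      have "0 \<le> b" using elim(1) norm_ge_zero order_trans by blast
      with elim show ?case by (auto simp: norm_mult intro!: mult_mono)
    qed
  qed measurable
  have "Re (\<integral>w. g w * of_real (d n w) \<partial>M) = (\<integral>w. Re (g w) * d n w \<partial>M)"
    by (subst integral_Re[OF int, symmetric]) simp
  also have "\<dots> = 0"
    using g b by (intro orthogonal[where b = b]) (auto elim!: eventually_mono intro: order_trans[OF abs_Re_le_cmod])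
  finally have re: "Re (\<integral>w. g w * of_real (d n w) \<partial>M) = 0" .
  have "Im (\<integral>w. g w * of_real (d n w) \<partial>M) = (\<integral>w. Im (g w) * d n w \<partial>M)"
    by (subst integral_Im[OF int, symmetric]) simp
  also have "\<dots> = 0"
    using g b by (intro orthogonal[where b = b]) (auto elim!: eventually_mono intro: order_trans[OF abs_Im_le_cmod])
  finally show ?thesis using re by (simp add: complex_eq_iff)
qed

lemma increment_measurable:
  "(\<lambda>w. \<Sum>j=n..<k. d j w) \<in> borel_measurable (F k)"
  by (intro borel_measurable_sum) (auto intro: F_measurable_mono[OF adapted])

lemma increment_bound: "AE w in M. \<bar>\<Sum>j=n..<k. d j w\<bar> \<le> (\<Sum>j=n..<k. c j)"
  using bounded_all by eventually_elim (intro order_trans[OF sum_abs] sum_mono, auto)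

lemma increment_square_integrable: "integrable M (\<lambda>w. (\<Sum>j=n..<k. d j w)\<^sup>2)"
proof (rule integrable_AE_bounded[where c = "(\<Sum>j=n..<k. c j)\<^sup>2"])
  show "AE w in M. norm ((\<Sum>j=n..<k. d j w)\<^sup>2) \<le> (\<Sum>j=n..<k. c j)\<^sup>2"
    using increment_bound[of n k] by eventually_elim (auto simp: abs_le_square_iff[symmetric] intro: order_trans)
qed measurable

text \<open>The mixed terms vanish by \<open>orthogonal\<close>, so the second moments add
  up.\<close>

lemma increment_variance:
  assumes "n \<le> k"
  shows "(\<integral>w. (\<Sum>j=n..<k. d j w)\<^sup>2 \<partial>M) \<le> (\<Sum>j=n..<k. (c j)\<^sup>2)"
  using assms
proof (induction k rule: dec_induct)
  case (step k)
  have sq: "integrable M (\<lambda>w. (d k w)\<^sup>2)"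
    using increment_square_integrable[of k "Suc k"] by simp
  have "integrable M (\<lambda>w. (\<Sum>j=n..<k. d j w) * d k w)"
  proof (rule integrable_AE_bounded[where c = "(\<Sum>j=n..<k. c j) * c k"])
    show "AE w in M. norm ((\<Sum>j=n..<k. d j w) * d k w) \<le> (\<Sum>j=n..<k. c j) * c k"
      using increment_bound[of n k] bounded[of k]
      by eventually_elim (auto simp: abs_mult intro!: mult_mono sum_nonneg c_nonneg)
  qed measurable
  then have "(\<integral>w. (\<Sum>j=n..<Suc k. d j w)\<^sup>2 \<partial>M)
    = (\<integral>w. (\<Sum>j=n..<k. d j w)\<^sup>2 \<partial>M) + 2 * (\<integral>w. (\<Sum>j=n..<k. d j w) * d k w \<partial>M) + (\<integral>w. (d k w)\<^sup>2 \<partial>M)"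
    using step(1) sq increment_square_integrable[of n k] by (simp add: power2_sum mult.assoc)
  also have "(\<integral>w. (\<Sum>j=n..<k. d j w) * d k w \<partial>M) = 0"
    by (rule orthogonal[OF increment_measurable increment_bound])
  also have "(\<integral>w. (d k w)\<^sup>2 \<partial>M) \<le> (\<integral>w. (c k)\<^sup>2 \<partial>M)"
    using sq bounded[of k]
    by (intro integral_mono_AE) (auto elim!: eventually_mono simp: abs_le_square_iff[symmetric] intro: order_trans)
  finally show ?case using step by (simp add: prob_space)
qed simp

end

section \<open>Almost sure convergence of averages and of series\<close>

context filtered_prob_space
begin

text \<open>At n = k^3 the average has second moment at most c^2 / k^3, which is summable, so it
  tends to 0 along the cubes. \<open>LIMSEQ_from_cubes\<close> closes the gaps: one more term
  changes the average by (d_n - average) / (n + 1).\<close>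

lemma averages_of_centered:
  assumes "bounded_increments M F d (\<lambda>_. c)"
  shows "AE w in M. (\<lambda>n. (\<Sum>j<n. d j w) / real n) \<longlonglongrightarrow> 0"
proof -
  interpret bounded_increments M F d "\<lambda>_. c" by fact
  define u where "u k w = ((\<Sum>j=0..<k ^ 3. d j w) / real (k ^ 3))\<^sup>2" for k w
  have u_int: "integrable M (u k)" for k
    unfolding u_def power_divide using increment_square_integrable[of 0 "k ^ 3"] by simp
  have "summable (\<lambda>k. \<integral>w. u k w \<partial>M)"
  proof (rule summable_comparison_test_ev)
    show "summable (\<lambda>k. c\<^sup>2 * (1 / real k ^ 3))"
      using inverse_power_summable[of 3, where 'a = real] by (intro summable_mult) (simp add: field_simps)
    show "\<forall>\<^sub>F k in sequentially. norm (\<integral>w. u k w \<partial>M) \<le> c\<^sup>2 * (1 / real k ^ 3)"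
      using eventually_gt_at_top[of 0]
    proof eventually_elim
      case (elim k)
      have "(\<integral>w. u k w \<partial>M) = (\<integral>w. (\<Sum>j=0..<k ^ 3. d j w)\<^sup>2 \<partial>M) / (real (k ^ 3))\<^sup>2"
        unfolding u_def power_divide by simp
      also have "\<dots> \<le> (\<Sum>j=0..<k ^ 3. c\<^sup>2) / (real (k ^ 3))\<^sup>2"
        by (intro divide_right_mono increment_variance) auto
      also have "\<dots> = c\<^sup>2 * (1 / real k ^ 3)" using elim by (simp add: power2_eq_square[of "real k ^ 3"] divide_simps)
      finally show ?case by (simp add: u_def)
    qed
  qed
  then have "AE w in M. summable (\<lambda>k. u k w)"
    by (intro AE_summable_if_summable_integrals u_int) (simp add: u_def)
  then show ?thesis using bounded_all
  proof eventually_elim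
    case (elim w)
    let ?v = "\<lambda>n. (\<Sum>j<n. d j w) / real n"
    have c: "0 \<le> c" using c_nonneg .
    have "(\<lambda>k. (?v (k ^ 3))\<^sup>2) \<longlonglongrightarrow> 0"
      using summable_LIMSEQ_zero[OF elim(1)] by (simp add: u_def lessThan_atLeast0)
    from tendsto_real_sqrt[OF this] have lim: "(\<lambda>k. ?v (k ^ 3)) \<longlonglongrightarrow> 0"
      by (simp add: real_sqrt_abs tendsto_rabs_zero_iff del: abs_divide)
    show ?case
    proof (rule LIMSEQ_from_cubes[OF lim, where c = "2 * c"])
      fix n
      show "\<bar>?v (Suc n) - ?v n\<bar> \<le> 2 * c / real (Suc n)"
      proof (cases "n = 0")
        case True
        then show ?thesis using elim(2) c by (auto intro: order_trans[of _ c])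
      next
        case False
        have "\<bar>\<Sum>j<n. d j w\<bar> \<le> (\<Sum>j<n. c)" using elim(2) by (intro order_trans[OF sum_abs] sum_mono) auto
        then have b: "\<bar>?v n\<bar> \<le> c" using False by (simp add: abs_divide divide_simps mult.commute)
        have "?v (Suc n) - ?v n = (d n w - ?v n) / real (Suc n)" using False by (simp add: field_simps)
        moreover have "\<bar>d n w - ?v n\<bar> \<le> 2 * c"
          using b elim(2)[rule_format, of n] abs_triangle_ineq4[of "d n w" "?v n"] by linarith
        ultimately show ?thesis by (auto simp: abs_divide intro!: divide_right_mono)
      qed
    qed
  qed
qed

text \<open>Subtracting the conditional expectations leaves centered increments bounded by 2c, whose
  averages vanish; the averages of the conditional expectations converge by Cesaro.\<close>

lemma strong_law_of_large_numbers:
  assumes adapted: "\<And>n. Y n \<in> borel_measurable (F (Suc n))"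
    and bounded: "\<And>n. AE w in M. \<bar>Y n w\<bar> \<le> c"
    and lim: "AE w in M. (\<lambda>n. real_cond_exp M (F n) (Y n) w) \<longlonglongrightarrow> y w"
  shows "AE w in M. (\<lambda>n. (\<Sum>j<n. Y j w) / real n) \<longlonglongrightarrow> y w"
proof -
  let ?e = "\<lambda>n. real_cond_exp M (F n) (Y n)"
  have [measurable]: "Y n \<in> borel_measurable M" for n by (rule F_measurable[OF adapted])
  have int: "integrable M (Y n)" for n
    using bounded by (intro integrable_AE_bounded[where c = c]) auto
  have "AE w in M. (\<lambda>n. (\<Sum>j<n. Y j w - ?e j w) / real n) \<longlonglongrightarrow> 0"
  proof (rule averages_of_centered[where c = "2 * c"], unfold_locales)
    fix n
    have eF: "?e n \<in> borel_measurable (F n)" by (rule borel_measurable_cond_exp)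
    then have eS: "?e n \<in> borel_measurable (F (Suc n))" by (rule F_measurable_mono) simp
    show "(\<lambda>w. Y n w - ?e n w) \<in> borel_measurable (F (Suc n))"
      using adapted eS by (rule borel_measurable_diff)
    have "AE w in M. ?e n w \<le> c"
      using bounded[of n] by (intro cond.real_cond_exp_le_c int) (auto elim!: eventually_mono)
    moreover have "AE w in M. - c \<le> ?e n w"
      using bounded[of n] by (intro cond.real_cond_exp_ge_c int) (auto elim!: eventually_mono)
    ultimately show "AE w in M. \<bar>Y n w - ?e n w\<bar> \<le> 2 * c"
      using bounded[of n] by eventually_elim auto
    show "AE w in M. real_cond_exp M (F n) (\<lambda>w. Y n w - ?e n w) w = 0"
      using cond.real_cond_exp_diff[OF int[of n] cond.real_cond_exp_int(1)[OF int[of n], of n], of n]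
        cond.real_cond_exp_F_meas[OF cond.real_cond_exp_int(1)[OF int[of n], of n] eF]
      by eventually_elim auto
  qed
  then show ?thesis using lim
  proof eventually_elim
    case (elim w)
    have "(\<lambda>n. (\<Sum>j<n. Y j w - ?e j w) / real n + (\<Sum>j<n. ?e j w) / real n) \<longlonglongrightarrow> 0 + y w"
      by (intro tendsto_add elim Cesaro_mean)
    then show ?case by (simp add: sum_subtractf diff_divide_distrib)
  qed
qed

text \<open>The blocks between consecutive cubes form an almost surely absolutely summable series,
  which gives convergence along the cubes. Single increments are O(1/n), so
  \<open>LIMSEQ_from_cubes\<close> gives the rest.\<close>

lemma centered_series_converges:
  assumes "bounded_increments M F d (\<lambda>n. c / real (Suc n))"
  shows "AE w in M. convergent (\<lambda>n. \<Sum>j<n. d j w)"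
proof -
  interpret bounded_increments M F d "\<lambda>n. c / real (Suc n)" by fact
  have c: "0 \<le> c" using c_nonneg[of 0] by simp
  define b where "b k w = (\<Sum>j=k ^ 3..<Suc k ^ 3. d j w)" for k w
  \<comment> \<open>A block has second moment at most 7k^2 (c/k^3)^2 = 7c^2/k^4. The weight k^2
    leaves the summable 7c^2/k^2 and suffices to pass from the squares to the blocks themselves, by
    |y| <= x^2 y^2 + 1/x^2 with x = k.\<close>
  have b_int: "integrable M (\<lambda>w. (real k)\<^sup>2 * (b k w)\<^sup>2)" for k
    unfolding b_def by (intro integrable_mult_right increment_square_integrable)
  have "summable (\<lambda>k. \<integral>w. (real k)\<^sup>2 * (b k w)\<^sup>2 \<partial>M)"
  proof (rule summable_comparison_test_ev)
    show "summable (\<lambda>k. 7 * c\<^sup>2 * (1 / real k ^ 2))"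
      using inverse_power_summable[of 2, where 'a = real] by (intro summable_mult) (simp add: field_simps)
    show "\<forall>\<^sub>F k in sequentially. norm (\<integral>w. (real k)\<^sup>2 * (b k w)\<^sup>2 \<partial>M) \<le> 7 * c\<^sup>2 * (1 / real k ^ 2)"
      using eventually_gt_at_top[of 0]
    proof eventually_elim
      case (elim k)
      have "(\<integral>w. (b k w)\<^sup>2 \<partial>M) \<le> (\<Sum>j=k ^ 3..<Suc k ^ 3. (c / real (Suc j))\<^sup>2)"
        unfolding b_def by (intro increment_variance power_mono) auto
      also have "\<dots> \<le> (\<Sum>j=k ^ 3..<Suc k ^ 3. (c / real k ^ 3)\<^sup>2)"
        using elim c by (intro sum_mono power_mono divide_left_mono)
          (auto simp: of_nat_power[symmetric] simp del: of_nat_power)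
      also have "\<dots> = real (Suc k ^ 3 - k ^ 3) * (c / real k ^ 3)\<^sup>2" by simp
      also have "\<dots> \<le> (7 * (real k)\<^sup>2) * (c / real k ^ 3)\<^sup>2"
      proof (intro mult_right_mono)
        have "Suc k ^ 3 - k ^ 3 \<le> 7 * k\<^sup>2" using elim
          by (cases k) (auto simp: power2_eq_square power3_eq_cube algebra_simps)
        then have "real (Suc k ^ 3 - k ^ 3) \<le> real (7 * k\<^sup>2)" by (rule of_nat_mono)
        then show "real (Suc k ^ 3 - k ^ 3) \<le> 7 * (real k)\<^sup>2" by simp
      qed simp
      finally have "(real k)\<^sup>2 * (\<integral>w. (b k w)\<^sup>2 \<partial>M) \<le> (real k)\<^sup>2 * ((7 * (real k)\<^sup>2) * (c / real k ^ 3)\<^sup>2)"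
        by (intro mult_left_mono) auto
      also have "\<dots> = 7 * c\<^sup>2 * (1 / real k ^ 2)" using elim by (simp add: power2_eq_square power3_eq_cube)
      finally show ?case by simp
    qed
  qed
  then have "AE w in M. summable (\<lambda>k. (real k)\<^sup>2 * (b k w)\<^sup>2)"
    using b_int by (intro AE_summable_if_summable_integrals) auto
  then show ?thesis using bounded_all
  proof eventually_elim
    case (elim w)
    have "summable (\<lambda>k. b k w)"
    proof (rule summable_comparison_test_ev)
      show "summable (\<lambda>k. (real k)\<^sup>2 * (b k w)\<^sup>2 + 1 / real k ^ 2)"
        using inverse_power_summable[of 2, where 'a = real] by (intro summable_add elim) (simp add: field_simps)
      have am_gm: "\<bar>y\<bar> \<le> x\<^sup>2 * y\<^sup>2 + 1 / x ^ 2" if "0 < x" for x y :: real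
      proof -
        have "0 \<le> (x * \<bar>y\<bar> - 1 / x)\<^sup>2" by simp
        also have "\<dots> = x\<^sup>2 * y\<^sup>2 + 1 / x ^ 2 - 2 * \<bar>y\<bar>"
          using that by (simp add: power2_diff power_mult_distrib power_divide)
        finally show ?thesis by linarith
      qed
      show "\<forall>\<^sub>F k in sequentially. norm (b k w) \<le> (real k)\<^sup>2 * (b k w)\<^sup>2 + 1 / real k ^ 2"
        using eventually_gt_at_top[of "0::nat"] by eventually_elim (simp add: am_gm)
    qed
    then have "convergent (\<lambda>k. \<Sum>i<k. b i w)" by (simp add: summable_iff_convergent)
    moreover have "(\<Sum>i<k. b i w) = (\<Sum>j<k ^ 3. d j w)" for k
    proof (induction k)
      case (Suc k)
      have "(\<Sum>j<Suc k ^ 3. d j w) = (\<Sum>j<k ^ 3. d j w) + b k w"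
        unfolding b_def lessThan_atLeast0 by (rule sum.atLeastLessThan_concat[symmetric]) (auto intro!: power_mono)
      with Suc show ?case by simp
    qed simp
    ultimately obtain L where "(\<lambda>k. \<Sum>j<k ^ 3. d j w) \<longlonglongrightarrow> L" by (auto simp: convergent_def)
    then have "(\<lambda>n. \<Sum>j<n. d j w) \<longlonglongrightarrow> L"
      by (rule LIMSEQ_from_cubes[where c = c]) (use elim(2) in auto)
    then show ?case by (rule convergentI)
  qed
qed

end

section \<open>A martingale central limit theorem with random scaling\<close>

text \<open>The lower bound permits division by such a factor without enlarging an error; the upper
  bound keeps a product of them below the exponential of half the sum of squares.\<close>

lemma norm_one_plus_imaginary:
  "1 \<le> cmod (1 + \<i> * of_real x)" "cmod (1 + \<i> * of_real x) \<le> exp (x\<^sup>2 / 2)"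
proof -
  have eq: "cmod (1 + \<i> * of_real x) = sqrt (1 + x\<^sup>2)" by (simp add: cmod_def)
  then show "1 \<le> cmod (1 + \<i> * of_real x)" by simp
  have "1 + x\<^sup>2 \<le> exp (x\<^sup>2)" by (rule exp_ge_add_one_self)
  also have "\<dots> = (exp (x\<^sup>2 / 2))\<^sup>2" by (simp add: power2_eq_square exp_add[symmetric])
  finally have "sqrt (1 + x\<^sup>2) \<le> exp (x\<^sup>2 / 2)" by (intro real_le_lsqrt) auto
  then show "cmod (1 + \<i> * of_real x) \<le> exp (x\<^sup>2 / 2)" by (simp add: eq)
qed

text \<open>Dividing each exp(i x_j) by 1 + i x_j leaves numbers in the unit disc, each within
  |x_j|^3 <= \<epsilon> x_j^2 of its Gaussian factor. Products of numbers in the unit disc differ by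
  at most the sum of the differences of their factors; multiplying back costs the modulus of the
  product of the 1 + i x_j.\<close>

lemma iexp_sum_factorization:
  fixes x :: "'i \<Rightarrow> real"
  assumes small: "\<And>j. j \<in> J \<Longrightarrow> \<bar>x j\<bar> \<le> \<epsilon>" and "\<epsilon> \<le> 1" and fin: "finite J"
  shows "cmod (iexp (\<Sum>j\<in>J. x j) - (\<Prod>j\<in>J. 1 + \<i> * of_real (x j)) * of_real (exp (- (\<Sum>j\<in>J. (x j)\<^sup>2) / 2)))
    \<le> exp ((\<Sum>j\<in>J. (x j)\<^sup>2) / 2) * (\<epsilon> * (\<Sum>j\<in>J. (x j)\<^sup>2))"
proof -
  let ?f = "\<lambda>j. 1 + \<i> * complex_of_real (x j)"
  let ?w = "\<lambda>j. complex_of_real (exp (- ((x j)\<^sup>2) / 2))"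
  have f: "1 \<le> cmod (?f j)" for j by (rule norm_one_plus_imaginary)
  have f0: "?f j \<noteq> 0" for j
  proof
    assume "?f j = 0"
    then have "cmod (?f j) = 0" by (simp only: norm_zero)
    moreover have "1 \<le> cmod (?f j)" by (rule f)
    ultimately show False by linarith
  qed
  have diff: "cmod (iexp (x j) / ?f j - ?w j) \<le> \<epsilon> * (x j)\<^sup>2" if "j \<in> J" for j
  proof -
    have "iexp (x j) / ?f j - ?w j = (iexp (x j) - ?f j * ?w j) / ?f j" using f0[of j] by (simp add: field_simps)
    then have "cmod (iexp (x j) / ?f j - ?w j) = cmod (iexp (x j) - ?f j * ?w j) / cmod (?f j)"
      by (simp only: norm_divide)
    also have "\<dots> \<le> cmod (iexp (x j) - ?f j * ?w j) / 1" using f[of j] f0[of j] by (intro divide_left_mono) auto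
    also have "\<dots> \<le> \<bar>x j\<bar> ^ 3" using iexp_factorization_bound[of "x j"] small[OF that] \<open>\<epsilon> \<le> 1\<close>
      by (simp add: exp_of_real[symmetric])
    also have "\<dots> = \<bar>x j\<bar> * (x j)\<^sup>2" by (simp add: power2_eq_square power3_eq_cube abs_mult[symmetric])
    also have "\<dots> \<le> \<epsilon> * (x j)\<^sup>2" using small[OF that] by (intro mult_right_mono) auto
    finally show ?thesis .
  qed
  have "cmod ((\<Prod>j\<in>J. iexp (x j) / ?f j) - (\<Prod>j\<in>J. ?w j)) \<le> (\<Sum>j\<in>J. cmod (iexp (x j) / ?f j - ?w j))"
  proof (rule norm_prod_diff)
    show "norm (iexp (x j) / ?f j) \<le> 1" for j using f[of j] by (simp add: norm_divide divide_le_eq_1)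
  qed simp
  also have "\<dots> \<le> (\<Sum>j\<in>J. \<epsilon> * (x j)\<^sup>2)" by (intro sum_mono diff)
  also have "\<dots> = \<epsilon> * (\<Sum>j\<in>J. (x j)\<^sup>2)" by (simp add: sum_distrib_left)
  finally have *: "cmod ((\<Prod>j\<in>J. iexp (x j) / ?f j) - (\<Prod>j\<in>J. ?w j)) \<le> \<epsilon> * (\<Sum>j\<in>J. (x j)\<^sup>2)" .
  have "cmod (\<Prod>j\<in>J. ?f j) = (\<Prod>j\<in>J. cmod (?f j))" by (rule prod_norm[symmetric])
  also have "\<dots> \<le> (\<Prod>j\<in>J. exp ((x j)\<^sup>2 / 2))" by (intro prod_mono) (use norm_one_plus_imaginary in auto)
  also have "\<dots> = exp ((\<Sum>j\<in>J. (x j)\<^sup>2) / 2)" by (simp add: exp_sum[OF fin] sum_divide_distrib)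
  finally have T: "cmod (\<Prod>j\<in>J. ?f j) \<le> exp ((\<Sum>j\<in>J. (x j)\<^sup>2) / 2)" .
  have w: "of_real (exp (- (\<Sum>j\<in>J. (x j)\<^sup>2) / 2)) = (\<Prod>j\<in>J. ?w j)"
  proof -
    have "- (\<Sum>j\<in>J. (x j)\<^sup>2) / 2 = (\<Sum>j\<in>J. - ((x j)\<^sup>2) / 2)" by (simp add: sum_divide_distrib sum_negf)
    then show ?thesis by (simp add: exp_sum[OF fin])
  qed
  have e: "iexp (\<Sum>j\<in>J. x j) = (\<Prod>j\<in>J. ?f j) * (\<Prod>j\<in>J. iexp (x j) / ?f j)"
  proof -
    have "iexp (\<Sum>j\<in>J. x j) = (\<Prod>j\<in>J. iexp (x j))" by (simp add: sum_distrib_left exp_sum[OF fin])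
    also have "\<dots> = (\<Prod>j\<in>J. ?f j * (iexp (x j) / ?f j))" using f0 by (intro prod.cong) auto
    finally show ?thesis by (simp only: prod.distrib)
  qed
  have "cmod (iexp (\<Sum>j\<in>J. x j) - (\<Prod>j\<in>J. ?f j) * of_real (exp (- (\<Sum>j\<in>J. (x j)\<^sup>2) / 2)))
    = cmod (\<Prod>j\<in>J. ?f j) * cmod ((\<Prod>j\<in>J. iexp (x j) / ?f j) - (\<Prod>j\<in>J. ?w j))"
    unfolding e w norm_mult[symmetric] by (simp only: right_diff_distrib)
  also have "\<dots> \<le> exp ((\<Sum>j\<in>J. (x j)\<^sup>2) / 2) * (\<epsilon> * (\<Sum>j\<in>J. (x j)\<^sup>2))"
    using T * by (intro mult_mono) auto
  finally show ?thesis .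
qed

text \<open>The comparison 1/y^2 <= 2/(y(y+1)) for y >= 1 makes the sum of the squares telescope to
  at most 2/(n+1), which absorbs the factor n. The bound depends neither on n nor on k, and so
  bounds the product martingale uniformly.\<close>

lemma sqrt_scaled_square_sum_le:
  fixes y :: "nat \<Rightarrow> real"
  assumes y: "\<And>j. \<bar>y j\<bar> \<le> \<kappa> / real (Suc j)" and s: "\<bar>s\<bar> \<le> \<sigma>" and "n \<le> k"
  shows "(\<Sum>j=n..<k. (sqrt (real n) * s * y j)\<^sup>2) \<le> 2 * (\<sigma> * \<kappa>)\<^sup>2"
proof -
  have \<kappa>: "0 \<le> \<kappa>" using y[of 0] by simp
  have "(sqrt (real n) * s * y j)\<^sup>2 \<le> real n * (\<sigma> * \<kappa>)\<^sup>2 * (2 * (1 / (real (j + 1) * real (j + 2))))" for j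
  proof -
    have "\<bar>s * y j\<bar> \<le> \<sigma> * (\<kappa> / real (Suc j))" unfolding abs_mult using s y \<kappa> by (intro mult_mono) auto
    then have "(s * y j)\<^sup>2 \<le> (\<sigma> * (\<kappa> / real (Suc j)))\<^sup>2" by (intro power2_le_iff_abs_le[THEN iffD2] order_trans[OF abs_ge_zero]) auto
    also have "\<dots> = (\<sigma> * \<kappa>)\<^sup>2 * (1 / (real (j + 1))\<^sup>2)" by (simp add: power_mult_distrib power_divide)
    also have "\<dots> \<le> (\<sigma> * \<kappa>)\<^sup>2 * (2 * (1 / (real (j + 1) * real (j + 2))))"
    proof (intro mult_left_mono)
      have "1 / y\<^sup>2 \<le> 2 * (1 / (y * (y + 1)))" if "1 \<le> y" for y :: real
        using that by (simp add: power2_eq_square divide_simps mult_left_mono)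
      from this[of "real (j + 1)"] show "1 / (real (j + 1))\<^sup>2 \<le> 2 * (1 / (real (j + 1) * real (j + 2)))"
        by (simp add: add_ac)
    qed simp
    finally have "real n * (s * y j)\<^sup>2 \<le> real n * ((\<sigma> * \<kappa>)\<^sup>2 * (2 * (1 / (real (j + 1) * real (j + 2)))))"
      by (intro mult_left_mono) auto
    then show ?thesis by (simp add: power_mult_distrib mult_ac)
  qed
  then have "(\<Sum>j=n..<k. (sqrt (real n) * s * y j)\<^sup>2)
    \<le> (\<Sum>j=n..<k. real n * (\<sigma> * \<kappa>)\<^sup>2 * (2 * (1 / (real (j + 1) * real (j + 2)))))" by (rule sum_mono)
  also have "\<dots> = real n * (\<sigma> * \<kappa>)\<^sup>2 * (2 * (1 / real (n + 1) - 1 / real (k + 1)))"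
    by (simp only: sum_distrib_left[symmetric] sum_inverse_consecutive[OF \<open>n \<le> k\<close>])
  also have "\<dots> \<le> real n * (\<sigma> * \<kappa>)\<^sup>2 * (2 * (1 / real (n + 1)))" by (intro mult_left_mono) auto
  also have "\<dots> = 2 * (\<sigma> * \<kappa>)\<^sup>2 * (real n / real (n + 1))" by simp
  also have "\<dots> \<le> 2 * (\<sigma> * \<kappa>)\<^sup>2 * 1" by (intro mult_left_mono) auto
  finally show ?thesis by simp
qed

text \<open>
  \<open>s n\<close> rescales the increments from time \<open>n\<close> on, and the characteristic function of the rescaled tail
  is compared with \<open>L n\<close>. Both are known at time \<open>n\<close>, so that the martingale \<open>T n\<close> below satisfies
  \<open>E (T n m * L n) = E (L n)\<close> although \<open>L n\<close> is random.
\<close>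

locale tail_increments = bounded_increments M F d "\<lambda>n. \<kappa> / real (Suc n)"
  for M :: "'a measure" and F d and \<kappa> :: real +
  fixes s L :: "nat \<Rightarrow> 'a \<Rightarrow> real" and \<sigma> :: real and k :: "nat \<Rightarrow> nat"
  assumes s_measurable: "s n \<in> borel_measurable (F n)" and s_bound: "\<bar>s n w\<bar> \<le> \<sigma>"
    and L_measurable: "L n \<in> borel_measurable (F n)" and L_bounds: "0 \<le> L n w" "L n w \<le> 1"
    and le_k: "n \<le> k n"
begin

definition x :: "nat \<Rightarrow> nat \<Rightarrow> 'a \<Rightarrow> real" where
  "x n j w = sqrt (real n) * s n w * d j w"

definition T :: "nat \<Rightarrow> nat \<Rightarrow> 'a \<Rightarrow> complex" where
  "T n m w = (\<Prod>j=n..<m. 1 + \<i> * of_real (x n j w))"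

lemma s_M [measurable]: "s n \<in> borel_measurable M" by (rule F_measurable[OF s_measurable])
lemma L_M [measurable]: "L n \<in> borel_measurable M" by (rule F_measurable[OF L_measurable])
lemma x_M [measurable]: "x n j \<in> borel_measurable M" unfolding x_def by measurable
lemma T_M [measurable]: "T n m \<in> borel_measurable M" unfolding T_def by measurable

lemma x_measurable: "n \<le> j \<Longrightarrow> x n j \<in> borel_measurable (F (Suc j))"
  unfolding x_def
  by (intro borel_measurable_times borel_measurable_const adapted F_measurable_mono[OF s_measurable]) auto

lemma T_measurable: "T n m \<in> borel_measurable (F m)"
  unfolding T_def
proof (intro borel_measurable_prod)
  fix j assume "j \<in> {n..<m}"
  then have "x n j \<in> borel_measurable (F m)" by (intro F_measurable_mono[OF x_measurable]) auto
  then show "(\<lambda>w. 1 + \<i> * complex_of_real (x n j w)) \<in> borel_measurable (F m)" by measurable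
qed

lemma square_sum_bound:
  "AE w in M. \<forall>n m. n \<le> m \<longrightarrow> (\<Sum>j=n..<m. (x n j w)\<^sup>2) \<le> 2 * (\<sigma> * \<kappa>)\<^sup>2"
  using bounded_all
  by eventually_elim (auto simp: x_def intro!: sqrt_scaled_square_sum_le s_bound)

lemma T_bound: "AE w in M. \<forall>n m. n \<le> m \<longrightarrow> cmod (T n m w) \<le> exp ((\<sigma> * \<kappa>)\<^sup>2)"
  using square_sum_bound
proof eventually_elim
  case (elim w)
  show ?case
  proof (intro allI impI)
    fix n m :: nat assume "n \<le> m"
    have "cmod (T n m w) = (\<Prod>j=n..<m. cmod (1 + \<i> * of_real (x n j w)))"
      unfolding T_def by (rule prod_norm[symmetric])
    also have "\<dots> \<le> (\<Prod>j=n..<m. exp ((x n j w)\<^sup>2 / 2))"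
      by (intro prod_mono) (use norm_one_plus_imaginary in auto)
    also have "\<dots> = exp ((\<Sum>j=n..<m. (x n j w)\<^sup>2) / 2)" by (simp add: exp_sum sum_divide_distrib)
    also have "\<dots> \<le> exp ((\<sigma> * \<kappa>)\<^sup>2)" using elim[rule_format, OF \<open>n \<le> m\<close>] by simp
    finally show "cmod (T n m w) \<le> exp ((\<sigma> * \<kappa>)\<^sup>2)" .
  qed
qed

lemma TL_bound: "n \<le> m \<Longrightarrow> AE w in M. cmod (T n m w * of_real (L n w)) \<le> exp ((\<sigma> * \<kappa>)\<^sup>2)"
proof -
  assume "n \<le> m"
  show ?thesis using T_bound
  proof eventually_elim
    case (elim w)
    have "cmod (T n m w * of_real (L n w)) \<le> exp ((\<sigma> * \<kappa>)\<^sup>2) * 1"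
      unfolding norm_mult using elim \<open>n \<le> m\<close> L_bounds[of n w] by (intro mult_mono) auto
    then show ?case by simp
  qed
qed

lemma integral_T_L:
  assumes "n \<le> m"
  shows "(\<integral>w. T n m w * of_real (L n w) \<partial>M) = (\<integral>w. of_real (L n w) \<partial>M)"
  using assms
proof (induction m rule: dec_induct)
  case base
  show ?case by (simp add: T_def)
next
  case (step m)
  \<comment> \<open>The product gains the factor 1 + i x at time m, so its increment is
    \<open>g\<close> times \<open>d m\<close> with \<open>g\<close> known at time m; orthogonality
    removes it from the expectation.\<close>
  define g where "g w = \<i> * of_real (sqrt (real n) * s n w) * (T n m w * of_real (L n w))" for w
  have g: "g \<in> borel_measurable (F m)"
  proof -
    have "s n \<in> borel_measurable (F m)" "L n \<in> borel_measurable (F m)"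
      using step by (auto intro: F_measurable_mono[OF s_measurable] F_measurable_mono[OF L_measurable])
    with T_measurable[of n m] show ?thesis unfolding g_def by measurable
  qed
  have g_bound: "AE w in M. cmod (g w) \<le> sqrt (real n) * \<sigma> * exp ((\<sigma> * \<kappa>)\<^sup>2)"
    using TL_bound[OF step(1)]
  proof eventually_elim
    case (elim w)
    have "cmod (g w) = sqrt (real n) * \<bar>s n w\<bar> * cmod (T n m w * of_real (L n w))"
      unfolding g_def by (simp add: norm_mult abs_mult)
    also have "\<dots> \<le> sqrt (real n) * \<sigma> * exp ((\<sigma> * \<kappa>)\<^sup>2)"
      using elim s_bound[of n w] by (intro mult_mono) (auto intro: order_trans[OF abs_ge_zero])
    finally show ?case .
  qed
  have [measurable]: "g \<in> borel_measurable M" by (rule F_measurable[OF g])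
  have "T n (Suc m) w * of_real (L n w) = T n m w * of_real (L n w) + g w * of_real (d m w)" for w
    using step(1) by (simp add: T_def g_def x_def algebra_simps)
  then have "(\<integral>w. T n (Suc m) w * of_real (L n w) \<partial>M)
    = (\<integral>w. T n m w * of_real (L n w) + g w * of_real (d m w) \<partial>M)" by simp
  also have "\<dots> = (\<integral>w. T n m w * of_real (L n w) \<partial>M) + (\<integral>w. g w * of_real (d m w) \<partial>M)"
  proof (rule Bochner_Integration.integral_add)
    show "integrable M (\<lambda>w. T n m w * of_real (L n w))"
      using TL_bound[OF step(1)] by (intro integrable_AE_bounded) auto
    show "integrable M (\<lambda>w. g w * of_real (d m w))"
    proof (rule integrable_AE_bounded)
      show "AE w in M. norm (g w * of_real (d m w)) \<le> (sqrt (real n) * \<sigma> * exp ((\<sigma> * \<kappa>)\<^sup>2)) * (\<kappa> / real (Suc m))"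
        using g_bound bounded[of m]
      proof eventually_elim
        case (elim w)
        have "0 \<le> sqrt (real n) * \<sigma> * exp ((\<sigma> * \<kappa>)\<^sup>2)" using elim(1) norm_ge_zero order_trans by blast
        with elim show ?case unfolding norm_mult by (intro mult_mono) auto
      qed
    qed measurable
  qed
  finally show ?case using step orthogonal_complex[OF g g_bound] by simp
qed

text \<open>The exponential splits as R + Q + T L. The factorization error R is O(1/sqrt n), because
  |x n j| <= \<sigma> \<kappa> / sqrt n for j >= n. Q = T (E - L) vanishes in mean, since T is
  bounded and E - L tends to 0 boundedly. The expectation of T L is exactly that of L.\<close>

lemma mixed_central_limit:
  assumes conv: "AE w in M. (\<lambda>n. exp (- (real n * (s n w)\<^sup>2 * (\<Sum>j=n..<k n. (d j w)\<^sup>2)) / 2) - L n w) \<longlonglongrightarrow> 0"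
  shows "(\<lambda>n. (\<integral>w. iexp (sqrt (real n) * s n w * (\<Sum>j=n..<k n. d j w)) \<partial>M) - (\<integral>w. of_real (L n w) \<partial>M)) \<longlonglongrightarrow> 0"
proof -
  define E where "E n w = exp (- (\<Sum>j=n..<k n. (x n j w)\<^sup>2) / 2)" for n w
  have [measurable]: "E n \<in> borel_measurable M" for n unfolding E_def by measurable
  have E01: "0 \<le> E n w" "E n w \<le> 1" for n w by (auto simp: E_def sum_nonneg)
  have EL: "\<bar>E n w - L n w\<bar> \<le> 1" for n w using E01[of n w] L_bounds[of n w] by (simp add: abs_le_iff)
  define B where "B = (\<sigma> * \<kappa>)\<^sup>2"
  have "0 \<le> \<kappa>" using c_nonneg[of 0] by simp
  have "0 \<le> \<sigma>" using s_bound[of 0 undefined] by simp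
  let ?I = "\<lambda>n. \<integral>w. \<bar>E n w - L n w\<bar> \<partial>M"
  have "?I \<longlonglongrightarrow> (\<integral>w. 0 \<partial>M)"
  proof (rule integral_dominated_convergence[where w = "\<lambda>_. 1"])
    have "E n w = exp (- (real n * (s n w)\<^sup>2 * (\<Sum>j=n..<k n. (d j w)\<^sup>2)) / 2)" for n w
      by (simp add: E_def x_def power_mult_distrib sum_distrib_left)
    with conv show "AE w in M. (\<lambda>n. \<bar>E n w - L n w\<bar>) \<longlonglongrightarrow> 0" by (auto simp: tendsto_rabs_zero_iff)
  qed (use EL in auto)
  then have I: "?I \<longlonglongrightarrow> 0" by simp
  have main: "cmod ((\<integral>w. iexp (sqrt (real n) * s n w * (\<Sum>j=n..<k n. d j w)) \<partial>M) - (\<integral>w. of_real (L n w) \<partial>M))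
    \<le> exp B * (\<sigma> * \<kappa> / sqrt (real n) * (2 * B)) + exp B * ?I n" if n: "0 < n" "\<sigma> * \<kappa> / sqrt (real n) \<le> 1" for n
  proof -
    define R where "R w = iexp (sqrt (real n) * s n w * (\<Sum>j=n..<k n. d j w)) - T n (k n) w * of_real (E n w)" for w
    have [measurable]: "R \<in> borel_measurable M" unfolding R_def by measurable
    have R_bound: "AE w in M. cmod (R w) \<le> exp B * (\<sigma> * \<kappa> / sqrt (real n) * (2 * B))"
      using bounded_all square_sum_bound
    proof eventually_elim
      case (elim w)
      have small: "\<bar>x n j w\<bar> \<le> \<sigma> * \<kappa> / sqrt (real n)" if "j \<in> {n..<k n}" for j
      proof -
        have "\<bar>x n j w\<bar> \<le> sqrt (real n) * \<sigma> * (\<kappa> / real n)"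
        proof -
          have "\<bar>d j w\<bar> \<le> \<kappa> / real (Suc j)" using elim by auto
          also have "\<dots> \<le> \<kappa> / real n" using that n \<open>0 \<le> \<kappa>\<close> by (intro divide_left_mono) auto
          finally show ?thesis unfolding x_def abs_mult using s_bound[of n w] \<open>0 \<le> \<sigma>\<close> by (intro mult_mono) auto
        qed
        also have "\<dots> = \<sigma> * \<kappa> / sqrt (real n)" using n by (simp add: real_div_sqrt divide_simps)
        finally show ?thesis .
      qed
      have "sqrt (real n) * s n w * (\<Sum>j=n..<k n. d j w) = (\<Sum>j=n..<k n. x n j w)"
        by (simp add: x_def sum_distrib_left)
      then have "cmod (R w) \<le> exp ((\<Sum>j=n..<k n. (x n j w)\<^sup>2) / 2) * (\<sigma> * \<kappa> / sqrt (real n) * (\<Sum>j=n..<k n. (x n j w)\<^sup>2))"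
        unfolding R_def T_def E_def using iexp_sum_factorization[of "{n..<k n}" "\<lambda>j. x n j w", OF small n(2)]
        by (simp del: of_real_sum of_real_exp of_real_minus of_real_divide)
      also have "\<dots> \<le> exp B * (\<sigma> * \<kappa> / sqrt (real n) * (2 * B))"
      proof -
        have "(\<Sum>j=n..<k n. (x n j w)\<^sup>2) \<le> 2 * B" using elim le_k unfolding B_def by auto
        then show ?thesis using \<open>0 \<le> \<sigma>\<close> \<open>0 \<le> \<kappa>\<close> by (intro mult_mono mult_left_mono) (auto simp: sum_nonneg)
      qed
      finally show ?case .
    qed
    define Q where "Q w = T n (k n) w * of_real (E n w - L n w)" for w
    have [measurable]: "Q \<in> borel_measurable M" unfolding Q_def by measurable
    have Q_bound: "AE w in M. cmod (Q w) \<le> exp B * \<bar>E n w - L n w\<bar>"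
      using T_bound by eventually_elim (use le_k in \<open>auto simp: Q_def norm_mult B_def of_real_diff[symmetric] simp del: of_real_diff intro!: mult_right_mono\<close>)
    have R_int: "integrable M R" using R_bound by (intro integrable_AE_bounded) auto
    have Q_int: "integrable M Q"
    proof (rule integrable_AE_bounded)
      show "AE w in M. norm (Q w) \<le> exp B"
        using Q_bound by eventually_elim (use EL in \<open>auto intro: order_trans mult_left_le\<close>)
    qed measurable
    have TL_int: "integrable M (\<lambda>w. T n (k n) w * of_real (L n w))"
      using TL_bound[OF le_k] by (intro integrable_AE_bounded) auto
    have "(\<integral>w. iexp (sqrt (real n) * s n w * (\<Sum>j=n..<k n. d j w)) \<partial>M)
      = (\<integral>w. (R w + Q w) + T n (k n) w * of_real (L n w) \<partial>M)"
      by (simp add: R_def Q_def algebra_simps)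
    also have "\<dots> = (\<integral>w. R w \<partial>M) + (\<integral>w. Q w \<partial>M) + (\<integral>w. of_real (L n w) \<partial>M)"
      using R_int Q_int TL_int integral_T_L[OF le_k] by simp
    finally have "cmod ((\<integral>w. iexp (sqrt (real n) * s n w * (\<Sum>j=n..<k n. d j w)) \<partial>M) - (\<integral>w. of_real (L n w) \<partial>M))
      \<le> cmod (\<integral>w. R w \<partial>M) + cmod (\<integral>w. Q w \<partial>M)"
      using norm_triangle_ineq by simp
    also have "cmod (\<integral>w. R w \<partial>M) \<le> (\<integral>w. exp B * (\<sigma> * \<kappa> / sqrt (real n) * (2 * B)) \<partial>M)"
      using R_int R_bound by (intro order_trans[OF integral_norm_bound] integral_mono_AE) auto
    also have "cmod (\<integral>w. Q w \<partial>M) \<le> (\<integral>w. exp B * \<bar>E n w - L n w\<bar> \<partial>M)"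
      using Q_int Q_bound EL
      by (intro order_trans[OF integral_norm_bound] integral_mono_AE integrable_mult_right
          integrable_AE_bounded[of "\<lambda>w. \<bar>E n w - L n w\<bar>" 1]) auto
    finally show ?thesis by (simp add: prob_space)
  qed
  have r: "(\<lambda>n. a / sqrt (real n)) \<longlonglongrightarrow> 0" for a :: real
    by real_asymp
  have "(\<lambda>n. exp B * (\<sigma> * \<kappa> / sqrt (real n) * (2 * B)) + exp B * ?I n) \<longlonglongrightarrow> exp B * (0 * (2 * B)) + exp B * 0"
    by (intro tendsto_intros r I)
  then have lim: "(\<lambda>n. exp B * (\<sigma> * \<kappa> / sqrt (real n) * (2 * B)) + exp B * ?I n) \<longlonglongrightarrow> 0" by simp
  have "\<forall>\<^sub>F n in sequentially. \<sigma> * \<kappa> / sqrt (real n) < 1" by (rule order_tendstoD[OF r]) simp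
  then have "\<forall>\<^sub>F n in sequentially. 0 < n \<and> \<sigma> * \<kappa> / sqrt (real n) \<le> 1"
    using eventually_gt_at_top[of 0] by eventually_elim auto
  then show ?thesis
    by (intro Lim_null_comparison[OF _ lim], eventually_elim) (intro main, simp_all only:)
qed

end

section \<open>Positivity of a limit proportion\<close>

context prob_space
begin

text \<open>
  Telescoping \<open>1 / U n\<close> bounds the expectation of the sum of \<open>(U (n + 1) - U n) / (U n)\<^sup>2\<close>, which is the
  quadratic error in the logarithm of \<open>U\<close>. Hence \<open>ln (S n / U n)\<close> is bounded in expectation.
\<close>

lemma positive_limit_of_proportion:
  fixes U S :: "nat \<Rightarrow> 'a \<Rightarrow> real"
  assumes [measurable]: "\<And>n. U n \<in> borel_measurable M" "\<And>n. S n \<in> borel_measurable M"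
    and path: "AE w in M. \<forall>n. 1 \<le> U n w \<and> U n w \<le> S n w \<and>
      U n w \<le> U (Suc n) w \<and> U (Suc n) w \<le> U n w + c \<and> S n w \<le> S (Suc n) w \<and> S (Suc n) w \<le> S n w + c"
    and init: "\<And>w. U 0 w = u0" "\<And>w. S 0 w = s0"
    and balance: "\<And>n. (\<integral>w. (U (Suc n) w - U n w) / U n w \<partial>M) = (\<integral>w. (S (Suc n) w - S n w) / S n w \<partial>M)"
    and lim: "AE w in M. (\<lambda>n. U n w / S n w) \<longlonglongrightarrow> Z w"
  shows "AE w in M. 0 < Z w"
proof -
  define u where "u n w = U (Suc n) w - U n w" for n w
  define r where "r n w = S (Suc n) w - S n w" for n w
  have [measurable]: "u n \<in> borel_measurable M" "r n \<in> borel_measurable M" for n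
    unfolding u_def r_def by measurable
  have "AE w in M. 0 \<le> c" using path by eventually_elim (metis add_le_cancel_left add.right_neutral order_trans)
  then have c: "0 \<le> c" by simp
  have bounds: "AE w in M. 1 \<le> U n w \<and> U n w \<le> S n w \<and> 0 \<le> u n w \<and> u n w \<le> c \<and> 0 \<le> r n w \<and> r n w \<le> c" for n
    using path
  proof eventually_elim
    case (elim w)
    then have "1 \<le> U n w \<and> U n w \<le> S n w \<and> U n w \<le> U (Suc n) w \<and> U (Suc n) w \<le> U n w + c \<and>
      S n w \<le> S (Suc n) w \<and> S (Suc n) w \<le> S n w + c" by blast
    then show ?case by (simp add: u_def r_def)
  qed
  have S_bound: "AE w in M. S n w \<le> s0 + c * real n" for n
    using path
  proof eventually_elim
    case (elim w)
    show ?case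
    proof (induction n)
      case (Suc n)
      moreover have "S (Suc n) w \<le> S n w + c" using elim by blast
      ultimately show ?case by (simp add: algebra_simps)
    qed (simp add: init)
  qed
  have int_inv: "integrable M (\<lambda>w. 1 / U n w)" for n
    using bounds[of n] by (intro integrable_const_bound[where B = 1]) (auto elim!: eventually_mono)
  have int_ratio: "integrable M (\<lambda>w. f w / g w)"
    if [measurable]: "f \<in> borel_measurable M" "g \<in> borel_measurable M"
      and fg: "AE w in M. 0 \<le> f w \<and> f w \<le> c \<and> 1 \<le> g w" for f g
  proof (rule integrable_const_bound[where B = c])
    show "AE w in M. norm (f w / g w) \<le> c"
      using fg
    proof eventually_elim
      case (elim w)
      then have "f w / g w \<le> c / 1" by (intro frac_le) auto
      with elim show ?case by simp
    qed
  qed measurable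
  have int_u: "integrable M (\<lambda>w. u n w / U n w)" for n
    by (rule int_ratio, measurable) (use bounds[of n] in eventually_elim, auto)
  have int_r: "integrable M (\<lambda>w. r n w / S n w)" for n
    by (rule int_ratio, measurable) (use bounds[of n] in eventually_elim, auto)
  have int_sq: "integrable M (\<lambda>w. u n w / (U n w)\<^sup>2)" for n
    by (rule int_ratio, measurable) (use bounds[of n] in eventually_elim, auto)
  have int_ln: "integrable M (\<lambda>w. ln (S n w) - ln (U n w))" for n
  proof (rule integrable_const_bound[where B = "s0 + c * real n"])
    show "AE w in M. norm (ln (S n w) - ln (U n w)) \<le> s0 + c * real n"
      using bounds[of n] S_bound[of n]
    proof eventually_elim
      case (elim w)
      then have "0 \<le> ln (U n w)" "ln (U n w) \<le> ln (S n w)" "ln (S n w) \<le> S n w - 1"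
        using ln_le_minus_one[of "S n w"] by auto
      with elim show ?case unfolding real_norm_def by linarith
    qed
  qed measurable
  define q where "q n = (\<integral>w. u n w / (U n w)\<^sup>2 \<partial>M)" for n
  \<comment> \<open>From U >= 1 follows U (n + 1) <= U n + c <= (1 + c) U n, so one factor of the
    squared denominator can be replaced by U (n + 1) at the price 1 + c, after which the fraction
    telescopes.\<close>
  have q_le: "q n \<le> (1 + c) * ((\<integral>w. 1 / U n w \<partial>M) - (\<integral>w. 1 / U (Suc n) w \<partial>M))" for n
  proof -
    have "q n \<le> (\<integral>w. (1 + c) * (1 / U n w - 1 / U (Suc n) w) \<partial>M)"
      unfolding q_def
    proof (intro integral_mono_AE int_sq integrable_mult_right Bochner_Integration.integrable_diff int_inv)
      show "AE w in M. u n w / (U n w)\<^sup>2 \<le> (1 + c) * (1 / U n w - 1 / U (Suc n) w)"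
        using bounds[of n]
      proof eventually_elim
        case (elim w)
        have eq: "U (Suc n) w = U n w + u n w" by (simp add: u_def)
        have "c \<le> c * U n w" using elim c by (simp add: mult_left_mono[of 1 "U n w" c, simplified])
        then have "U n w + u n w \<le> (1 + c) * U n w" using elim by (simp add: distrib_right)
        then have "u n w * (U n w * (U n w + u n w)) \<le> u n w * (U n w * ((1 + c) * U n w))"
          using elim by (intro mult_left_mono) auto
        then have "u n w / (U n w)\<^sup>2 \<le> (1 + c) * (u n w / (U n w * (U n w + u n w)))"
          using elim by (simp add: divide_simps power2_eq_square mult_ac)
        also have "u n w / (U n w * (U n w + u n w)) = 1 / U n w - 1 / U (Suc n) w"
          using elim unfolding eq by (simp add: field_simps)
        finally show ?case .
      qed
    qed
    then show ?thesis using int_inv by simp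
  qed
  have sum_q: "(\<Sum>j<n. q j) \<le> 1 + c" for n
  proof -
    have "(\<Sum>j<n. q j) \<le> (\<Sum>j<n. (1 + c) * ((\<integral>w. 1 / U j w \<partial>M) - (\<integral>w. 1 / U (Suc j) w \<partial>M)))"
      by (intro sum_mono q_le)
    also have "\<dots> = (1 + c) * ((\<integral>w. 1 / U 0 w \<partial>M) - (\<integral>w. 1 / U n w \<partial>M))"
      by (simp only: sum_distrib_left[symmetric]
          sum_lessThan_telescope'[of "\<lambda>j. \<integral>w. 1 / U j w \<partial>M"])
    also have "\<dots> \<le> (1 + c) * 1"
    proof (rule mult_left_mono)
      have "(\<integral>w. 1 / U 0 w \<partial>M) \<le> (\<integral>w. 1 \<partial>M)"
        using bounds[of 0] by (intro integral_mono_AE int_inv) (auto elim!: eventually_mono)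
      moreover have "0 \<le> (\<integral>w. 1 / U n w \<partial>M)"
        using bounds[of n] by (intro integral_nonneg_AE) (auto elim!: eventually_mono)
      ultimately show "(\<integral>w. 1 / U 0 w \<partial>M) - (\<integral>w. 1 / U n w \<partial>M) \<le> 1" by (simp add: prob_space)
    qed (use c in simp)
    finally show ?thesis by simp
  qed
  define l where "l n = (\<integral>w. ln (S n w) - ln (U n w) \<partial>M)" for n
  \<comment> \<open>Concavity bounds the growth of ln S by r/S, and ln(1 + y) >= y - y^2 bounds the
    growth of ln U from below. The first-order terms cancel in expectation by
    \<open>balance\<close>, and y^2 <= c u / U^2 is the summable error.\<close>
  have l_step: "l (Suc n) \<le> l n + c * q n" for n
  proof -
    have "l (Suc n) \<le> (\<integral>w. (ln (S n w) - ln (U n w)) + (r n w / S n w - u n w / U n w) + c * (u n w / (U n w)\<^sup>2) \<partial>M)"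
      unfolding l_def
    proof (intro integral_mono_AE int_ln Bochner_Integration.integrable_add Bochner_Integration.integrable_diff int_r int_u
        integrable_mult_right int_sq)
      show "AE w in M. ln (S (Suc n) w) - ln (U (Suc n) w)
        \<le> (ln (S n w) - ln (U n w)) + (r n w / S n w - u n w / U n w) + c * (u n w / (U n w)\<^sup>2)"
        using bounds[of n]
      proof eventually_elim
        case (elim w)
        have "ln (S (Suc n) w) - ln (S n w) \<le> (S (Suc n) w - S n w) / S n w"
          using elim by (intro ln_diff_le) (auto simp: r_def)
        moreover have "u n w / U n w - c * (u n w / (U n w)\<^sup>2) \<le> ln (U (Suc n) w) - ln (U n w)"
        proof -
          define y where "y = u n w / U n w"
          have y: "0 \<le> y" using elim by (simp add: y_def)
          have "y - y\<^sup>2 \<le> ln (1 + y)"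
          \<comment> \<open>The series bound for the logarithm covers y <= 1; beyond that the left
            side y - y^2 is not positive.\<close>
          proof (cases "y \<le> 1")
            case True
            then show ?thesis using y by (intro ln_one_plus_pos_lower_bound)
          next
            case False
            then have "y \<le> y\<^sup>2" by (simp add: power2_eq_square)
            moreover have "0 \<le> ln (1 + y)" using y by simp
            ultimately show ?thesis by simp
          qed
          moreover have "ln (U (Suc n) w) - ln (U n w) = ln (1 + y)"
          proof -
            have "1 + y = U (Suc n) w / U n w" using elim by (simp add: y_def u_def field_simps)
            then show ?thesis using elim by (simp add: ln_div u_def)
          qed
          moreover have "y\<^sup>2 \<le> c * (u n w / (U n w)\<^sup>2)"
            using elim by (simp add: y_def power_divide power2_eq_square[of "u n w"] divide_right_mono mult_right_mono)
          ultimately show ?thesis unfolding y_def by linarith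
        qed
        ultimately show ?case unfolding r_def by linarith
      qed
    qed
    also have "\<dots> = l n + ((\<integral>w. r n w / S n w \<partial>M) - (\<integral>w. u n w / U n w \<partial>M)) + c * q n"
      using int_ln int_r int_u int_sq unfolding l_def q_def by (simp del: times_divide_eq_right)
    also have "\<dots> = l n + c * q n" using balance[of n] by (simp add: r_def u_def)
    finally show ?thesis .
  qed
  have l_bound: "l n \<le> l 0 + c * (1 + c)" for n
  proof -
    have "l n \<le> l 0 + c * (\<Sum>j<n. q j)" for n
    proof (induction n)
      case (Suc n)
      with l_step[of n] show ?case by (simp add: distrib_left)
    qed simp
    also have "\<dots> n \<le> l 0 + c * (1 + c)" for n using sum_q[of n] c by (intro add_left_mono mult_left_mono)
    finally show ?thesis .
  qed
  have "(\<integral>\<^sup>+w. liminf (\<lambda>n. ennreal (ln (S n w) - ln (U n w))) \<partial>M)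
    \<le> liminf (\<lambda>n. \<integral>\<^sup>+w. ennreal (ln (S n w) - ln (U n w)) \<partial>M)"
    by (rule nn_integral_liminf) measurable
  also have "\<dots> = liminf (\<lambda>n. ennreal (l n))"
  proof -
    have "(\<integral>\<^sup>+w. ennreal (ln (S n w) - ln (U n w)) \<partial>M) = ennreal (l n)" for n
    proof -
      have "AE w in M. 0 \<le> ln (S n w) - ln (U n w)" using bounds[of n] by eventually_elim auto
      then show ?thesis unfolding l_def by (intro nn_integral_eq_integral int_ln)
    qed
    then show ?thesis by simp
  qed
  also have "\<dots> \<le> liminf (\<lambda>n. ennreal (l 0 + c * (1 + c)))"
    by (intro Liminf_mono always_eventually allI ennreal_leI l_bound)
  also have "\<dots> = ennreal (l 0 + c * (1 + c))" by (simp add: Liminf_const)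
  finally have "(\<integral>\<^sup>+w. liminf (\<lambda>n. ennreal (ln (S n w) - ln (U n w))) \<partial>M) \<noteq> \<infinity>"
    by (auto simp: top_unique)
  then have "AE w in M. liminf (\<lambda>n. ennreal (ln (S n w) - ln (U n w))) \<noteq> \<infinity>"
    by (intro nn_integral_noteq_infinite) measurable
  then show ?thesis using lim path
  proof eventually_elim
    case (elim w)
    have pos: "1 \<le> U n w" "U n w \<le> S n w" for n using elim by auto
    then have ratio: "0 < U n w / S n w" for n using less_le_trans[OF zero_less_one, of "U n w"]
      by (smt (verit) divide_pos_pos)
    then have "0 \<le> Z w" using elim(2) by (intro LIMSEQ_le_const) (auto intro: less_imp_le)
    \<comment> \<open>If Z w were 0, the logarithm of S n / U n would tend to infinity, against the
      almost surely finite limit inferior obtained from Fatou's lemma and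
      \<open>l_bound\<close>.\<close>
    moreover have "Z w \<noteq> 0"
    proof
      assume "Z w = 0"
      then have "filterlim (\<lambda>n. U n w / S n w) (at_right 0) sequentially"
        using elim(2) ratio by (intro tendsto_imp_filterlim_at_right) simp_all
      then have "filterlim (\<lambda>n. ln (U n w / S n w)) at_bot sequentially"
        by (rule filterlim_compose[OF ln_at_0])
      then have "filterlim (\<lambda>n. - ln (U n w / S n w)) at_top sequentially"
        by (simp add: filterlim_uminus_at_bot)
      moreover have "- ln (U n w / S n w) = ln (S n w) - ln (U n w)" for n
        using pos[of n] by (subst ln_div) auto
      ultimately have "filterlim (\<lambda>n. ln (S n w) - ln (U n w)) at_top sequentially" by simp
      then have "(\<lambda>n. ennreal (ln (S n w) - ln (U n w))) \<longlonglongrightarrow> top"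
        by (simp add: ennreal_tendsto_top_eq_at_top)
      then have "liminf (\<lambda>n. ennreal (ln (S n w) - ln (U n w))) = top"
        by (intro lim_imp_Liminf) auto
      with elim(1) show False by simp
    qed
    ultimately show ?case by simp
  qed
qed

end

section \<open>Hypergeometric moments\<close>

text \<open>The factor k is absorbed into the binomial coefficient, k C(h,k) = h C(h-1,k-1), and
  Vandermonde's identity sums the rest.\<close>

lemma sum_index_times_binomials:
  "(\<Sum>k\<le>Suc r. k * (Suc h choose k) * (t choose (Suc r - k))) = Suc h * ((h + t) choose r)"
proof -
  have "(\<Sum>k\<le>Suc r. k * (Suc h choose k) * (t choose (Suc r - k)))
    = (\<Sum>k\<le>r. Suc k * (Suc h choose Suc k) * (t choose (r - k)))"
    by (subst sum.atMost_Suc_shift) simp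
  also have "\<dots> = Suc h * (\<Sum>k\<le>r. (h choose k) * (t choose (r - k)))"
    by (simp only: Suc_times_binomial sum_distrib_left mult.assoc)
  finally show ?thesis by (simp only: vandermonde)
qed

text \<open>One absorption reduces this to the previous sum, which contains the second one.\<close>

lemma sum_index_pairs_times_binomials:
  "(\<Sum>k\<le>Suc (Suc r). k * (k - 1) * (Suc (Suc h) choose k) * (t choose (Suc (Suc r) - k)))
    = Suc (Suc h) * Suc h * ((h + t) choose r)"
proof -
  have "(\<Sum>k\<le>Suc (Suc r). k * (k - 1) * (Suc (Suc h) choose k) * (t choose (Suc (Suc r) - k)))
    = (\<Sum>k\<le>Suc r. Suc k * k * (Suc (Suc h) choose Suc k) * (t choose (Suc r - k)))"
    by (subst sum.atMost_Suc_shift) simp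
  also have "\<dots> = (\<Sum>k\<le>Suc r. Suc (Suc h) * (k * (Suc h choose k) * (t choose (Suc r - k))))"
  proof (rule sum.cong[OF refl])
    fix k
    have "Suc k * k * (Suc (Suc h) choose Suc k) = k * (Suc k * (Suc (Suc h) choose Suc k))" by (simp only: mult_ac)
    then show "Suc k * k * (Suc (Suc h) choose Suc k) * (t choose (Suc r - k))
      = Suc (Suc h) * (k * (Suc h choose k) * (t choose (Suc r - k)))"
      by (simp only: Suc_times_binomial) (simp only: mult_ac)
  qed
  also have "\<dots> = Suc (Suc h) * (Suc h * ((h + t) choose r))"
    by (simp only: sum_distrib_left[symmetric] sum_index_times_binomials)
  finally show ?thesis by (simp only: mult.assoc)
qed

lemma hypergeometric_mean:
  assumes "n \<le> s" "h \<le> s" "0 < s"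
  shows "(\<Sum>k\<le>n. real k * hypergeometric_mass n s h k) = real n * real h / real s"
proof (cases "n = 0 \<or> h = 0")
  case True
  have "real k * hypergeometric_mass n s h k = 0" if "k \<le> n" for k
    using True that by (cases k) (auto simp: hypergeometric_mass_def)
  with True show ?thesis by (auto intro!: sum.neutral)
next
  case False
  then obtain r h' where n: "n = Suc r" and h: "h = Suc h'" by (metis not0_implies_Suc)
  define t where "t = s - h"
  have s: "s = Suc (h' + t)" using assms h by (simp add: t_def)
  have "(\<Sum>k\<le>n. real k * hypergeometric_mass n s h k)
    = (\<Sum>k\<le>n. real (k * (h choose k) * (t choose (n - k))) / real (s choose n))"
    by (intro sum.cong) (auto simp: hypergeometric_mass_def t_def mult.assoc)
  also have "\<dots> = real (\<Sum>k\<le>n. k * (h choose k) * (t choose (n - k))) / real (s choose n)"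
    by (simp add: sum_divide_distrib)
  also have "\<dots> = real (h * ((h' + t) choose r)) / real (s choose n)"
    unfolding n h by (simp only: sum_index_times_binomials)
  also have "\<dots> = real n * real h / real s"
  proof -
    have "real n * real (s choose n) = real s * real ((h' + t) choose r)"
      unfolding n s of_nat_mult[symmetric] by (simp only: Suc_times_binomial)
    moreover have "0 < s choose n" using assms by simp
    ultimately show ?thesis using \<open>0 < s\<close> by (simp add: field_simps)
  qed
  finally show ?thesis .
qed

text \<open>The factorial moment is taken instead of the second moment because absorbing k and k - 1
  into the binomial coefficient gives a closed form. The case
  \<open>n \<le> 1 \<or> h \<le> 1\<close>, where both sides vanish, is split off to write
  \<open>n\<close> and \<open>h\<close> as double successors.\<close>

lemma hypergeometric_factorial_moment:
  assumes "n \<le> s" "h \<le> s" "2 \<le> s"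
  shows "(\<Sum>k\<le>n. real k * (real k - 1) * hypergeometric_mass n s h k)
    = real n * (real n - 1) * (real h / real s) * ((real h - 1) / (real s - 1))"
proof (cases "n \<le> 1 \<or> h \<le> 1")
  case True
  have "real k * (real k - 1) * hypergeometric_mass n s h k = 0" if "k \<le> n" for k
  proof (cases "k \<le> 1")
    case True
    then have "k = 0 \<or> k = 1" by auto
    then show ?thesis by auto
  next
    case False
    with True that have "h choose k = 0" by (intro binomial_eq_0) auto
    then show ?thesis by (simp add: hypergeometric_mass_def)
  qed
  then have "(\<Sum>k\<le>n. real k * (real k - 1) * hypergeometric_mass n s h k) = 0" by (intro sum.neutral) auto
  moreover have "n = 0 \<or> n = 1 \<or> h = 0 \<or> h = 1" using True by auto
  ultimately show ?thesis by auto
next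
  case False
  then obtain r h' where n: "n = Suc (Suc r)" and h: "h = Suc (Suc h')"
    by (metis One_nat_def le_0_eq le_SucE nat_le_linear not_less_eq_eq old.nat.exhaust)
  define t where "t = s - h"
  have s: "s = Suc (Suc (h' + t))" using assms h by (simp add: t_def)
  have "(\<Sum>k\<le>n. real k * (real k - 1) * hypergeometric_mass n s h k)
    = (\<Sum>k\<le>n. real (k * (k - 1) * (h choose k) * (t choose (n - k))) / real (s choose n))"
  proof (rule sum.cong[OF refl])
    fix k assume "k \<in> {..n}"
    moreover have pair: "real k * (real k - 1) = real (k * (k - 1))" by (cases k) (auto simp: algebra_simps)
    ultimately show "real k * (real k - 1) * hypergeometric_mass n s h k
      = real (k * (k - 1) * (h choose k) * (t choose (n - k))) / real (s choose n)"
      unfolding pair by (simp add: hypergeometric_mass_def t_def mult.assoc)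
  qed
  also have "\<dots> = real (\<Sum>k\<le>n. k * (k - 1) * (h choose k) * (t choose (n - k))) / real (s choose n)"
    by (simp add: sum_divide_distrib)
  also have "\<dots> = real (h * Suc h' * ((h' + t) choose r)) / real (s choose n)"
    unfolding n h by (simp only: sum_index_pairs_times_binomials)
  also have "\<dots> = real n * (real n - 1) * (real h / real s) * ((real h - 1) / (real s - 1))"
  proof -
    have "Suc (Suc r) * (Suc (Suc (h' + t)) choose Suc (Suc r)) = Suc (Suc (h' + t)) * (Suc (h' + t) choose Suc r)"
      by (simp only: Suc_times_binomial)
    then have "Suc r * (Suc (Suc r) * (Suc (Suc (h' + t)) choose Suc (Suc r)))
      = Suc (Suc (h' + t)) * (Suc r * (Suc (h' + t) choose Suc r))" by (simp only: mult_ac)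
    then have "Suc r * (n * (s choose n)) = s * (Suc (h' + t) * ((h' + t) choose r))"
      unfolding n s by (simp only: Suc_times_binomial)
    then have "real (Suc r * (n * (s choose n))) = real (s * (Suc (h' + t) * ((h' + t) choose r)))" by (simp only:)
    then have "(real n - 1) * (real n * real (s choose n)) = real s * ((real s - 1) * real ((h' + t) choose r))"
    proof -
      have "real n - 1 = real (Suc r)" "real s - 1 = real (Suc (h' + t))" by (simp_all add: n s)
      then show ?thesis
        using \<open>real (Suc r * (n * (s choose n))) = real (s * (Suc (h' + t) * ((h' + t) choose r)))\<close>
        by (simp only: of_nat_mult)
    qed
    moreover have pos: "0 < real (s choose n)" "0 < real s" "0 < real s - 1" using assms by auto
    ultimately have "real ((h' + t) choose r) = (real n - 1) * (real n * real (s choose n)) / (real s * (real s - 1))"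
      by (simp add: eq_divide_eq mult_ac)
    moreover have "real (h * Suc h') = real h * (real h - 1)" by (simp add: h algebra_simps)
    ultimately have "real (h * Suc h' * ((h' + t) choose r))
      = real h * (real h - 1) * ((real n - 1) * (real n * real (s choose n)) / (real s * (real s - 1)))"
      by (simp only: of_nat_mult[of "h * Suc h'"])
    then show ?thesis using pos by simp
  qed
  finally show ?thesis .
qed

section \<open>Studentized limits\<close>

lemma std_normal_no_atoms: "measure std_normal_distribution {x} = 0"
proof -
  have "emeasure std_normal_distribution {x} = (\<integral>\<^sup>+y. ennreal (std_normal_density y) * indicator {x} y \<partial>lborel)"
    by (rule emeasure_density) auto
  also have "\<dots> = (\<integral>\<^sup>+y. 0 \<partial>(lborel :: real measure))"
  proof (rule nn_integral_cong_AE)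
    show "AE y in lborel. ennreal (std_normal_density y) * indicator {x} y = 0"
      using AE_lborel_singleton[of x] by eventually_elim simp
  qed
  finally show ?thesis by (simp add: measure_def)
qed

text \<open>The characteristic function exp(-t^2/2) is even and determines the distribution.\<close>

lemma std_normal_distribution_symmetric:
  "distr std_normal_distribution borel uminus = std_normal_distribution"
proof (rule Levy_uniqueness)
  interpret real_distribution std_normal_distribution by (rule real_dist_normal_dist)
  show "real_distribution (distr std_normal_distribution borel uminus)" by (rule real_distribution_distr) simp
  show "char (distr std_normal_distribution borel uminus) = char std_normal_distribution"
  proof
    fix t
    have "char (distr std_normal_distribution borel uminus) t = char std_normal_distribution (- t)"
      unfolding char_def by (subst integral_distr) auto
    then show "char (distr std_normal_distribution borel uminus) t = char std_normal_distribution t"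
      by (simp add: char_std_normal_distribution)
  qed
qed (rule real_dist_normal_dist)

lemma std_normal_cdf_minus:
  "cdf std_normal_distribution (- x) = 1 - cdf std_normal_distribution x"
proof -
  interpret real_distribution std_normal_distribution by (rule real_dist_normal_dist)
  have "cdf std_normal_distribution (- x) = measure (distr std_normal_distribution borel uminus) {..- x}"
    by (simp add: std_normal_distribution_symmetric cdf_def)
  also have "\<dots> = measure std_normal_distribution (uminus -` {..- x} \<inter> space std_normal_distribution)"
    by (rule measure_distr) auto
  also have "uminus -` {..- x} \<inter> space std_normal_distribution = {x} \<union> (UNIV - {..x})" by auto
  also have "measure std_normal_distribution \<dots> = measure std_normal_distribution {x} + measure std_normal_distribution (UNIV - {..x})"
    by (rule finite_measure_Union) auto
  also have "measure std_normal_distribution (UNIV - {..x}) = 1 - measure std_normal_distribution {..x}"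
    using prob_compl[of "{..x}"] by simp
  finally show ?thesis by (simp add: std_normal_no_atoms cdf_def)
qed

text \<open>The intermediate value theorem gives some x where the distribution function equals p. By
  continuity the set defining the quantile is closed and contains its infimum, which gives one
  inequality; the infimum is at most x, which gives the other.\<close>

lemma cdf_std_normal_quantile:
  assumes "0 < p" "p < 1"
  shows "cdf std_normal_distribution (quantile std_normal_distribution p) = p"
proof -
  interpret real_distribution std_normal_distribution by (rule real_dist_normal_dist)
  let ?\<Phi> = "cdf std_normal_distribution"
  let ?q = "quantile std_normal_distribution p"
  have cont: "isCont ?\<Phi> x" for x by (simp add: isCont_cdf std_normal_no_atoms)
  obtain u where u: "p < ?\<Phi> u"
    using order_tendstoD(1)[OF cdf_lim_at_top_prob assms(2)] by (auto simp: eventually_at_top_linorder)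
  obtain l where l: "\<And>x. x \<le> l \<Longrightarrow> ?\<Phi> x < p"
    using order_tendstoD(2)[OF cdf_lim_at_bot assms(1)] by (auto simp: eventually_at_bot_linorder)
  have "\<exists>x\<ge>l. x \<le> u \<and> ?\<Phi> x = p"
  proof (rule IVT)
    show "?\<Phi> l \<le> p" "p \<le> ?\<Phi> u" using l[of l] u by auto
    show "l \<le> u" using l[of u] u by (metis less_asym linear)
    show "\<forall>x. l \<le> x \<and> x \<le> u \<longrightarrow> isCont ?\<Phi> x" using cont by simp
  qed
  then obtain x where x: "?\<Phi> x = p" by blast
  have bdd: "bdd_below {x. p \<le> ?\<Phi> x}"
    by (rule bdd_belowI[of _ l]) (metis l linear mem_Collect_eq not_less)
  have "closed {x. p \<le> ?\<Phi> x}"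
    using cont by (intro closed_Collect_le continuous_on_const continuous_at_imp_continuous_on) auto
  then have "?q \<in> {x. p \<le> ?\<Phi> x}"
    unfolding quantile_def using x bdd by (intro closed_contains_Inf) auto
  moreover have "?\<Phi> ?q \<le> ?\<Phi> x"
    using x bdd by (intro cdf_nondecreasing) (auto simp: quantile_def intro!: cInf_lower)
  ultimately show ?thesis using x by simp
qed

lemma std_normal_quantile_interval:
  assumes "0 < \<alpha>" "\<alpha> < 1"
  defines "q \<equiv> quantile std_normal_distribution (1 - \<alpha> / 2)"
  shows "0 < q" "measure std_normal_distribution {- q..q} = 1 - \<alpha>"
proof -
  interpret real_distribution std_normal_distribution by (rule real_dist_normal_dist)
  have q: "cdf std_normal_distribution q = 1 - \<alpha> / 2"
    unfolding q_def using assms by (intro cdf_std_normal_quantile) auto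
  have mq: "cdf std_normal_distribution (- q) = \<alpha> / 2" by (simp add: std_normal_cdf_minus q)
  show "0 < q"
  proof (rule ccontr)
    assume "\<not> 0 < q"
    then have "cdf std_normal_distribution q \<le> cdf std_normal_distribution (- q)"
      by (intro cdf_nondecreasing) auto
    with q mq assms show False by simp
  qed
  then have "measure std_normal_distribution {- q<..q} = 1 - \<alpha>"
    using cdf_diff_eq[of "- q" q] q mq by simp
  moreover have "{- q..q} = {- q} \<union> {- q<..q}" using \<open>0 < q\<close> by auto
  moreover have "measure std_normal_distribution ({- q} \<union> {- q<..q})
    = measure std_normal_distribution {- q} + measure std_normal_distribution {- q<..q}"
    by (rule finite_measure_Union) auto
  ultimately show "measure std_normal_distribution {- q..q} = 1 - \<alpha>" by (simp add: std_normal_no_atoms)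
qed

context prob_space
begin

text \<open>Dividing by the root of V_n is harmless except where V_n is small. There the truncation
  at \<delta> replaces V_n, and the errors are bounded by the probability that V_n < \<delta>, which
  is eventually small for suitable \<delta>. Levy continuity then gives the normal limit of W_n /
  sqrt V_n.\<close>

lemma studentized_coverage:
  fixes W V :: "nat \<Rightarrow> 'a \<Rightarrow> real"
  assumes [measurable]: "\<And>n. W n \<in> borel_measurable M" "\<And>n. V n \<in> borel_measurable M" "V' \<in> borel_measurable M"
    and lim: "AE w in M. (\<lambda>n. V n w) \<longlonglongrightarrow> V' w" and pos: "AE w in M. 0 < V' w"
    and clt: "\<And>t \<delta>. 0 < \<delta> \<Longrightarrow> (\<lambda>n. (\<integral>w. iexp (t * (W n w / sqrt (max (V n w) \<delta>))) \<partial>M)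
      - (\<integral>w. of_real (exp (- (t\<^sup>2 * (max (V n w) 0 / max (V n w) \<delta>)) / 2)) \<partial>M)) \<longlonglongrightarrow> (0 :: complex)"
    and \<alpha>: "0 < \<alpha>" "\<alpha> < 1"
  shows "(\<lambda>n. prob {w \<in> space M. \<bar>W n w\<bar> \<le> quantile std_normal_distribution (1 - \<alpha> / 2) * sqrt (V n w)}) \<longlonglongrightarrow> 1 - \<alpha>"
proof -
  define Y where "Y n w = W n w / sqrt (V n w)" for n w
  have Y_M [measurable]: "Y n \<in> borel_measurable M" for n unfolding Y_def by measurable
  \<comment> \<open>A continuous majorant of the indicator of v < \<delta>, falling from 1 at
    \<delta> to 0 at 2\<delta>. Continuity lets its expectation pass to the limit in n.\<close>
  define \<phi> where "\<phi> \<delta> v = min 1 (max 0 (2 - v / \<delta>))" for \<delta> v :: real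
  have \<phi>01: "0 \<le> \<phi> \<delta> v" "\<phi> \<delta> v \<le> 1" for \<delta> v by (auto simp: \<phi>_def)
  have \<phi>1: "\<phi> \<delta> v = 1" if "v < \<delta>" "0 < \<delta>" for \<delta> v using that by (auto simp: \<phi>_def divide_simps)
  have [measurable]: "\<phi> \<delta> \<in> borel_measurable borel" for \<delta> unfolding \<phi>_def by measurable
  have \<phi>_int: "integrable M (\<lambda>w. \<phi> \<delta> (f w))" if "f \<in> borel_measurable M" for \<delta> f
    using that \<phi>01 by (intro integrable_const_bound[where B = 1]) auto
  have \<phi>_lim: "(\<lambda>n. \<integral>w. \<phi> \<delta> (V n w) \<partial>M) \<longlonglongrightarrow> (\<integral>w. \<phi> \<delta> (V' w) \<partial>M)" if "0 < \<delta>" for \<delta>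
  proof (rule integral_dominated_convergence[where w = "\<lambda>_. 1"])
    show "AE w in M. (\<lambda>n. \<phi> \<delta> (V n w)) \<longlonglongrightarrow> \<phi> \<delta> (V' w)"
      using lim by eventually_elim (use that in \<open>auto simp: \<phi>_def intro!: tendsto_intros\<close>)
  qed (use \<phi>01 in auto)
  have "(\<lambda>m. \<integral>w. \<phi> (1 / real (Suc m)) (V' w) \<partial>M) \<longlonglongrightarrow> (\<integral>w. 0 \<partial>M)"
  proof (rule integral_dominated_convergence[where w = "\<lambda>_. 1"])
    show "AE w in M. (\<lambda>m. \<phi> (1 / real (Suc m)) (V' w)) \<longlonglongrightarrow> 0"
      using pos
    proof eventually_elim
      case (elim w)
      obtain m0 where m0: "2 / V' w < real m0" using reals_Archimedean2 by blast
      have "\<phi> (1 / real (Suc m)) (V' w) = 0" if "m0 \<le> m" for m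
      proof -
        have "2 / V' w < real (Suc m)" using m0 that by linarith
        then have "2 < V' w * real (Suc m)" using elim by (simp only: pos_divide_less_eq mult.commute)
        then show ?thesis by (simp add: \<phi>_def)
      qed
      then show ?case by (intro tendsto_eventually) (auto simp: eventually_sequentially)
    qed
  qed (use \<phi>01 in auto)
  then have small: "(\<lambda>m. \<integral>w. \<phi> (1 / real (Suc m)) (V' w) \<partial>M) \<longlonglongrightarrow> 0" by simp
  \<comment> \<open>The order of the limits matters: for fixed \<delta> the expectations converge as
    n grows, and the limits vanish as \<delta> decreases because V' is almost surely
    positive.\<close>
  have V_small: "\<exists>\<delta>>0. \<forall>\<^sub>F n in sequentially. (\<integral>w. \<phi> \<delta> (V n w) \<partial>M) < e" if e: "0 < e" for e
  proof -
    obtain m where "(\<integral>w. \<phi> (1 / real (Suc m)) (V' w) \<partial>M) < e"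
      using order_tendstoD(2)[OF small e] by (auto simp: eventually_sequentially)
    then show ?thesis
      by (intro exI[of _ "1 / real (Suc m)"] conjI order_tendstoD(2)[OF \<phi>_lim]) auto
  qed
  have char_lim: "(\<lambda>n. \<integral>w. iexp (t * Y n w) \<partial>M) \<longlonglongrightarrow> of_real (exp (- (t\<^sup>2) / 2))" for t
  proof (rule tendstoI)
    fix e :: real assume "0 < e"
    then obtain \<delta> where \<delta>: "0 < \<delta>" and ev: "\<forall>\<^sub>F n in sequentially. (\<integral>w. \<phi> \<delta> (V n w) \<partial>M) < e / 6"
      using V_small[of "e / 6"] by auto
    define Yd where "Yd n w = W n w / sqrt (max (V n w) \<delta>)" for n w
    define L where "L n w = exp (- (t\<^sup>2 * (max (V n w) 0 / max (V n w) \<delta>)) / 2)" for n w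
    have [measurable]: "Yd n \<in> borel_measurable M" "L n \<in> borel_measurable M" for n
      unfolding Yd_def L_def by measurable
    have L01: "0 \<le> L n w" "L n w \<le> 1" for n w
      using \<delta> by (auto simp: L_def zero_le_divide_iff zero_le_mult_iff le_max_iff_disj)
    have int: "integrable M (\<lambda>w. iexp (t * f w))" if [measurable]: "f \<in> borel_measurable M" for f
      by (intro integrable_const_bound[where B = 1]) auto
    have int_L: "integrable M (\<lambda>w. complex_of_real (L n w))" for n
      using L01 by (intro integrable_const_bound[where B = 1]) auto
    have close: "\<forall>\<^sub>F n in sequentially. cmod ((\<integral>w. iexp (t * Yd n w) \<partial>M) - (\<integral>w. of_real (L n w) \<partial>M)) < e / 2"
      using tendstoD[OF clt[OF \<delta>, of t], of "e / 2"] \<open>0 < e\<close> by (simp add: Yd_def L_def dist_norm)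
    have int_Y: "integrable M (\<lambda>w. iexp (t * Y n w))" "integrable M (\<lambda>w. iexp (t * Yd n w))" for n
      by (rule int, measurable)+
    from ev close show "\<forall>\<^sub>F n in sequentially. dist (\<integral>w. iexp (t * Y n w) \<partial>M) (of_real (exp (- (t\<^sup>2) / 2))) < e"
    proof eventually_elim
      case (elim n)
      have "cmod ((\<integral>w. iexp (t * Y n w) \<partial>M) - (\<integral>w. iexp (t * Yd n w) \<partial>M))
        = cmod (\<integral>w. iexp (t * Y n w) - iexp (t * Yd n w) \<partial>M)"
        by (simp only: Bochner_Integration.integral_diff[OF int_Y])
      also have "\<dots> \<le> (\<integral>w. 2 * \<phi> \<delta> (V n w) \<partial>M)"
      proof (rule order_trans[OF integral_norm_bound], intro integral_mono)
        fix w
        show "norm (iexp (t * Y n w) - iexp (t * Yd n w)) \<le> 2 * \<phi> \<delta> (V n w)"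
        proof (cases "V n w < \<delta>")
          case True
          have "norm (iexp (t * Y n w) - iexp (t * Yd n w)) \<le> norm (iexp (t * Y n w)) + norm (iexp (t * Yd n w))"
            by (rule norm_triangle_ineq4)
          then show ?thesis using True \<phi>1[OF True \<delta>] by simp
        next
          case False
          then have "max (V n w) \<delta> = V n w" by simp
          then show ?thesis using \<phi>01 by (simp add: Y_def Yd_def)
        qed
      qed (intro int_Y \<phi>_int Bochner_Integration.integrable_diff integrable_norm integrable_mult_right, measurable)+
      also have "\<dots> = 2 * (\<integral>w. \<phi> \<delta> (V n w) \<partial>M)" by simp
      finally have 1: "cmod ((\<integral>w. iexp (t * Y n w) \<partial>M) - (\<integral>w. iexp (t * Yd n w) \<partial>M)) \<le> 2 * (\<integral>w. \<phi> \<delta> (V n w) \<partial>M)" .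
      have "cmod ((\<integral>w. of_real (L n w) \<partial>M) - of_real (exp (- (t\<^sup>2) / 2)))
        = cmod (\<integral>w. of_real (L n w) - of_real (exp (- (t\<^sup>2) / 2)) \<partial>M)"
        by (subst Bochner_Integration.integral_diff) (auto intro!: int_L simp: prob_space)
      also have "\<dots> \<le> (\<integral>w. \<phi> \<delta> (V n w) \<partial>M)"
      proof (rule order_trans[OF integral_norm_bound], intro integral_mono)
        fix w
        have eq: "norm (complex_of_real (L n w) - of_real (exp (- (t\<^sup>2) / 2))) = \<bar>L n w - exp (- (t\<^sup>2) / 2)\<bar>"
          by (simp only: of_real_diff[symmetric] norm_of_real)
        show "norm (complex_of_real (L n w) - of_real (exp (- (t\<^sup>2) / 2))) \<le> \<phi> \<delta> (V n w)"
        proof (cases "V n w < \<delta>")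
          case True
          have "0 \<le> exp (- (t\<^sup>2) / 2)" "exp (- (t\<^sup>2) / 2) \<le> 1" by auto
          then have "\<bar>L n w - exp (- (t\<^sup>2) / 2)\<bar> \<le> 1" using L01[of n w] unfolding abs_le_iff by linarith
          then show ?thesis using \<phi>1[OF True \<delta>] eq by simp
        next
          case False
          then have "max (V n w) \<delta> = V n w" "max (V n w) 0 = V n w" "V n w \<noteq> 0" using \<delta> by auto
          then show ?thesis using \<phi>01 by (simp add: L_def)
        qed
      qed (auto intro!: int_L \<phi>_int Bochner_Integration.integrable_diff integrable_norm)
      finally have 2: "cmod ((\<integral>w. of_real (L n w) \<partial>M) - of_real (exp (- (t\<^sup>2) / 2))) \<le> (\<integral>w. \<phi> \<delta> (V n w) \<partial>M)" .
      \<comment> \<open>Undoing the truncation costs at most 2p, and replacing \<open>L n\<close> by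
        its value on V_n >= \<delta> costs p. With p < e/6 this leaves e/2 for the limit theorem
        itself.\<close>
      have tri: "cmod (x - z) < e" if "cmod (x - y1) \<le> 2 * p" "cmod (y1 - y2) < e / 2" "cmod (y2 - z) \<le> p" "p < e / 6"
        for x y1 y2 z :: complex and p
        using that norm_triangle_ineq[of "x - y1" "y1 - z"] norm_triangle_ineq[of "y1 - y2" "y2 - z"] by simp
      show ?case unfolding dist_norm by (rule tri[OF 1 elim(2) 2 elim(1)])
    qed
  qed
  define q where "q = quantile std_normal_distribution (1 - \<alpha> / 2)"
  have q: "0 < q" "measure std_normal_distribution {- q..q} = 1 - \<alpha>"
    unfolding q_def using \<alpha> by (rule std_normal_quantile_interval)+
  have weak: "weak_conv_m (\<lambda>n. distr M borel (Y n)) std_normal_distribution"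
  proof (rule levy_continuity)
    show "real_distribution (distr M borel (Y n))" for n by (rule real_distribution_distr) simp
    show "(\<lambda>n. char (distr M borel (Y n)) t) \<longlonglongrightarrow> char std_normal_distribution t" for t
      unfolding char_std_normal_distribution using char_lim[of t] by (simp add: char_def integral_distr)
  qed (rule real_dist_normal_dist)
  have "(\<lambda>n. measure (distr M borel (Y n)) {- q..q}) \<longlonglongrightarrow> measure std_normal_distribution {- q..q}"
  proof (rule weak_conv_imp_continuity_set_conv[OF _ real_dist_normal_dist weak])
    interpret N: real_distribution std_normal_distribution by (rule real_dist_normal_dist)
    show "real_distribution (distr M borel (Y n))" for n by (rule real_distribution_distr) simp
    have "frontier {- q..q} = {- q} \<union> {q}"
      using q(1) by (auto simp: frontier_def)
    moreover have "measure std_normal_distribution ({- q} \<union> {q})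
      = measure std_normal_distribution {- q} + measure std_normal_distribution {q}"
      using q(1) by (intro N.finite_measure_Union) auto
    ultimately have "measure std_normal_distribution (frontier {- q..q}) = 0" by (simp only: std_normal_no_atoms)
    then show "emeasure std_normal_distribution (frontier {- q..q}) = 0" by (simp add: N.emeasure_eq_measure)
  qed simp
  then have Y_lim: "(\<lambda>n. prob {w \<in> space M. \<bar>Y n w\<bar> \<le> q}) \<longlonglongrightarrow> 1 - \<alpha>"
  proof -
    have "measure (distr M borel (Y n)) {- q..q} = prob {w \<in> space M. \<bar>Y n w\<bar> \<le> q}" for n
      by (subst measure_distr) (auto intro!: arg_cong[where f = prob] simp: abs_le_iff)
    then show ?thesis using \<open>(\<lambda>n. measure (distr M borel (Y n)) {- q..q}) \<longlonglongrightarrow> _\<close> q(2) by simp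
  qed
  \<comment> \<open>The inequality may be divided by \<open>sqrt (V n w)\<close> only where this is
    positive. Elsewhere x / 0 = 0 and the negative root of a negative number can make the two events
    differ, again only inside V_n < \<delta>.\<close>
  have "(\<lambda>n. prob {w \<in> space M. \<bar>W n w\<bar> \<le> q * sqrt (V n w)} - prob {w \<in> space M. \<bar>Y n w\<bar> \<le> q}) \<longlonglongrightarrow> 0"
  proof (rule tendstoI)
    fix e :: real assume "0 < e"
    then obtain \<delta> where \<delta>: "0 < \<delta>" and ev: "\<forall>\<^sub>F n in sequentially. (\<integral>w. \<phi> \<delta> (V n w) \<partial>M) < e"
      using V_small[of e] by auto
    from ev show "\<forall>\<^sub>F n in sequentially. dist (prob {w \<in> space M. \<bar>W n w\<bar> \<le> q * sqrt (V n w)}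
      - prob {w \<in> space M. \<bar>Y n w\<bar> \<le> q}) 0 < e"
    proof eventually_elim
      case (elim n)
      let ?P = "{w \<in> space M. \<bar>W n w\<bar> \<le> q * sqrt (V n w)}" and ?Q = "{w \<in> space M. \<bar>Y n w\<bar> \<le> q}"
      have [measurable]: "?P \<in> events" "?Q \<in> events" by measurable
      have ind: "integrable M (indicator ?P :: 'a \<Rightarrow> real)" "integrable M (indicator ?Q :: 'a \<Rightarrow> real)"
        by (intro integrable_const_bound[where B = 1]; simp add: indicator_def)+
      have "?P \<inter> space M = ?P" "?Q \<inter> space M = ?Q" by auto
      then have "prob ?P - prob ?Q = (\<integral>w. indicator ?P w - indicator ?Q w \<partial>M)"
        by (simp only: Bochner_Integration.integral_diff[OF ind] Bochner_Integration.integral_indicator)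
      then have "\<bar>prob ?P - prob ?Q\<bar> \<le> (\<integral>w. \<bar>indicator ?P w - indicator ?Q w\<bar> \<partial>M)"
        using integral_norm_bound[of M "\<lambda>w. indicator ?P w - indicator ?Q w :: real"] by simp
      also have "\<dots> \<le> (\<integral>w. \<phi> \<delta> (V n w) \<partial>M)"
      proof (intro integral_mono \<phi>_int)
        fix w assume "w \<in> space M"
        show "\<bar>indicator ?P w - indicator ?Q w\<bar> \<le> \<phi> \<delta> (V n w)"
        proof (cases "V n w < \<delta>")
          case True
          then show ?thesis using \<phi>1[OF True \<delta>] by (auto simp: indicator_def)
        next
          case False
          then have "0 < sqrt (V n w)" using \<delta> by simp
          then have "\<bar>W n w\<bar> \<le> q * sqrt (V n w) \<longleftrightarrow> \<bar>Y n w\<bar> \<le> q"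
            by (simp add: Y_def abs_divide pos_divide_le_eq)
          then show ?thesis using \<phi>01 by (auto simp: indicator_def)
        qed
      qed (auto intro!: ind Bochner_Integration.integrable_diff)
      finally show ?case using elim by simp
    qed
  qed
  from tendsto_add[OF this Y_lim] show ?thesis by (simp add: q_def)
qed

end

section \<open>Conditional means in the urn model\<close>

context filtered_prob_space
begin

text \<open>Joining integrability to the almost sure value lets conditional moments be computed by
  composing rules, without repeating side conditions.\<close>

definition cond_mean :: "nat \<Rightarrow> ('a \<Rightarrow> real) \<Rightarrow> ('a \<Rightarrow> real) \<Rightarrow> bool" where
  "cond_mean n Y y \<longleftrightarrow> integrable M Y \<and> (AE w in M. real_cond_exp M (F n) Y w = y w)"

lemma cond_mean_real_cond_exp: "integrable M Y \<Longrightarrow> cond_mean n Y (real_cond_exp M (F n) Y)"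
  by (simp add: cond_mean_def)

lemma cond_mean_add:
  assumes "cond_mean n Y y" "cond_mean n Y' y'"
  shows "cond_mean n (\<lambda>w. Y w + Y' w) (\<lambda>w. y w + y' w)"
proof -
  have i: "integrable M Y" "integrable M Y'" using assms by (auto simp: cond_mean_def)
  have "AE w in M. real_cond_exp M (F n) Y w = y w" "AE w in M. real_cond_exp M (F n) Y' w = y' w"
    using assms by (auto simp: cond_mean_def)
  with cond.real_cond_exp_add[OF i, of n] have "AE w in M. real_cond_exp M (F n) (\<lambda>w. Y w + Y' w) w = y w + y' w"
    by eventually_elim simp
  with i show ?thesis by (simp add: cond_mean_def)
qed

lemma cond_mean_mult:
  assumes g: "g \<in> borel_measurable (F n)" "AE w in M. \<bar>g w\<bar> \<le> b" and "cond_mean n Y y"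
  shows "cond_mean n (\<lambda>w. g w * Y w) (\<lambda>w. g w * y w)"
proof -
  have [measurable]: "g \<in> borel_measurable M" by (rule F_measurable[OF g(1)])
  have i: "integrable M Y" and e: "AE w in M. real_cond_exp M (F n) Y w = y w"
    using assms by (auto simp: cond_mean_def)
  have [measurable]: "Y \<in> borel_measurable M" using i by auto
  have gi: "integrable M (\<lambda>w. g w * Y w)"
  proof (rule Bochner_Integration.integrable_bound[OF integrable_mult_right[OF integrable_norm[OF i], of b]])
    show "AE w in M. norm (g w * Y w) \<le> norm (b * norm (Y w))"
      using g(2) by eventually_elim (auto simp: abs_mult intro!: mult_right_mono)
  qed measurable
  from cond.real_cond_exp_mult[OF g(1) _ gi] e
  have "AE w in M. real_cond_exp M (F n) (\<lambda>w. g w * Y w) w = g w * y w"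
    by (auto elim!: eventually_elim2)
  with gi show ?thesis by (simp add: cond_mean_def)
qed

lemma cond_mean_cmult:
  "cond_mean n Y y \<Longrightarrow> cond_mean n (\<lambda>w. c * Y w) (\<lambda>w. c * y w)"
  by (rule cond_mean_mult[where b = "\<bar>c\<bar>"]) auto

lemma cond_mean_diff:
  assumes "cond_mean n Y y" "cond_mean n Y' y'"
  shows "cond_mean n (\<lambda>w. Y w - Y' w) (\<lambda>w. y w - y' w)"
  using cond_mean_add[OF assms(1) cond_mean_cmult[OF assms(2), of "-1"]] by simp

lemma cond_mean_cong:
  assumes "cond_mean n Y y" "AE w in M. Y w = Y' w" "AE w in M. y w = y' w" and [measurable]: "Y' \<in> borel_measurable M"
  shows "cond_mean n Y' y'"
proof -
  have i: "integrable M Y" and e: "AE w in M. real_cond_exp M (F n) Y w = y w"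
    using assms by (auto simp: cond_mean_def)
  have [measurable]: "Y \<in> borel_measurable M" using i by auto
  have "integrable M Y'" using i assms(2) by (subst integrable_cong_AE[of Y' M Y]) (auto simp: eq_commute)
  moreover have "AE w in M. real_cond_exp M (F n) Y' w = y' w"
    using cond.real_cond_exp_cong[OF assms(2), of n] e assms(3) by (auto elim!: eventually_elim2)
  ultimately show ?thesis by (simp add: cond_mean_def)
qed

text \<open>This form of the tower property feeds the \<open>balance\<close> hypothesis of
  \<open>positive_limit_of_proportion\<close>.\<close>

lemma integral_eq_if_cond_mean_eq:
  assumes "cond_mean n Y y" "cond_mean n Y' y"
  shows "(\<integral>w. Y w \<partial>M) = (\<integral>w. Y' w \<partial>M)"
proof -
  have i: "integrable M Y" "integrable M Y'" using assms by (auto simp: cond_mean_def)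
  have "AE w in M. real_cond_exp M (F n) Y w = y w" "AE w in M. real_cond_exp M (F n) Y' w = y w"
    using assms by (auto simp: cond_mean_def)
  then have "(\<integral>w. real_cond_exp M (F n) Y w \<partial>M) = (\<integral>w. real_cond_exp M (F n) Y' w \<partial>M)"
    by (intro integral_cong_AE) (auto elim!: eventually_elim2)
  then show ?thesis using i by (simp add: cond.real_cond_exp_int)
qed

end

section \<open>Sigma-algebras generated by discrete random variables\<close>

lemma measurable_generated_by:
  "h \<in> measurable (count_space UNIV) T \<Longrightarrow> (\<lambda>w. h (Y w)) \<in> measurable (generated_by M Y) T"
  unfolding generated_by_def
  by (rule measurable_compose[OF measurable_vimage_algebra1]) auto

lemma sets_generated_by: "sets (generated_by M Y) = {Y -` A \<inter> space M |A. True}"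
  unfolding generated_by_def by (subst sets_vimage_algebra2) auto

lemma space_generated_by [simp]: "space (generated_by M Y) = space M"
  by (simp add: generated_by_def)

lemma subalgebra_generated_by: "Y \<in> measurable M (count_space UNIV) \<Longrightarrow> subalgebra M (generated_by M Y)"
  by (auto simp: subalgebra_def sets_generated_by intro: measurable_sets)

lemma subalgebra_generated_by_fun: "subalgebra (generated_by M Y) (generated_by M (\<lambda>w. h (Y w)))"
  unfolding subalgebra_def
proof (intro conjI subsetI)
  fix E assume "E \<in> sets (generated_by M (\<lambda>w. h (Y w)))"
  then obtain A where "E = (\<lambda>w. h (Y w)) -` A \<inter> space M" by (auto simp: sets_generated_by)
  then have "E = Y -` (h -` A) \<inter> space M" by auto
  then show "E \<in> sets (generated_by M Y)" by (auto simp: sets_generated_by)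
qed simp

lemma measurable_count_space_Pair:
  fixes Y :: "'a \<Rightarrow> 'b :: countable" and Y' :: "'a \<Rightarrow> 'c :: countable"
  assumes "Y \<in> measurable M (count_space UNIV)" "Y' \<in> measurable M (count_space UNIV)"
  shows "(\<lambda>w. (Y w, Y' w)) \<in> measurable M (count_space UNIV)"
proof -
  have "(count_space UNIV :: 'b measure) \<Otimes>\<^sub>M (count_space UNIV :: 'c measure) = count_space UNIV"
    by (simp add: pair_measure_countable)
  with measurable_Pair[OF assms] show ?thesis by simp
qed

section \<open>The urn process, its filtration and its almost sure constraints\<close>

context urn_model
begin

abbreviation hist where "hist \<equiv> urn_history N X A B"
abbreviation F where "F \<equiv> urn_filtration M N X A B"
abbreviation H where "H \<equiv> urn_H a X A"
abbreviation K where "K \<equiv> urn_K b N X B"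
abbreviation S where "S \<equiv> urn_S a b N X A B"
abbreviation Z where "Z \<equiv> urn_Z a b N X A B"

lemma variables_measurable [measurable]:
  "N (Suc n) \<in> measurable M (count_space UNIV)" "X (Suc n) \<in> measurable M (count_space UNIV)"
  "A (Suc n) \<in> measurable M (count_space UNIV)" "B (Suc n) \<in> measurable M (count_space UNIV)"
  using random_variables[of "Suc n"] by auto

lemma hist_Suc: "hist (Suc n) w = hist n w @ [(N (Suc n) w, X (Suc n) w, A (Suc n) w, B (Suc n) w)]"
  by (simp add: urn_history_def)

lemma hist_measurable [measurable]: "hist n \<in> measurable M (count_space UNIV)"
proof (induction n)
  case 0
  have "hist 0 = (\<lambda>w. [])" by (simp add: urn_history_def fun_eq_iff)
  then show ?case by simp
next
  case (Suc n)
  have "(\<lambda>w. (hist n w, N (Suc n) w, X (Suc n) w, A (Suc n) w, B (Suc n) w)) \<in> measurable M (count_space UNIV)"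
    by (intro measurable_count_space_Pair Suc variables_measurable)
  moreover have "(\<lambda>(l, x). l @ [x]) \<in> measurable (count_space UNIV) (count_space UNIV)"
    by (simp only: measurable_count_space_eq1 space_count_space) blast
  ultimately have "(\<lambda>w. case (hist n w, N (Suc n) w, X (Suc n) w, A (Suc n) w, B (Suc n) w) of (l, x) \<Rightarrow> l @ [x])
    \<in> measurable M (count_space UNIV)"
    by (rule measurable_compose)
  then have "(\<lambda>w. hist n w @ [(N (Suc n) w, X (Suc n) w, A (Suc n) w, B (Suc n) w)]) \<in> measurable M (count_space UNIV)"
    by (simp only: prod.case)
  moreover have "hist (Suc n) = (\<lambda>w. hist n w @ [(N (Suc n) w, X (Suc n) w, A (Suc n) w, B (Suc n) w)])"
    by (rule ext) (rule hist_Suc)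
  ultimately show ?case by (simp only:)
qed

sublocale filtered_prob_space M F
proof
  fix n
  show "subalgebra M (F n)" unfolding urn_filtration_def by (rule subalgebra_generated_by) measurable
  \<comment> \<open>Dropping the last entry of the longer history recovers the shorter one, so
    \<open>F n\<close> is generated by a function of \<open>hist (Suc n)\<close>.\<close>
  have "F n = generated_by M (\<lambda>w. butlast (hist (Suc n) w))" by (simp add: urn_filtration_def hist_Suc)
  moreover have "F (Suc n) = generated_by M (hist (Suc n))" by (rule urn_filtration_def)
  ultimately show "subalgebra (F (Suc n)) (F n)" by (simp only: subalgebra_generated_by_fun)
qed

lemma F_measurable_hist: "(\<lambda>w. h (hist n w)) \<in> measurable (F n) (count_space UNIV)"
  unfolding urn_filtration_def by (rule measurable_generated_by) simp

lemma F_measurable_variables: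
  "N (Suc n) \<in> measurable (F (Suc n)) (count_space UNIV)" "X (Suc n) \<in> measurable (F (Suc n)) (count_space UNIV)"
  "A (Suc n) \<in> measurable (F (Suc n)) (count_space UNIV)" "B (Suc n) \<in> measurable (F (Suc n)) (count_space UNIV)"
  using F_measurable_hist[of "\<lambda>l. fst (last l)" "Suc n"] F_measurable_hist[of "\<lambda>l. fst (snd (last l))" "Suc n"]
    F_measurable_hist[of "\<lambda>l. fst (snd (snd (last l)))" "Suc n"] F_measurable_hist[of "\<lambda>l. snd (snd (snd (last l)))" "Suc n"]
  by (simp_all add: hist_Suc)

lemma urn_steps:
  "H 0 w = a" "K 0 w = b" "S 0 w = a + b"
  "H (Suc n) w = H n w + A (Suc n) w * X (Suc n) w"
  "K (Suc n) w = K n w + B (Suc n) w * (N (Suc n) w - X (Suc n) w)"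
  by (simp_all add: urn_S_def urn_H_def urn_K_def)

text \<open>Writing the urn content as a function of the history makes it measurable for
  \<open>F n\<close>, since every function on a discrete space is measurable.\<close>

lemma H_eq_hist: "H n w = a + sum_list (map (\<lambda>(n, x, a, b). a * x) (hist n w))"
  by (induction n) (auto simp: urn_steps hist_Suc, simp add: urn_history_def)

lemma K_eq_hist: "K n w = b + sum_list (map (\<lambda>(n, x, a, b). b * (n - x)) (hist n w))"
  by (induction n) (auto simp: urn_steps hist_Suc, simp add: urn_history_def)

lemma F_measurable_urn:
  "H n \<in> measurable (F n) (count_space UNIV)" "S n \<in> measurable (F n) (count_space UNIV)"
proof -
  let ?h = "\<lambda>l. a + sum_list (map (\<lambda>(n, x, a, b). a * x) l)"
    and ?k = "\<lambda>l. b + sum_list (map (\<lambda>(n, x, a, b). b * (n - x)) l)"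
  show "H n \<in> measurable (F n) (count_space UNIV)"
    unfolding H_eq_hist[abs_def] by (rule F_measurable_hist[of ?h])
  show "S n \<in> measurable (F n) (count_space UNIV)"
    unfolding urn_S_def[abs_def] H_eq_hist K_eq_hist by (rule F_measurable_hist[of "\<lambda>l. ?h l + ?k l"])
qed

lemma urn_measurable [measurable]:
  "H n \<in> measurable M (count_space UNIV)" "S n \<in> measurable M (count_space UNIV)"
  using F_measurable_urn[of n] by (auto intro: F_measurable)

lemma F_measurable_Z: "Z n \<in> borel_measurable (F n)"
proof -
  note F_measurable_urn[of n, measurable]
  show ?thesis unfolding urn_Z_def[abs_def] by measurable
qed

lemma Z_measurable [measurable]: "Z n \<in> borel_measurable M"
  by (rule F_measurable[OF F_measurable_Z])

lemma H_ge_1: "1 \<le> H n w" and K_ge_1: "1 \<le> K n w" and S_ge_2: "2 \<le> S n w" and H_le_S: "H n w \<le> S n w"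
proof -
  show "1 \<le> H n w" "1 \<le> K n w" using a_ge_1 b_ge_1 by (auto simp: urn_H_def urn_K_def)
  then show "2 \<le> S n w" "H n w \<le> S n w" by (auto simp: urn_S_def)
qed

lemma Z_bounds: "0 \<le> Z n w" "Z n w \<le> 1"
  using H_le_S[of n w] by (auto simp: urn_Z_def divide_le_eq_1)

lemma sample_size_Suc: "AE w in M. (\<Sum>k=1..S n w. cond_mass M (F n) (N (Suc n)) k w) = 1"
proof -
  have "1 \<le> Suc n" by simp
  from sample_size[OF this] show ?thesis by (simp only: diff_Suc_1)
qed

text \<open>The assumption speaks of conditional masses, summed over a random range. On each of the
  countably many events S n = s the range is fixed; integrating the masses there shows that the part
  of the event where the sample size leaves 1..s has probability 0.\<close>

lemma sample_size_range: "AE w in M. 1 \<le> N (Suc n) w \<and> N (Suc n) w \<le> S n w"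
proof -
  let ?i = "\<lambda>k. indicator {w \<in> space M. N (Suc n) w = k} :: 'a \<Rightarrow> real"
  have "AE w in M. S n w = s \<longrightarrow> 1 \<le> N (Suc n) w \<and> N (Suc n) w \<le> s" for s
  proof -
    let ?e = "indicator {w \<in> space M. S n w = s} :: 'a \<Rightarrow> real"
    have e: "?e \<in> borel_measurable (F n)"
    proof -
      have "{w \<in> space (F n). S n w = s} \<in> sets (F n)"
        using F_measurable_urn(2)[of n] by measurable
      then show ?thesis by (simp add: urn_filtration_def)
    qed
    have int: "integrable M (\<lambda>w. ?e w * ?i k w)" for k
      by (intro integrable_AE_bounded[where c = 1]) (auto simp: indicator_def)
    have int_e: "integrable M ?e" by (intro integrable_AE_bounded[where c = 1]) (auto simp: indicator_def)
    have int_c: "integrable M (\<lambda>w. ?e w * cond_mass M (F n) (N (Suc n)) k w)" for k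
      unfolding cond_mass_def using e int by (intro cond.real_cond_exp_intg(1)) auto
    have "(\<integral>w. (\<Sum>k=1..s. ?e w * ?i k w) \<partial>M) = (\<Sum>k=1..s. \<integral>w. ?e w * cond_mass M (F n) (N (Suc n)) k w \<partial>M)"
    proof -
      have "(\<integral>w. ?e w * ?i k w \<partial>M) = (\<integral>w. ?e w * cond_mass M (F n) (N (Suc n)) k w \<partial>M)" for k
        unfolding cond_mass_def using e int[of k] by (intro cond.real_cond_exp_intg(2)[symmetric]) auto
      then show ?thesis by (simp only: Bochner_Integration.integral_sum[OF int])
    qed
    also have "\<dots> = (\<integral>w. (\<Sum>k=1..s. ?e w * cond_mass M (F n) (N (Suc n)) k w) \<partial>M)"
      by (simp only: Bochner_Integration.integral_sum[OF int_c])
    also have "\<dots> = (\<integral>w. ?e w \<partial>M)"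
    proof (rule integral_cong_AE)
      show "AE w in M. (\<Sum>k=1..s. ?e w * cond_mass M (F n) (N (Suc n)) k w) = ?e w"
        using sample_size_Suc[of n]
      proof eventually_elim
        case (elim w)
        then show ?case by (simp only: sum_distrib_left[symmetric]) (auto simp: indicator_def)
      qed
      show "(\<lambda>w. \<Sum>k=1..s. ?e w * cond_mass M (F n) (N (Suc n)) k w) \<in> borel_measurable M"
        by (intro borel_measurable_sum borel_measurable_integrable int_c)
    qed measurable
    finally have "(\<integral>w. ?e w - (\<Sum>k=1..s. ?e w * ?i k w) \<partial>M) = 0"
      by (simp only: Bochner_Integration.integral_diff[OF int_e Bochner_Integration.integrable_sum[OF int]])
    moreover have val: "?e w - (\<Sum>k=1..s. ?e w * ?i k w)
      = (if S n w = s \<and> \<not> (1 \<le> N (Suc n) w \<and> N (Suc n) w \<le> s) then 1 else 0)" if "w \<in> space M" for w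
    proof -
      have "(\<Sum>k=1..s. ?e w * ?i k w) = ?e w * (\<Sum>k=1..s. if N (Suc n) w = k then 1 else 0)"
        unfolding sum_distrib_left[symmetric] using that by (intro arg_cong2[where f = "(*)"] sum.cong) (auto simp: indicator_def)
      also have "(\<Sum>k=1..s. if N (Suc n) w = k then 1 else 0) = (if 1 \<le> N (Suc n) w \<and> N (Suc n) w \<le> s then 1 else 0 :: real)"
        by (simp add: sum.delta')
      finally show ?thesis using that by (auto simp: indicator_def)
    qed
    moreover have "integrable M (\<lambda>w. ?e w - (\<Sum>k=1..s. ?e w * ?i k w))"
      by (intro Bochner_Integration.integrable_diff Bochner_Integration.integrable_sum int int_e)
    moreover have "AE w in M. 0 \<le> ?e w - (\<Sum>k=1..s. ?e w * ?i k w)"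
      by (rule AE_I2, subst val) auto
    ultimately have "AE w in M. ?e w - (\<Sum>k=1..s. ?e w * ?i k w) = 0"
      using integral_nonneg_eq_0_iff_AE by blast
    then show ?thesis using AE_space
    proof eventually_elim
      case (elim w)
      then show ?case using val[OF elim(2)] by (auto split: if_splits)
    qed
  qed
  then have "AE w in M. \<forall>s. S n w = s \<longrightarrow> 1 \<le> N (Suc n) w \<and> N (Suc n) w \<le> s"
    unfolding AE_all_countable by blast
  then show ?thesis by eventually_elim blast
qed

text \<open>What is known once the size of sample n + 1 has been chosen, before its composition
  is.\<close>

abbreviation G where "G n \<equiv> generated_by M (\<lambda>w. (hist n w, N (Suc n) w))"

lemma sigma_finite_G: "sigma_finite_subalgebra M (G n)"
proof -
  have "finite_measure_subalgebra M (G n)"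
    by unfold_locales (intro subalgebra_generated_by measurable_count_space_Pair hist_measurable variables_measurable)
  then show ?thesis by (rule finite_measure_subalgebra_is_sigma_finite)
qed

lemma subalgebra_G_F: "subalgebra (G n) (F n)"
  unfolding urn_filtration_def using subalgebra_generated_by_fun[of M "\<lambda>w. (hist n w, N (Suc n) w)" fst] by simp

lemma G_measurable_N: "N (Suc n) \<in> measurable (G n) (count_space UNIV)"
  using measurable_generated_by[of snd "count_space UNIV" "\<lambda>w. (hist n w, N (Suc n) w)" M] by simp

lemma sample_composition_Suc:
  "AE w in M. \<forall>k. cond_mass M (G n) (X (Suc n)) k w = hypergeometric_mass (N (Suc n) w) (S n w) (H n w) k"
  using sample_composition[of "Suc n"] by simp

text \<open>\<open>hypergeometric_mass\<close> is 0 for k above the sample size by its case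
  distinction, so for each k the event X = k > N has probability 0.\<close>

lemma X_le_N: "AE w in M. X (Suc n) w \<le> N (Suc n) w"
proof -
  interpret G: sigma_finite_subalgebra M "G n" by (rule sigma_finite_G)
  let ?i = "\<lambda>k. indicator {w \<in> space M. X (Suc n) w = k} :: 'a \<Rightarrow> real"
  have "AE w in M. \<not> (X (Suc n) w = k \<and> N (Suc n) w < k)" for k
  proof -
    let ?e = "indicator {w \<in> space M. N (Suc n) w < k} :: 'a \<Rightarrow> real"
    have e: "?e \<in> borel_measurable (G n)"
    proof -
      have "{w \<in> space (G n). N (Suc n) w < k} \<in> sets (G n)"
        using G_measurable_N[of n] by measurable
      then show ?thesis by simp
    qed
    have int: "integrable M (\<lambda>w. ?e w * ?i k w)"
      by (intro integrable_AE_bounded[where c = 1]) (auto simp: indicator_def)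
    have "(\<integral>w. ?e w * ?i k w \<partial>M) = (\<integral>w. ?e w * cond_mass M (G n) (X (Suc n)) k w \<partial>M)"
      unfolding cond_mass_def using e int by (intro G.real_cond_exp_intg(2)[symmetric]) auto
    also have "\<dots> = (\<integral>w. 0 \<partial>M)"
    proof (rule integral_cong_AE)
      show "AE w in M. ?e w * cond_mass M (G n) (X (Suc n)) k w = 0"
        using sample_composition_Suc[of n] by eventually_elim (auto simp: hypergeometric_mass_def indicator_def)
      show "(\<lambda>w. ?e w * cond_mass M (G n) (X (Suc n)) k w) \<in> borel_measurable M"
        unfolding cond_mass_def by measurable
    qed simp
    finally have "AE w in M. ?e w * ?i k w = 0"
      using int by (subst integral_nonneg_eq_0_iff_AE[symmetric]) auto
    then show ?thesis using AE_space by eventually_elim (auto simp: indicator_def split: if_splits)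
  qed
  then have "AE w in M. \<forall>k. \<not> (X (Suc n) w = k \<and> N (Suc n) w < k)"
    unfolding AE_all_countable by blast
  then show ?thesis by eventually_elim (auto simp: not_less)
qed

end

lemma (in prob_space) indep_var_if_indep_set:
  assumes indep: "indep_set (sets P) (sets Q)"
    and f: "f \<in> measurable P S" "f \<in> measurable M S" and g: "g \<in> measurable Q T" "g \<in> measurable M T"
    and space: "space P = space M" "space Q = space M"
  shows "indep_var S f T g"
  unfolding indep_var_eq
proof (intro conjI f g indep_setI)
  have P: "sigma_sets (space M) {f -` A \<inter> space M |A. A \<in> sets S} \<subseteq> sets P"
    using sets_image_in_sets[OF space(1) f(1)] by (simp add: sets_vimage_algebra)
  have Q: "sigma_sets (space M) {g -` A \<inter> space M |A. A \<in> sets T} \<subseteq> sets Q"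
    using sets_image_in_sets[OF space(2) g(1)] by (simp add: sets_vimage_algebra)
  have ev: "sets P \<subseteq> events" "sets Q \<subseteq> events" using indep by (rule indep_setD_ev1, rule indep_setD_ev2)
  show "sigma_sets (space M) {f -` A \<inter> space M |A. A \<in> sets S} \<subseteq> events" using P ev by blast
  show "sigma_sets (space M) {g -` A \<inter> space M |A. A \<in> sets T} \<subseteq> events" using Q ev by blast
  fix a b
  assume "a \<in> sigma_sets (space M) {f -` A \<inter> space M |A. A \<in> sets S}"
    and "b \<in> sigma_sets (space M) {g -` A \<inter> space M |A. A \<in> sets T}"
  with P Q show "prob (a \<inter> b) = prob a * prob b" by (intro indep_setD[OF indep]) auto
qed

section \<open>Conditional expectations of functions of the draw and of the additions\<close>

locale bounded_urn = urn_model M a b N X A B for M :: "'a measure" and a b N X A B +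
  fixes C :: nat
  assumes bounded: "AE w in M. A (Suc n) w \<le> C \<and> B (Suc n) w \<le> C \<and> N (Suc n) w \<le> C"
begin

lemma path_bounds: "AE w in M. \<forall>n. 1 \<le> N (Suc n) w \<and> N (Suc n) w \<le> S n w \<and> X (Suc n) w \<le> N (Suc n) w \<and>
  1 \<le> A (Suc n) w \<and> 1 \<le> B (Suc n) w \<and> A (Suc n) w \<le> C \<and> B (Suc n) w \<le> C \<and> N (Suc n) w \<le> C"
  unfolding AE_all_countable
proof
  fix n
  have "AE w in M. 1 \<le> A (Suc n) w \<and> 1 \<le> B (Suc n) w" by (rule additions_pos) simp
  with sample_size_range[of n] X_le_N[of n] bounded[of n]
  show "AE w in M. 1 \<le> N (Suc n) w \<and> N (Suc n) w \<le> S n w \<and> X (Suc n) w \<le> N (Suc n) w \<and>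
    1 \<le> A (Suc n) w \<and> 1 \<le> B (Suc n) w \<and> A (Suc n) w \<le> C \<and> B (Suc n) w \<le> C \<and> N (Suc n) w \<le> C"
    by eventually_elim blast
qed

lemma borel_measurable_fun2:
  fixes f :: "nat \<Rightarrow> nat \<Rightarrow> real"
  assumes "u \<in> measurable T (count_space UNIV)" "v \<in> measurable T (count_space UNIV)"
  shows "(\<lambda>w. f (u w) (v w)) \<in> borel_measurable T"
proof -
  have "case_prod f \<in> measurable (count_space UNIV) borel" by simp
  from measurable_compose[OF measurable_count_space_Pair[OF assms] this] show ?thesis by simp
qed

text \<open>A crude bound, but one that serves every function of two values in 0..C and so settles
  all integrability questions at once.\<close>

lemma abs_le_sum_of_values:
  fixes f :: "nat \<Rightarrow> nat \<Rightarrow> real"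
  assumes "i \<le> C" "j \<le> C"
  shows "\<bar>f i j\<bar> \<le> (\<Sum>i\<le>C. \<Sum>j\<le>C. \<bar>f i j\<bar>)"
proof -
  have "\<bar>f i j\<bar> \<le> (\<Sum>j\<le>C. \<bar>f i j\<bar>)" using assms by (intro member_le_sum) auto
  also have "\<dots> \<le> (\<Sum>i\<le>C. \<Sum>j\<le>C. \<bar>f i j\<bar>)"
    using assms by (intro member_le_sum[of i "{..C}" "\<lambda>i. \<Sum>j\<le>C. \<bar>f i j\<bar>"]) (auto intro: sum_nonneg)
  finally show ?thesis .
qed

lemma integrable_fun2:
  fixes f :: "nat \<Rightarrow> nat \<Rightarrow> real"
  assumes [measurable]: "u \<in> measurable M (count_space UNIV)" "v \<in> measurable M (count_space UNIV)"
    and le: "AE w in M. u w \<le> C \<and> v w \<le> C"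
  shows "integrable M (\<lambda>w. f (u w) (v w))"
proof (rule integrable_AE_bounded)
  show "AE w in M. norm (f (u w) (v w)) \<le> (\<Sum>i\<le>C. \<Sum>j\<le>C. \<bar>f i j\<bar>)"
    using le by eventually_elim (simp add: abs_le_sum_of_values)
qed (rule borel_measurable_fun2[OF assms(1,2)])

lemma N_X_le: "AE w in M. N (Suc n) w \<le> C \<and> X (Suc n) w \<le> C"
  using path_bounds by eventually_elim (meson order_trans)

lemma A_B_le: "AE w in M. A (Suc n) w \<le> C \<and> B (Suc n) w \<le> C"
  using path_bounds by eventually_elim blast

lemma integrable_N_X: "integrable M (\<lambda>w. p (N (Suc n) w) (X (Suc n) w) :: real)"
  using N_X_le by (intro integrable_fun2) measurable

lemma integrable_A_B: "integrable M (\<lambda>w. f (A (Suc n) w) (B (Suc n) w) :: real)"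
  using A_B_le by (intro integrable_fun2) measurable

text \<open>The variable is the finite sum over k <= C of p(N, k) times the indicator of X = k. The
  first factor is known to \<open>G n\<close> and can be pulled out, and the masses with k > N
  vanish.\<close>

lemma cond_exp_composition:
  fixes p :: "nat \<Rightarrow> nat \<Rightarrow> real"
  shows "AE w in M. real_cond_exp M (G n) (\<lambda>w. p (N (Suc n) w) (X (Suc n) w)) w
    = (\<Sum>k\<le>N (Suc n) w. p (N (Suc n) w) k * hypergeometric_mass (N (Suc n) w) (S n w) (H n w) k)"
proof -
  interpret G: sigma_finite_subalgebra M "G n" by (rule sigma_finite_G)
  define f where "f k w = p (N (Suc n) w) k * indicator {w \<in> space M. X (Suc n) w = k} w" for k w
  have f_int: "integrable M (f k)" for k
    unfolding f_def[abs_def]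
    by (rule integrable_real_mult_indicator) (use integrable_N_X[of "\<lambda>i j. p i k" n] in measurable)
  have "AE w in M. real_cond_exp M (G n) (f k) w = p (N (Suc n) w) k * cond_mass M (G n) (X (Suc n)) k w" for k
    using f_int[of k] unfolding f_def[abs_def] cond_mass_def
  proof (intro G.real_cond_exp_mult)
    have "(\<lambda>i. p i k) \<in> measurable (count_space UNIV) borel" by simp
    from measurable_compose[OF G_measurable_N this] show "(\<lambda>w. p (N (Suc n) w) k) \<in> borel_measurable (G n)" .
  qed simp_all
  then have 1: "AE w in M. \<forall>k. real_cond_exp M (G n) (f k) w = p (N (Suc n) w) k * cond_mass M (G n) (X (Suc n)) k w"
    unfolding AE_all_countable by blast
  have 2: "AE w in M. real_cond_exp M (G n) (\<lambda>w. \<Sum>k\<in>{..C}. f k w) w = (\<Sum>k\<in>{..C}. real_cond_exp M (G n) (f k) w)"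
    by (rule G.real_cond_exp_sum[OF f_int])
  have 3: "AE w in M. real_cond_exp M (G n) (\<lambda>w. p (N (Suc n) w) (X (Suc n) w)) w
    = real_cond_exp M (G n) (\<lambda>w. \<Sum>k\<in>{..C}. f k w) w"
  proof (rule G.real_cond_exp_cong)
    show "AE w in M. p (N (Suc n) w) (X (Suc n) w) = (\<Sum>k\<in>{..C}. f k w)"
      using N_X_le[of n] AE_space
    proof eventually_elim
      case (elim w)
      have "(\<Sum>k\<in>{..C}. f k w) = (\<Sum>k\<in>{..C}. if k = X (Suc n) w then p (N (Suc n) w) k else 0)"
        using elim by (intro sum.cong) (auto simp: f_def)
      with elim show ?case by simp
    qed
    show "(\<lambda>w. \<Sum>k\<in>{..C}. f k w) \<in> borel_measurable M"
      by (intro borel_measurable_sum borel_measurable_integrable f_int)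
  qed (rule borel_measurable_integrable[OF integrable_N_X])
  show ?thesis using 1 2 3 sample_composition_Suc[of n] N_X_le[of n]
  proof eventually_elim
    case (elim w)
    have "real_cond_exp M (G n) (\<lambda>w. p (N (Suc n) w) (X (Suc n) w)) w
      = (\<Sum>k\<le>C. p (N (Suc n) w) k * hypergeometric_mass (N (Suc n) w) (S n w) (H n w) k)"
      using elim by simp
    also have "\<dots> = (\<Sum>k\<le>N (Suc n) w. p (N (Suc n) w) k * hypergeometric_mass (N (Suc n) w) (S n w) (H n w) k)"
      using elim by (intro sum.mono_neutral_right) (auto simp: hypergeometric_mass_def)
    finally show ?case .
  qed
qed

text \<open>Tower property: condition first on \<open>G n\<close>, which contains
  \<open>F n\<close>, then on \<open>F n\<close>.\<close>

lemma cond_mean_composition: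
  fixes p :: "nat \<Rightarrow> nat \<Rightarrow> real"
  assumes eq: "AE w in M. (\<Sum>k\<le>N (Suc n) w. p (N (Suc n) w) k *
      hypergeometric_mass (N (Suc n) w) (S n w) (H n w) k) = Y w"
    and Y: "cond_mean n Y y"
  shows "cond_mean n (\<lambda>w. p (N (Suc n) w) (X (Suc n) w)) y"
proof -
  interpret G: sigma_finite_subalgebra M "G n" by (rule sigma_finite_G)
  let ?f = "\<lambda>w. p (N (Suc n) w) (X (Suc n) w)"
  have [measurable]: "Y \<in> borel_measurable M" using Y by (auto simp: cond_mean_def)
  have "AE w in M. real_cond_exp M (G n) ?f w = Y w"
    using cond_exp_composition[of n p] eq by eventually_elim simp
  then have "AE w in M. real_cond_exp M (F n) (real_cond_exp M (G n) ?f) w = real_cond_exp M (F n) Y w"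
    by (rule cond.real_cond_exp_cong) measurable
  moreover have "AE w in M. real_cond_exp M (F n) (real_cond_exp M (G n) ?f) w = real_cond_exp M (F n) ?f w"
    by (rule cond.real_cond_exp_nested_subalg[OF G.subalg subalgebra_G_F integrable_N_X])
  moreover have "AE w in M. real_cond_exp M (F n) Y w = y w" using Y by (simp add: cond_mean_def)
  ultimately have "AE w in M. real_cond_exp M (F n) ?f w = y w" by eventually_elim simp
  then show ?thesis by (simp add: cond_mean_def integrable_N_X)
qed

lemma additions_indep_set:
  "indep_set (sets (generated_by M (\<lambda>w. (A (Suc n) w, B (Suc n) w))))
    (sets (generated_by M (\<lambda>w. (hist n w, N (Suc n) w, X (Suc n) w))))"
proof -
  have "1 \<le> Suc n" by simp
  from additions_indep[OF this] show ?thesis by (simp only: diff_Suc_1)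
qed

text \<open>An event of \<open>F n\<close> is determined by the history, so over it \<open>q\<close>
  becomes a function of history, sample size and composition, from which the additions are
  independent; the integral factorizes. Products f(A,B) q(N,X) are general enough, because the later
  moments expand into sums of them with coefficients known at time n.\<close>

lemma cond_mean_additions:
  fixes f q :: "nat \<Rightarrow> nat \<Rightarrow> real"
  assumes q: "cond_mean n (\<lambda>w. q (N (Suc n) w) (X (Suc n) w)) y"
  shows "cond_mean n (\<lambda>w. f (A (Suc n) w) (B (Suc n) w) * q (N (Suc n) w) (X (Suc n) w))
    (\<lambda>w. (\<integral>w. f (A (Suc n) w) (B (Suc n) w) \<partial>M) * y w)"
proof -
  let ?f = "\<lambda>w. f (A (Suc n) w) (B (Suc n) w)" and ?q = "\<lambda>w. q (N (Suc n) w) (X (Suc n) w)"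
  let ?e = "real_cond_exp M (F n) ?q"
  have prod: "integrable M (\<lambda>w. ?f w * h (hist n w, N (Suc n) w, X (Suc n) w))
    \<and> (\<integral>w. ?f w * h (hist n w, N (Suc n) w, X (Suc n) w) \<partial>M)
      = (\<integral>w. ?f w \<partial>M) * (\<integral>w. h (hist n w, N (Suc n) w, X (Suc n) w) \<partial>M)"
    if h: "integrable M (\<lambda>w. h (hist n w, N (Suc n) w, X (Suc n) w))" for h :: "_ \<Rightarrow> real"
  proof -
    have "indep_var borel ?f borel (\<lambda>w. h (hist n w, N (Suc n) w, X (Suc n) w))"
    proof (rule indep_var_if_indep_set[OF additions_indep_set])
      show "?f \<in> borel_measurable (generated_by M (\<lambda>w. (A (Suc n) w, B (Suc n) w)))"
        using measurable_generated_by[of "case_prod f" borel "\<lambda>w. (A (Suc n) w, B (Suc n) w)" M] by simp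
      show "(\<lambda>w. h (hist n w, N (Suc n) w, X (Suc n) w))
        \<in> borel_measurable (generated_by M (\<lambda>w. (hist n w, N (Suc n) w, X (Suc n) w)))"
        by (rule measurable_generated_by) simp
    qed (use h in auto)
    from indep_var_integrable[OF this integrable_A_B h] indep_var_lebesgue_integral[OF this integrable_A_B h]
    show ?thesis by simp
  qed
  have int: "integrable M (\<lambda>w. ?f w * ?q w)"
    using prod[of "\<lambda>(l, i, j). q i j"] integrable_N_X[of q n] by simp
  have e_int: "integrable M ?e" by (rule cond.real_cond_exp_int(1)[OF integrable_N_X])
  have "AE w in M. real_cond_exp M (F n) (\<lambda>w. ?f w * ?q w) w = (\<integral>w. ?f w \<partial>M) * ?e w"
  proof (rule cond.real_cond_exp_charact)
    fix E assume E: "E \<in> sets (F n)"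
    then obtain U where U: "E = hist n -` U \<inter> space M" by (auto simp: urn_filtration_def sets_generated_by)
    have [measurable]: "E \<in> sets M" using E subalgebra_F[of n] by (auto simp: subalgebra_def)
    define h :: "_ \<times> nat \<times> nat \<Rightarrow> real" where "h = (\<lambda>(l, i, j). indicator U l * q i j)"
    have h: "indicator E w * ?q w = h (hist n w, N (Suc n) w, X (Suc n) w)" if "w \<in> space M" for w
      using that by (auto simp: h_def U indicator_def)
    have int_h: "integrable M (\<lambda>w. h (hist n w, N (Suc n) w, X (Suc n) w))"
    proof -
      have "integrable M (\<lambda>w. indicator E w * ?q w)"
        using integrable_mult_indicator[OF \<open>E \<in> sets M\<close> integrable_N_X[of q n]] by simp
      then show ?thesis by (subst Bochner_Integration.integrable_cong[OF refl h[symmetric]])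
    qed
    have "(\<integral>w\<in>E. ?f w * ?q w \<partial>M) = (\<integral>w. ?f w * h (hist n w, N (Suc n) w, X (Suc n) w) \<partial>M)"
      unfolding set_lebesgue_integral_def
      by (intro Bochner_Integration.integral_cong refl) (simp add: h[symmetric] mult.left_commute)
    also have "\<dots> = (\<integral>w. ?f w \<partial>M) * (\<integral>w. h (hist n w, N (Suc n) w, X (Suc n) w) \<partial>M)"
      using prod[OF int_h] by simp
    also have "(\<integral>w. h (hist n w, N (Suc n) w, X (Suc n) w) \<partial>M) = (\<integral>w\<in>E. ?q w \<partial>M)"
      unfolding set_lebesgue_integral_def
      by (intro Bochner_Integration.integral_cong refl) (simp add: h[symmetric])
    also have "\<dots> = (\<integral>w\<in>E. ?e w \<partial>M)" by (rule cond.real_cond_exp_intA[OF integrable_N_X E])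
    also have "(\<integral>w. ?f w \<partial>M) * (\<integral>w\<in>E. ?e w \<partial>M) = (\<integral>w\<in>E. (\<integral>w. ?f w \<partial>M) * ?e w \<partial>M)" by simp
    finally show "(\<integral>w\<in>E. ?f w * ?q w \<partial>M) = (\<integral>w\<in>E. (\<integral>w. ?f w \<partial>M) * ?e w \<partial>M)" .
  next
    show "(\<lambda>w. (\<integral>w. ?f w \<partial>M) * ?e w) \<in> borel_measurable (F n)"
      by (intro borel_measurable_times borel_measurable_const borel_measurable_cond_exp)
  qed (use int e_int in auto)
  moreover have "AE w in M. ?e w = y w" using q by (simp add: cond_mean_def)
  ultimately have "AE w in M. real_cond_exp M (F n) (\<lambda>w. ?f w * ?q w) w = (\<integral>w. ?f w \<partial>M) * y w"
    by eventually_elim simp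
  with int show ?thesis by (simp add: cond_mean_def)
qed

section \<open>Conditional moments of the sample and of the drift\<close>

definition \<nu> :: "nat \<Rightarrow> 'a \<Rightarrow> real" where "\<nu> n = real_cond_exp M (F n) (\<lambda>w. real (N (Suc n) w))"
definition \<theta> :: "nat \<Rightarrow> 'a \<Rightarrow> real" where "\<theta> n = real_cond_exp M (F n) (\<lambda>w. (real (N (Suc n) w))\<^sup>2)"

text \<open>The proportion of colour A after one ball of that colour has been removed: the
  probability that a second sampled ball is A given that the first one is.\<close>

definition Z' :: "nat \<Rightarrow> 'a \<Rightarrow> real" where "Z' n w = (real (H n w) - 1) / (real (S n w) - 1)"

definition \<xi> :: "nat \<Rightarrow> 'a \<Rightarrow> real" where
  "\<xi> n w = Z n w * \<nu> n w + Z n w * Z' n w * (\<theta> n w - \<nu> n w)"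

lemma cond_mean_N: "cond_mean n (\<lambda>w. real (N (Suc n) w)) (\<nu> n)"
  unfolding \<nu>_def using integrable_N_X[of "\<lambda>i j. real i" n] by (rule cond_mean_real_cond_exp)

lemma cond_mean_N_square: "cond_mean n (\<lambda>w. (real (N (Suc n) w))\<^sup>2) (\<theta> n)"
  unfolding \<theta>_def using integrable_N_X[of "\<lambda>i j. (real i)\<^sup>2" n] by (rule cond_mean_real_cond_exp)

lemma Z'_measurable: "Z' n \<in> borel_measurable (F n)"
proof -
  note F_measurable_urn[of n, measurable]
  show ?thesis unfolding Z'_def[abs_def] by measurable
qed

lemma Z'_bounds: "0 \<le> Z' n w" "Z' n w \<le> 1"
  using H_le_S[of n w] H_ge_1[of n w] S_ge_2[of n w] by (auto simp: Z'_def divide_le_eq_1)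

lemma cond_mean_X: "cond_mean n (\<lambda>w. real (X (Suc n) w)) (\<lambda>w. Z n w * \<nu> n w)"
proof (rule cond_mean_composition[where p = "\<lambda>i j. real j"])
  show "cond_mean n (\<lambda>w. Z n w * real (N (Suc n) w)) (\<lambda>w. Z n w * \<nu> n w)"
    using Z_bounds by (intro cond_mean_mult[where b = 1] F_measurable_Z cond_mean_N) (auto simp: abs_le_iff intro: order_trans[of _ 0])
  show "AE w in M. (\<Sum>k\<le>N (Suc n) w. real k * hypergeometric_mass (N (Suc n) w) (S n w) (H n w) k) = Z n w * real (N (Suc n) w)"
    using path_bounds
  proof eventually_elim
    case (elim w)
    have "0 < S n w" using S_ge_2[of n w] by simp
    with elim H_le_S[of n w] show ?case by (subst hypergeometric_mean) (auto simp: urn_Z_def)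
  qed
qed

lemma cond_mean_N_times_X: "cond_mean n (\<lambda>w. real (N (Suc n) w) * real (X (Suc n) w)) (\<lambda>w. Z n w * \<theta> n w)"
proof (rule cond_mean_composition[where p = "\<lambda>i j. real i * real j"])
  show "cond_mean n (\<lambda>w. Z n w * (real (N (Suc n) w))\<^sup>2) (\<lambda>w. Z n w * \<theta> n w)"
    using Z_bounds by (intro cond_mean_mult[where b = 1] F_measurable_Z cond_mean_N_square) (auto simp: abs_le_iff intro: order_trans[of _ 0])
  show "AE w in M. (\<Sum>k\<le>N (Suc n) w. real (N (Suc n) w) * real k * hypergeometric_mass (N (Suc n) w) (S n w) (H n w) k)
    = Z n w * (real (N (Suc n) w))\<^sup>2"
    using path_bounds
  proof eventually_elim
    case (elim w)
    have "0 < S n w" using S_ge_2[of n w] by simp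
    with elim H_le_S[of n w] show ?case
      by (simp only: mult.assoc sum_distrib_left[symmetric], subst hypergeometric_mean) (auto simp: urn_Z_def power2_eq_square)
  qed
qed

text \<open>X^2 = X + X(X - 1), with the hypergeometric factorial moment for the second
  term.\<close>

lemma cond_mean_X_square: "cond_mean n (\<lambda>w. (real (X (Suc n) w))\<^sup>2) (\<xi> n)"
proof -
  have "cond_mean n (\<lambda>w. real (X (Suc n) w) * (real (X (Suc n) w) - 1))
    (\<lambda>w. Z n w * (Z' n w * (\<theta> n w - \<nu> n w)))"
  proof (rule cond_mean_composition[where p = "\<lambda>i j. real j * (real j - 1)"])
    show "cond_mean n (\<lambda>w. Z n w * (Z' n w * ((real (N (Suc n) w))\<^sup>2 - real (N (Suc n) w))))
      (\<lambda>w. Z n w * (Z' n w * (\<theta> n w - \<nu> n w)))"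
      using Z_bounds Z'_bounds
      by (intro cond_mean_mult[where b = 1] F_measurable_Z Z'_measurable cond_mean_diff cond_mean_N cond_mean_N_square)
         (auto simp: abs_le_iff intro: order_trans[of _ 0])
    show "AE w in M. (\<Sum>k\<le>N (Suc n) w. real k * (real k - 1) * hypergeometric_mass (N (Suc n) w) (S n w) (H n w) k)
      = Z n w * (Z' n w * ((real (N (Suc n) w))\<^sup>2 - real (N (Suc n) w)))"
      using path_bounds
    proof eventually_elim
      case (elim w)
      have "(\<Sum>k\<le>N (Suc n) w. real k * (real k - 1) * hypergeometric_mass (N (Suc n) w) (S n w) (H n w) k)
        = real (N (Suc n) w) * (real (N (Suc n) w) - 1) * (real (H n w) / real (S n w)) * ((real (H n w) - 1) / (real (S n w) - 1))"
        using elim H_le_S[of n w] S_ge_2[of n w] by (intro hypergeometric_factorial_moment) auto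
      also have "\<dots> = real (N (Suc n) w) * (real (N (Suc n) w) - 1) * Z n w * Z' n w"
        by (simp only: urn_Z_def Z'_def)
      finally show ?case by (simp only: power2_eq_square algebra_simps mult_1 mult_1_right)
    qed
  qed
  from cond_mean_add[OF cond_mean_X this] show ?thesis
    by (simp add: \<xi>_def[abs_def] power2_eq_square algebra_simps)
qed

definition D :: "nat \<Rightarrow> 'a \<Rightarrow> real" where
  "D n w = (1 - Z n w) * (real (A (Suc n) w) * real (X (Suc n) w))
    - Z n w * (real (B (Suc n) w) * (real (N (Suc n) w) - real (X (Suc n) w)))"

text \<open>The number of balls added at draw n + 1. The subtraction is one of reals, so identities
  need X <= N only where the urn itself, with its truncated subtraction, is involved.\<close>

definition R :: "nat \<Rightarrow> 'a \<Rightarrow> real" where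
  "R n w = real (A (Suc n) w) * real (X (Suc n) w) + real (B (Suc n) w) * (real (N (Suc n) w) - real (X (Suc n) w))"

text \<open>Indices are shifted: \<open>EA n\<close> belongs to draw n + 1, the first one not known
  to \<open>F n\<close>.\<close>

definition EA where "EA n = (\<integral>w. real (A (Suc n) w) \<partial>M)"
definition EB where "EB n = (\<integral>w. real (B (Suc n) w) \<partial>M)"
definition EAA where "EAA n = (\<integral>w. (real (A (Suc n) w))\<^sup>2 \<partial>M)"
definition EBB where "EBB n = (\<integral>w. (real (B (Suc n) w))\<^sup>2 \<partial>M)"
definition EAB where "EAB n = (\<integral>w. real (A (Suc n) w) * real (B (Suc n) w) \<partial>M)"

lemma cond_mean_A_X: "cond_mean n (\<lambda>w. real (A (Suc n) w) * real (X (Suc n) w)) (\<lambda>w. EA n * (Z n w * \<nu> n w))"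
  unfolding EA_def by (rule cond_mean_additions[where f = "\<lambda>i j. real i" and q = "\<lambda>i j. real j", OF cond_mean_X])

lemma cond_mean_B_Y: "cond_mean n (\<lambda>w. real (B (Suc n) w) * (real (N (Suc n) w) - real (X (Suc n) w)))
  (\<lambda>w. EB n * ((1 - Z n w) * \<nu> n w))"
proof -
  have "cond_mean n (\<lambda>w. real (N (Suc n) w) - real (X (Suc n) w)) (\<lambda>w. (1 - Z n w) * \<nu> n w)"
    using cond_mean_diff[OF cond_mean_N cond_mean_X] by (simp add: left_diff_distrib)
  then show ?thesis unfolding EB_def
    by (rule cond_mean_additions[where f = "\<lambda>i j. real j" and q = "\<lambda>i j. real i - real j"])
qed

lemma cond_mean_R: "cond_mean n (R n) (\<lambda>w. EA n * (Z n w * \<nu> n w) + EB n * ((1 - Z n w) * \<nu> n w))"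
  unfolding R_def[abs_def] by (rule cond_mean_add[OF cond_mean_A_X cond_mean_B_Y])

lemma cond_mean_Z_mult: "cond_mean n Y y \<Longrightarrow> cond_mean n (\<lambda>w. Z n w * Y w) (\<lambda>w. Z n w * y w)"
  using Z_bounds by (intro cond_mean_mult[where b = 1] F_measurable_Z) (auto simp: abs_le_iff intro: order_trans[of _ 0])

lemma cond_mean_one_minus_Z_mult: "cond_mean n Y y \<Longrightarrow> cond_mean n (\<lambda>w. (1 - Z n w) * Y w) (\<lambda>w. (1 - Z n w) * y w)"
  using Z_bounds
  by (intro cond_mean_mult[where b = 1] borel_measurable_diff borel_measurable_const F_measurable_Z) (auto simp: abs_le_iff intro: order_trans[of _ 0])

text \<open>Each colour contributes Z (1 - Z) \<nu> times its mean addition, with opposite signs, so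
  the drift disappears when the means agree.\<close>

lemma cond_mean_D: "cond_mean n (D n) (\<lambda>w. (EA n - EB n) * (Z n w * (1 - Z n w) * \<nu> n w))"
  using cond_mean_diff[OF cond_mean_one_minus_Z_mult[OF cond_mean_A_X] cond_mean_Z_mult[OF cond_mean_B_Y]]
  by (simp add: D_def[abs_def] algebra_simps)

definition v :: "nat \<Rightarrow> 'a \<Rightarrow> real" where
  "v n w = (1 - Z n w)\<^sup>2 * EAA n * \<xi> n w + (Z n w)\<^sup>2 * EBB n * (\<theta> n w - 2 * (Z n w * \<theta> n w) + \<xi> n w)
    - 2 * Z n w * (1 - Z n w) * EAB n * (Z n w * \<theta> n w - \<xi> n w)"

lemma cond_mean_D_square: "cond_mean n (\<lambda>w. (D n w)\<^sup>2) (v n)"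
proof -
  have AA: "cond_mean n (\<lambda>w. (real (A (Suc n) w))\<^sup>2 * (real (X (Suc n) w))\<^sup>2) (\<lambda>w. EAA n * \<xi> n w)"
    unfolding EAA_def by (rule cond_mean_additions[where f = "\<lambda>i j. (real i)\<^sup>2" and q = "\<lambda>i j. (real j)\<^sup>2", OF cond_mean_X_square])
  have "cond_mean n (\<lambda>w. (real (N (Suc n) w) - real (X (Suc n) w))\<^sup>2) (\<lambda>w. \<theta> n w - 2 * (Z n w * \<theta> n w) + \<xi> n w)"
    using cond_mean_add[OF cond_mean_diff[OF cond_mean_N_square cond_mean_cmult[OF cond_mean_N_times_X, of n 2]] cond_mean_X_square]
    by (simp add: power2_eq_square algebra_simps)
  then have BB: "cond_mean n (\<lambda>w. (real (B (Suc n) w))\<^sup>2 * (real (N (Suc n) w) - real (X (Suc n) w))\<^sup>2)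
    (\<lambda>w. EBB n * (\<theta> n w - 2 * (Z n w * \<theta> n w) + \<xi> n w))"
    unfolding EBB_def by (rule cond_mean_additions[where f = "\<lambda>i j. (real j)\<^sup>2" and q = "\<lambda>i j. (real i - real j)\<^sup>2"])
  have "cond_mean n (\<lambda>w. real (X (Suc n) w) * (real (N (Suc n) w) - real (X (Suc n) w))) (\<lambda>w. Z n w * \<theta> n w - \<xi> n w)"
    using cond_mean_diff[OF cond_mean_N_times_X cond_mean_X_square] by (simp add: power2_eq_square algebra_simps)
  then have AB: "cond_mean n (\<lambda>w. real (A (Suc n) w) * real (B (Suc n) w) * (real (X (Suc n) w) * (real (N (Suc n) w) - real (X (Suc n) w))))
    (\<lambda>w. EAB n * (Z n w * \<theta> n w - \<xi> n w))"
    unfolding EAB_def by (rule cond_mean_additions[where f = "\<lambda>i j. real i * real j" and q = "\<lambda>i j. real j * (real i - real j)"])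
  \<comment> \<open>The products are nested so that each factor Z or 1 - Z, known at time n, is
    pulled out by one rule application.\<close>
  have sq: "(w * (x * y) - z * (x' * y'))\<^sup>2 = w * (w * (x\<^sup>2 * y\<^sup>2)) + z * (z * (x'\<^sup>2 * y'\<^sup>2)) - 2 * (w * (z * (x * x' * (y * y'))))"
    for w x y z x' y' :: real by (simp add: power2_eq_square algebra_simps)
  have v: "v n w = (1 - Z n w) * ((1 - Z n w) * (EAA n * \<xi> n w))
      + Z n w * (Z n w * (EBB n * (\<theta> n w - 2 * (Z n w * \<theta> n w) + \<xi> n w)))
      - 2 * ((1 - Z n w) * (Z n w * (EAB n * (Z n w * \<theta> n w - \<xi> n w))))" for w
    unfolding v_def power2_eq_square by (simp only: mult_ac)
  show ?thesis
    unfolding D_def[abs_def] sq v[abs_def]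
    by (intro cond_mean_add cond_mean_diff cond_mean_cmult cond_mean_one_minus_Z_mult cond_mean_Z_mult AA BB AB)
qed

end

section \<open>The balanced urn\<close>

locale balanced_urn = bounded_urn M a b N X A B C for M :: "'a measure" and a b N X A B C +
  fixes m qA qB qAB :: real and Ninf Qinf :: "'a \<Rightarrow> real"
  assumes balance: "EA n = EB n"
    and EA_lim: "EA \<longlonglongrightarrow> m" and m_pos: "0 < m"
    and Ninf_M [measurable]: "Ninf \<in> borel_measurable M" and Ninf_pos: "AE w in M. 0 < Ninf w"
    and Qinf_M [measurable]: "Qinf \<in> borel_measurable M" and Qinf_pos: "AE w in M. 0 < Qinf w"
    and \<nu>_lim: "AE w in M. (\<lambda>n. \<nu> n w) \<longlonglongrightarrow> Ninf w"
    and \<theta>_lim: "AE w in M. (\<lambda>n. \<theta> n w) \<longlonglongrightarrow> Qinf w"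
    and EAA_lim: "EAA \<longlonglongrightarrow> qA" and qA_pos: "0 < qA"
    and EBB_lim: "EBB \<longlonglongrightarrow> qB" and qB_pos: "0 < qB"
    and EAB_lim: "EAB \<longlonglongrightarrow> qAB" and qAB_pos: "0 < qAB"
begin

text \<open>At most C balls are sampled and each brings at most C new ones.\<close>

definition \<kappa> :: real where "\<kappa> = (real C)\<^sup>2"

definition d :: "nat \<Rightarrow> 'a \<Rightarrow> real" where "d n w = 1 / real (S n w) * D n w"

text \<open>One predicate for the almost sure bounds lets the estimates be proved path by path,
  outside a single null set.\<close>

definition path :: "'a \<Rightarrow> bool" where
  "path w \<longleftrightarrow> (\<forall>n. 1 \<le> N (Suc n) w \<and> X (Suc n) w \<le> N (Suc n) w \<and>
    1 \<le> A (Suc n) w \<and> 1 \<le> B (Suc n) w \<and> A (Suc n) w \<le> C \<and> B (Suc n) w \<le> C \<and> N (Suc n) w \<le> C)"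

lemma AE_path: "AE w in M. path w"
  using path_bounds by eventually_elim (simp add: path_def)

lemma \<kappa>_nonneg: "0 \<le> \<kappa>" by (simp add: \<kappa>_def)

lemma path_R:
  assumes "path w"
  shows "real (S (Suc n) w) = real (S n w) + R n w" "1 \<le> R n w" "R n w \<le> \<kappa>" "\<bar>D n w\<bar> \<le> R n w"
    "real (K (Suc n) w) = real (K n w) + real (B (Suc n) w) * (real (N (Suc n) w) - real (X (Suc n) w))"
    "0 \<le> real (B (Suc n) w) * (real (N (Suc n) w) - real (X (Suc n) w))"
proof -
  let ?a = "real (A (Suc n) w)" and ?b = "real (B (Suc n) w)" and ?x = "real (X (Suc n) w)"
    and ?y = "real (N (Suc n) w) - real (X (Suc n) w)"
  have p: "1 \<le> N (Suc n) w" "X (Suc n) w \<le> N (Suc n) w" "1 \<le> A (Suc n) w" "1 \<le> B (Suc n) w"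
    "A (Suc n) w \<le> C" "B (Suc n) w \<le> C" "N (Suc n) w \<le> C"
    using assms by (auto simp: path_def)
  then have y: "real (N (Suc n) w - X (Suc n) w) = ?y" "0 \<le> ?y" by auto
  show K: "real (K (Suc n) w) = real (K n w) + ?b * ?y" by (simp add: urn_steps y(1))
  show "real (S (Suc n) w) = real (S n w) + R n w"
    using K by (simp add: urn_S_def urn_steps R_def)
  have ax: "?x \<le> ?a * ?x" "?a * ?x \<le> real C * ?x" using p by (auto intro!: mult_right_mono simp: mult_le_cancel_right1)
  have "1 * ?y \<le> ?b * ?y" using p y by (intro mult_right_mono) auto
  moreover have "?b * ?y \<le> real C * ?y" using p y by (intro mult_right_mono) auto
  ultimately have bY: "?y \<le> ?b * ?y" "?b * ?y \<le> real C * ?y" by auto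
  show bY0: "0 \<le> ?b * ?y" using y by simp
  have R: "R n w = ?a * ?x + ?b * ?y" by (simp add: R_def)
  have "1 \<le> ?x + ?y" using p by simp
  with ax(1) bY(1) show "1 \<le> R n w" unfolding R by linarith
  have "R n w \<le> real C * ?x + real C * ?y" unfolding R using ax(2) bY(2) by linarith
  also have "\<dots> = real C * real (N (Suc n) w)" by (simp add: algebra_simps)
  also have "\<dots> \<le> real C * real C" using p by (intro mult_left_mono) auto
  finally show "R n w \<le> \<kappa>" by (simp add: \<kappa>_def power2_eq_square)
  have "0 \<le> (1 - Z n w) * (?a * ?x)" "(1 - Z n w) * (?a * ?x) \<le> ?a * ?x"
    using Z_bounds[of n w] by (auto intro!: mult_nonneg_nonneg mult_left_le_one_le)
  moreover have "0 \<le> Z n w * (?b * ?y)" "Z n w * (?b * ?y) \<le> ?b * ?y"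
    using Z_bounds[of n w] bY0 by (auto intro!: mult_nonneg_nonneg mult_left_le_one_le)
  ultimately show "\<bar>D n w\<bar> \<le> R n w" unfolding D_def R by linarith
qed

lemma path_D: "path w \<Longrightarrow> \<bar>D n w\<bar> \<le> \<kappa>"
  using path_R(3,4)[of w n] by linarith

text \<open>The urn starts with at least two balls, and each draw samples at least one ball, which
  brings at least one new one. This linear growth is the source of all bounds of order 1/n.\<close>

lemma path_S: "path w \<Longrightarrow> real n + 2 \<le> real (S n w)"
proof (induction n)
  case 0
  show ?case using S_ge_2[of 0 w] by simp
next
  case (Suc n)
  with path_R(1,2)[of w n] show ?case by simp
qed

lemma path_d: "path w \<Longrightarrow> \<bar>d n w\<bar> \<le> \<kappa> / real (Suc n)"
  unfolding d_def using path_S[of w n] path_D[of w n] by (auto simp: abs_mult intro!: frac_le)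

text \<open>Exactly, Z_{n+1} - Z_n = D_n / S_{n+1}. Replacing S_{n+1} by S_n, which is known at time
  n, keeps the increment centered and costs D_n R_n / (S_n S_{n+1}).\<close>

lemma Z_increment:
  assumes "path w"
  shows "\<bar>Z (Suc n) w - Z n w - d n w\<bar> \<le> \<kappa>\<^sup>2 * (1 / (real (n + 1) * real (n + 2)))"
proof -
  let ?s = "real (S n w)" and ?s' = "real (S (Suc n) w)"
  have s: "real n + 1 \<le> ?s" "real n + 2 \<le> ?s'" "0 < ?s" "0 < ?s'"
    using path_S[OF assms, of n] path_S[OF assms, of "Suc n"] by auto
  have s': "?s' = ?s + R n w" by (rule path_R(1)[OF assms])
  have h: "real (H (Suc n) w) = Z n w * ?s + real (A (Suc n) w) * real (X (Suc n) w)"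
    using s(3) by (simp add: urn_steps urn_Z_def)
  have "Z (Suc n) w * ?s' = Z n w * ?s + real (A (Suc n) w) * real (X (Suc n) w)"
    using s(4) h by (simp add: urn_Z_def)
  also have "\<dots> = Z n w * ?s' + D n w"
    unfolding s' D_def R_def by (simp add: algebra_simps)
  finally have "Z (Suc n) w - Z n w = D n w / ?s'" using s(4) by (simp add: field_simps)
  moreover have "D n w / ?s' - D n w / ?s = - (D n w * R n w) / (?s * ?s')"
    using s(3,4) unfolding s' by (simp add: field_simps)
  ultimately have "\<bar>Z (Suc n) w - Z n w - d n w\<bar> = \<bar>D n w\<bar> * \<bar>R n w\<bar> / (?s * ?s')"
    using s by (simp add: d_def abs_mult)
  also have "\<dots> \<le> (\<kappa> * \<kappa>) / (real (n + 1) * real (n + 2))"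
    using path_D[OF assms] path_R(2,3)[OF assms, of n] s by (intro frac_le mult_mono) auto
  finally show ?thesis by (simp add: power2_eq_square)
qed

lemma Z_remainder:
  assumes "path w" "n \<le> k"
  shows "\<bar>Z k w - Z n w - (\<Sum>j=n..<k. d j w)\<bar> \<le> \<kappa>\<^sup>2 / real (n + 1)"
proof -
  have "Z k w - Z n w = (\<Sum>j=n..<k. Z (Suc j) w - Z j w)"
    using sum_Suc_diff'[OF assms(2), of "\<lambda>j. Z j w"] by simp
  then have "\<bar>Z k w - Z n w - (\<Sum>j=n..<k. d j w)\<bar> = \<bar>\<Sum>j=n..<k. Z (Suc j) w - Z j w - d j w\<bar>"
    by (simp add: sum_subtractf)
  also have "\<dots> \<le> (\<Sum>j=n..<k. \<kappa>\<^sup>2 * (1 / (real (j + 1) * real (j + 2))))"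
    by (rule order_trans[OF sum_abs sum_mono]) (rule Z_increment[OF assms(1)])
  also have "\<dots> = \<kappa>\<^sup>2 * (1 / real (n + 1) - 1 / real (k + 1))"
    by (simp only: sum_distrib_left[symmetric] sum_inverse_consecutive[OF assms(2)])
  also have "\<dots> \<le> \<kappa>\<^sup>2 * (1 / real (n + 1))" by (intro mult_left_mono) auto
  finally show ?thesis by simp
qed

lemma F_measurable_variables_real:
  "(\<lambda>w. real (N (Suc n) w)) \<in> borel_measurable (F (Suc n))" "(\<lambda>w. real (X (Suc n) w)) \<in> borel_measurable (F (Suc n))"
  "(\<lambda>w. real (A (Suc n) w)) \<in> borel_measurable (F (Suc n))" "(\<lambda>w. real (B (Suc n) w)) \<in> borel_measurable (F (Suc n))"
  by (rule measurable_compose[OF F_measurable_variables(1)] measurable_compose[OF F_measurable_variables(2)]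
      measurable_compose[OF F_measurable_variables(3)] measurable_compose[OF F_measurable_variables(4)], simp)+

lemma F_measurable_D: "D n \<in> borel_measurable (F (Suc n))" and F_measurable_R: "R n \<in> borel_measurable (F (Suc n))"
proof -
  note F_measurable_variables_real[of n, measurable]
  have [measurable]: "Z n \<in> borel_measurable (F (Suc n))" by (rule F_measurable_mono[OF F_measurable_Z]) simp
  show "D n \<in> borel_measurable (F (Suc n))" unfolding D_def[abs_def] by measurable
  show "R n \<in> borel_measurable (F (Suc n))" unfolding R_def[abs_def] by measurable
qed

lemma F_measurable_inverse_S: "(\<lambda>w. 1 / real (S n w)) \<in> borel_measurable (F n)"
proof -
  note F_measurable_urn[of n, measurable]
  show ?thesis by measurable
qed

sublocale increments: bounded_increments M F d "\<lambda>n. \<kappa> / real (Suc n)"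
proof
  fix n
  have "(\<lambda>w. 1 / real (S n w)) \<in> borel_measurable (F (Suc n))"
    by (rule F_measurable_mono[OF F_measurable_inverse_S]) simp
  then show "d n \<in> borel_measurable (F (Suc n))"
    unfolding d_def[abs_def] using F_measurable_D by (rule borel_measurable_times)
  show "AE w in M. \<bar>d n w\<bar> \<le> \<kappa> / real (Suc n)" using AE_path by eventually_elim (rule path_d)
  have "cond_mean n (d n) (\<lambda>w. 1 / real (S n w) * ((EA n - EB n) * (Z n w * (1 - Z n w) * \<nu> n w)))"
    unfolding d_def[abs_def]
  proof (rule cond_mean_mult[where b = 1, OF F_measurable_inverse_S _ cond_mean_D])
    have "\<bar>1 / real (S n w)\<bar> \<le> 1" for w using S_ge_2[of n w] by simp
    then show "AE w in M. \<bar>1 / real (S n w)\<bar> \<le> 1" by simp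
  qed
  then show "AE w in M. real_cond_exp M (F n) (d n) w = 0" by (simp add: cond_mean_def balance)
qed

text \<open>The series of the \<open>d j\<close> converges, and \<open>Z_remainder\<close> makes the
  difference between Z_n and its partial sums a Cauchy sequence.\<close>

lemma Z_convergent: "AE w in M. convergent (\<lambda>n. Z n w)"
  using centered_series_converges[OF increments.bounded_increments_axioms] AE_path
proof eventually_elim
  case (elim w)
  let ?r = "\<lambda>n. Z n w - (\<Sum>j<n. d j w)"
  have "Cauchy ?r"
  proof (rule CauchyI')
    fix e :: real assume "0 < e"
    obtain n0 where n0: "\<kappa>\<^sup>2 / e < real n0" using reals_Archimedean2 by blast
    have "dist (?r n) (?r k) < e" if "n0 \<le> n" "n < k" for n k
    proof -
      have "(\<Sum>j<k. d j w) = (\<Sum>j<n. d j w) + (\<Sum>j=n..<k. d j w)"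
        unfolding lessThan_atLeast0 using that by (simp add: sum.atLeastLessThan_concat)
      then have "dist (?r n) (?r k) = \<bar>Z k w - Z n w - (\<Sum>j=n..<k. d j w)\<bar>"
        by (simp add: dist_real_def abs_minus_commute algebra_simps)
      also have "\<dots> \<le> \<kappa>\<^sup>2 / real (n + 1)" using that elim by (intro Z_remainder) auto
      also have "\<dots> < e"
      proof -
        have "\<kappa>\<^sup>2 < real n0 * e" using n0 \<open>0 < e\<close> by (simp add: pos_divide_less_eq)
        also have "\<dots> \<le> real (n + 1) * e" using that \<open>0 < e\<close> by (intro mult_right_mono) auto
        finally show ?thesis by (simp add: pos_divide_less_eq mult.commute)
      qed
      finally show ?thesis .
    qed
    then show "\<exists>n0. \<forall>n\<ge>n0. \<forall>k>n. dist (?r n) (?r k) < e" by blast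
  qed
  then have "convergent ?r" by (simp add: Cauchy_convergent_iff)
  from convergent_add[OF this elim(1)] show ?case by simp
qed

lemma Z_limit_exists: "\<exists>Zinf \<in> borel_measurable M. AE w in M. (\<lambda>n. Z n w) \<longlonglongrightarrow> Zinf w"
proof (intro bexI)
  show "AE w in M. (\<lambda>n. Z n w) \<longlonglongrightarrow> lim (\<lambda>n. Z n w)"
    using Z_convergent by eventually_elim (simp add: convergent_LIMSEQ_iff)
  show "(\<lambda>w. lim (\<lambda>n. Z n w)) \<in> borel_measurable M" by (rule borel_measurable_lim_metric) measurable
qed

lemma averages_of_cond_mean:
  assumes "\<And>n. Y n \<in> borel_measurable (F (Suc n))" "\<And>n w. path w \<Longrightarrow> \<bar>Y n w\<bar> \<le> c"
    and "\<And>n. cond_mean n (Y n) (y n)" and lim: "AE w in M. (\<lambda>n. y n w) \<longlonglongrightarrow> l w"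
  shows "AE w in M. (\<lambda>n. (\<Sum>j<n. Y j w) / real n) \<longlonglongrightarrow> l w"
proof (rule strong_law_of_large_numbers)
  have "AE w in M. \<forall>n. real_cond_exp M (F n) (Y n) w = y n w"
    unfolding AE_all_countable using assms(3) by (simp add: cond_mean_def)
  with lim show "AE w in M. (\<lambda>n. real_cond_exp M (F n) (Y n) w) \<longlonglongrightarrow> l w" by eventually_elim simp
  show "AE w in M. \<bar>Y n w\<bar> \<le> c" for n using AE_path by eventually_elim (rule assms(2))
qed (rule assms(1))

lemma empirical_mean_eq: "empirical_mean Y n w = (\<Sum>j<n. Y (Suc j) w) / real n"
  unfolding empirical_mean_def by (simp add: sum.atLeast1_atMost_eq)

lemma empirical_mean_additions:
  fixes f :: "nat \<Rightarrow> nat \<Rightarrow> real"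
  assumes lim: "(\<lambda>n. \<integral>w. f (A (Suc n) w) (B (Suc n) w) \<partial>M) \<longlonglongrightarrow> l"
  shows "AE w in M. (\<lambda>n. empirical_mean (\<lambda>j w. f (A j w) (B j w)) n w) \<longlonglongrightarrow> l"
  unfolding empirical_mean_eq
proof (rule averages_of_cond_mean)
  show "(\<lambda>w. f (A (Suc n) w) (B (Suc n) w)) \<in> borel_measurable (F (Suc n))" for n
    by (intro borel_measurable_fun2 F_measurable_variables)
  show "\<bar>f (A (Suc n) w) (B (Suc n) w)\<bar> \<le> (\<Sum>i\<le>C. \<Sum>j\<le>C. \<bar>f i j\<bar>)" if "path w" for n w
    using that by (intro abs_le_sum_of_values) (auto simp: path_def)
  show "cond_mean n (\<lambda>w. f (A (Suc n) w) (B (Suc n) w)) (\<lambda>w. \<integral>w. f (A (Suc n) w) (B (Suc n) w) \<partial>M)" for n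
  proof -
    \<comment> \<open>With the constant function for the draw, independence turns the conditional
      mean of the additions into their expectation.\<close>
    have "cond_mean n (\<lambda>w. 1) (\<lambda>w. 1)" by (simp add: cond_mean_def)
    from cond_mean_additions[where q = "\<lambda>i j. 1" and f = f, OF this] show ?thesis by simp
  qed
  show "AE w in M. (\<lambda>n. \<integral>w. f (A (Suc n) w) (B (Suc n) w) \<partial>M) \<longlonglongrightarrow> l" using lim by simp
qed

lemma empirical_mean_N: "AE w in M. (\<lambda>n. empirical_mean (\<lambda>j w. real (N j w)) n w) \<longlonglongrightarrow> Ninf w"
  unfolding empirical_mean_eq
  by (rule averages_of_cond_mean[where c = C, OF F_measurable_variables_real(1) _ cond_mean_N \<nu>_lim]) (auto simp: path_def)

lemma empirical_mean_N_square: "AE w in M. (\<lambda>n. empirical_mean (\<lambda>j w. (real (N j w))\<^sup>2) n w) \<longlonglongrightarrow> Qinf w"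
  unfolding empirical_mean_eq
  by (rule averages_of_cond_mean[where c = "(real C)\<^sup>2", OF borel_measurable_power[OF F_measurable_variables_real(1)] _ cond_mean_N_square \<theta>_lim])
     (auto simp: path_def)

text \<open>With equal means the conditional expectation of the number of added balls is
  \<open>EA n * \<nu> n w\<close>, whatever the proportion Z_n; the law of large numbers does the
  rest.\<close>

lemma S_over_n: "AE w in M. (\<lambda>n. real (S n w) / real n) \<longlonglongrightarrow> m * Ninf w"
proof -
  have "AE w in M. (\<lambda>n. (\<Sum>j<n. R j w) / real n) \<longlonglongrightarrow> m * Ninf w"
  proof (rule averages_of_cond_mean[OF F_measurable_R _ cond_mean_R])
    show "\<bar>R n w\<bar> \<le> \<kappa>" if "path w" for n w using path_R(2,3)[OF that, of n] by simp
    have eq: "EA n * (Z n w * \<nu> n w) + EB n * ((1 - Z n w) * \<nu> n w) = EA n * \<nu> n w" for n w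
      by (simp add: balance[symmetric] algebra_simps)
    show "AE w in M. (\<lambda>n. EA n * (Z n w * \<nu> n w) + EB n * ((1 - Z n w) * \<nu> n w)) \<longlonglongrightarrow> m * Ninf w"
      unfolding eq using \<nu>_lim by eventually_elim (intro tendsto_mult EA_lim)
  qed
  then show ?thesis using AE_path
  proof eventually_elim
    case (elim w)
    have "real (S n w) = real (a + b) + (\<Sum>j<n. R j w)" for n
      by (induction n) (auto simp: path_R(1)[OF elim(2)] urn_steps)
    moreover have "(\<lambda>n. real (a + b) / real n + (\<Sum>j<n. R j w) / real n) \<longlonglongrightarrow> 0 + m * Ninf w"
      by (intro tendsto_add lim_const_over_n elim(1))
    ultimately show ?case by (simp add: add_divide_distrib)
  qed
qed

lemma cond_mean_S_growth:
  "cond_mean n (\<lambda>w. (real (S (Suc n) w) - real (S n w)) / real (S n w)) (\<lambda>w. EA n * \<nu> n w / real (S n w))"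
proof (rule cond_mean_cong[OF cond_mean_mult[where b = 1, OF F_measurable_inverse_S _ cond_mean_R]])
  have "\<bar>1 / real (S n w)\<bar> \<le> 1" for w using S_ge_2[of n w] by simp
  then show "AE w in M. \<bar>1 / real (S n w)\<bar> \<le> 1" by simp
  show "AE w in M. 1 / real (S n w) * R n w = (real (S (Suc n) w) - real (S n w)) / real (S n w)"
    using AE_path by eventually_elim (simp add: path_R(1))
qed (simp_all add: balance[symmetric] algebra_simps)

section \<open>The limit theorem for an arbitrary version of the limit proportion\<close>

context
  fixes Zinf :: "'a \<Rightarrow> real"
  assumes Zinf_M [measurable]: "Zinf \<in> borel_measurable M"
    and Z_lim: "AE w in M. (\<lambda>n. Z n w) \<longlonglongrightarrow> Zinf w"
begin

text \<open>H and S have the same expected relative growth: the conditional mean of A X is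
  \<open>EA n * (Z n w * \<nu> n w)\<close>, division by H_n turns Z_n into 1/S_n, and the mean
  growth of S_n divided by S_n is the same expression.\<close>

lemma Zinf_pos: "AE w in M. 0 < Zinf w"
proof (rule positive_limit_of_proportion)
  show "AE w in M. \<forall>n. 1 \<le> real (H n w) \<and> real (H n w) \<le> real (S n w) \<and>
      real (H n w) \<le> real (H (Suc n) w) \<and> real (H (Suc n) w) \<le> real (H n w) + \<kappa> \<and>
      real (S n w) \<le> real (S (Suc n) w) \<and> real (S (Suc n) w) \<le> real (S n w) + \<kappa>"
    using AE_path
  proof eventually_elim
    case (elim w)
    show ?case
    proof
      fix n
      have "real (A (Suc n) w) * real (X (Suc n) w) \<le> R n w" using path_R(6)[OF elim, of n] by (simp add: R_def)
      with path_R(1-3)[OF elim, of n] H_ge_1[of n w] H_le_S[of n w]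
      show "1 \<le> real (H n w) \<and> real (H n w) \<le> real (S n w) \<and>
        real (H n w) \<le> real (H (Suc n) w) \<and> real (H (Suc n) w) \<le> real (H n w) + \<kappa> \<and>
        real (S n w) \<le> real (S (Suc n) w) \<and> real (S (Suc n) w) \<le> real (S n w) + \<kappa>"
        by (simp add: urn_steps)
    qed
  qed
  show "(\<integral>w. (real (H (Suc n) w) - real (H n w)) / real (H n w) \<partial>M)
    = (\<integral>w. (real (S (Suc n) w) - real (S n w)) / real (S n w) \<partial>M)" for n
  proof (rule integral_eq_if_cond_mean_eq)
    note F_measurable_urn[of n, measurable]
    show "cond_mean n (\<lambda>w. (real (H (Suc n) w) - real (H n w)) / real (H n w)) (\<lambda>w. EA n * \<nu> n w / real (S n w))"
    proof (rule cond_mean_cong[OF cond_mean_mult[where b = 1, OF _ _ cond_mean_A_X]])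
      show "(\<lambda>w. 1 / real (H n w)) \<in> borel_measurable (F n)" by measurable
      have "\<bar>1 / real (H n w)\<bar> \<le> 1" for w using H_ge_1[of n w] by simp
      then show "AE w in M. \<bar>1 / real (H n w)\<bar> \<le> 1" by simp
      have "1 / real (H n w) * (EA n * (Z n w * \<nu> n w)) = EA n * \<nu> n w / real (S n w)" for w
        using H_ge_1[of n w] by (simp add: urn_Z_def)
      then show "AE w in M. 1 / real (H n w) * (EA n * (Z n w * \<nu> n w)) = EA n * \<nu> n w / real (S n w)" by simp
    qed (simp_all add: urn_steps)
    show "cond_mean n (\<lambda>w. (real (S (Suc n) w) - real (S n w)) / real (S n w)) (\<lambda>w. EA n * \<nu> n w / real (S n w))"
      by (rule cond_mean_S_growth)
  qed
  show "AE w in M. (\<lambda>n. real (H n w) / real (S n w)) \<longlonglongrightarrow> Zinf w"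
    using Z_lim by (simp add: urn_Z_def)
qed (simp_all add: urn_steps)

text \<open>The same argument for colour B, with 1 - Z_n = K_n / S_n. \<open>K n\<close> is written
  as S_n - H_n because the measurability of these two is available.\<close>

lemma Zinf_less_1: "AE w in M. Zinf w < 1"
proof -
  have S_eq: "real (S n w) = real (H n w) + real (K n w)" for n w by (simp add: urn_S_def)
  have K_eq: "real (K n w) = real (S n w) - real (H n w)" for n w by (simp add: urn_S_def)
  have [measurable]: "(\<lambda>w. real (K n w)) \<in> borel_measurable M" for n
  proof -
    have "(\<lambda>w. real (S n w) - real (H n w)) \<in> borel_measurable M" by measurable
    then show ?thesis by (simp add: S_eq)
  qed
  have "AE w in M. 0 < 1 - Zinf w"
  proof (rule positive_limit_of_proportion)
    show "AE w in M. \<forall>n. 1 \<le> real (K n w) \<and> real (K n w) \<le> real (S n w) \<and>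
        real (K n w) \<le> real (K (Suc n) w) \<and> real (K (Suc n) w) \<le> real (K n w) + \<kappa> \<and>
        real (S n w) \<le> real (S (Suc n) w) \<and> real (S (Suc n) w) \<le> real (S n w) + \<kappa>"
      using AE_path
    proof eventually_elim
      case (elim w)
      show ?case
      proof
        fix n
        have "real (B (Suc n) w) * (real (N (Suc n) w) - real (X (Suc n) w)) \<le> R n w" by (simp add: R_def)
        with path_R(1-3)[OF elim, of n] path_R(5,6)[OF elim, of n] K_ge_1[of n w] S_eq[of n w]
        show "1 \<le> real (K n w) \<and> real (K n w) \<le> real (S n w) \<and>
          real (K n w) \<le> real (K (Suc n) w) \<and> real (K (Suc n) w) \<le> real (K n w) + \<kappa> \<and>
          real (S n w) \<le> real (S (Suc n) w) \<and> real (S (Suc n) w) \<le> real (S n w) + \<kappa>"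
          by auto
      qed
    qed
    show "(\<integral>w. (real (K (Suc n) w) - real (K n w)) / real (K n w) \<partial>M)
      = (\<integral>w. (real (S (Suc n) w) - real (S n w)) / real (S n w) \<partial>M)" for n
    proof (rule integral_eq_if_cond_mean_eq)
      note F_measurable_urn[of n, measurable]
      have KF: "(\<lambda>w. 1 / (real (S n w) - real (H n w))) \<in> borel_measurable (F n)" by measurable
      have K1: "1 \<le> real (K n w)" for w using K_ge_1[of n w] by simp
      show "cond_mean n (\<lambda>w. (real (K (Suc n) w) - real (K n w)) / real (K n w)) (\<lambda>w. EA n * \<nu> n w / real (S n w))"
      proof (rule cond_mean_cong[OF cond_mean_mult[where b = 1, OF KF _ cond_mean_B_Y]])
        have "\<bar>1 / (real (S n w) - real (H n w))\<bar> \<le> 1" for w using K1[of w] by (simp add: S_eq)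
        then show "AE w in M. \<bar>1 / (real (S n w) - real (H n w))\<bar> \<le> 1" by simp
        show "AE w in M. 1 / (real (S n w) - real (H n w)) * (real (B (Suc n) w) * (real (N (Suc n) w) - real (X (Suc n) w)))
          = (real (K (Suc n) w) - real (K n w)) / real (K n w)"
          using AE_path by eventually_elim (simp add: path_R(5) S_eq)
        have "1 / (real (S n w) - real (H n w)) * (EB n * ((1 - Z n w) * \<nu> n w)) = EA n * \<nu> n w / real (S n w)" for w
        proof -
          have "1 - Z n w = real (K n w) / real (S n w)"
            using S_ge_2[of n w] K_eq[of n w] by (simp add: urn_Z_def diff_divide_distrib)
          then show ?thesis using K1[of w] by (simp add: S_eq balance)
        qed
        then show "AE w in M. 1 / (real (S n w) - real (H n w)) * (EB n * ((1 - Z n w) * \<nu> n w)) = EA n * \<nu> n w / real (S n w)"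
          by simp
      qed measurable
      show "cond_mean n (\<lambda>w. (real (S (Suc n) w) - real (S n w)) / real (S n w)) (\<lambda>w. EA n * \<nu> n w / real (S n w))"
        by (rule cond_mean_S_growth)
    qed
    show "AE w in M. (\<lambda>n. real (K n w) / real (S n w)) \<longlonglongrightarrow> 1 - Zinf w"
      using Z_lim
    proof eventually_elim
      case (elim w)
      have "real (K n w) / real (S n w) = 1 - Z n w" for n
        using S_ge_2[of n w] K_eq[of n w] by (simp add: urn_Z_def diff_divide_distrib)
      with tendsto_diff[OF tendsto_const[of 1] elim] show ?case by simp
    qed
  qed (simp_all add: urn_steps)
  then show ?thesis by eventually_elim simp
qed

text \<open>The bracket of the estimator at its limit. Times Z (1 - Z) it is also the limit of the
  conditional second moments of D_n, by \<open>v_tendsto\<close>; the denominator of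
  \<open>Vinf\<close> comes from S_n / n.\<close>

definition \<beta> :: "'a \<Rightarrow> real" where
  "\<beta> w = (1 - Zinf w) * qA * ((1 - Zinf w) * Ninf w + Zinf w * Qinf w)
    + Zinf w * qB * (Zinf w * Ninf w + (1 - Zinf w) * Qinf w)
    - 2 * Zinf w * (1 - Zinf w) * qAB * (Qinf w - Ninf w)"

definition Vinf :: "'a \<Rightarrow> real" where
  "Vinf w = Zinf w * (1 - Zinf w) * (\<beta> w / (m * Ninf w)\<^sup>2)"

lemma Vinf_M [measurable]: "Vinf \<in> borel_measurable M"
  unfolding Vinf_def[abs_def] \<beta>_def by measurable

text \<open>The limit of the expectations of (A - B)^2. It compensates the cross term of
  \<open>\<beta>\<close>, which is negative when Q exceeds N.\<close>

lemma qAB_le: "0 \<le> qA + qB - 2 * qAB"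
proof (rule LIMSEQ_le_const)
  show "(\<lambda>n. EAA n + EBB n - 2 * EAB n) \<longlonglongrightarrow> qA + qB - 2 * qAB"
    by (intro tendsto_intros EAA_lim EBB_lim EAB_lim)
  have "0 \<le> EAA n + EBB n - 2 * EAB n" for n
  proof -
    have i: "integrable M (\<lambda>w. (real (A (Suc n) w))\<^sup>2)" "integrable M (\<lambda>w. (real (B (Suc n) w))\<^sup>2)"
      "integrable M (\<lambda>w. real (A (Suc n) w) * real (B (Suc n) w))"
      using integrable_A_B[of "\<lambda>i j. (real i)\<^sup>2" n] integrable_A_B[of "\<lambda>i j. (real j)\<^sup>2" n]
        integrable_A_B[of "\<lambda>i j. real i * real j" n] by simp_all
    have "0 \<le> (\<integral>w. (real (A (Suc n) w) - real (B (Suc n) w))\<^sup>2 \<partial>M)" by simp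
    also have "\<dots> = (\<integral>w. (real (A (Suc n) w))\<^sup>2 + (real (B (Suc n) w))\<^sup>2 - 2 * (real (A (Suc n) w) * real (B (Suc n) w)) \<partial>M)"
      by (simp add: power2_diff mult.assoc)
    also have "\<dots> = EAA n + EBB n - 2 * EAB n" using i by (simp add: EAA_def EBB_def EAB_def)
    finally show ?thesis .
  qed
  then show "\<exists>k. \<forall>n\<ge>k. 0 \<le> EAA n + EBB n - 2 * EAB n" by blast
qed

text \<open>Regrouped by N and Q, the coefficient of N in \<open>\<beta>\<close> is strictly
  positive and that of Q is nonnegative by \<open>qAB_le\<close>.\<close>

lemma Vinf_pos: "AE w in M. 0 < Vinf w"
  using Zinf_pos Zinf_less_1 Ninf_pos Qinf_pos
proof eventually_elim
  case (elim w)
  let ?z = "Zinf w"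
  have "\<beta> w = Ninf w * ((1 - ?z)\<^sup>2 * qA + ?z\<^sup>2 * qB + 2 * (?z * (1 - ?z) * qAB))
    + ?z * (1 - ?z) * Qinf w * (qA + qB - 2 * qAB)"
    by (simp add: \<beta>_def power2_eq_square algebra_simps)
  also have "\<dots> > 0"
    using elim qA_pos qB_pos qAB_pos qAB_le
    by (intro add_pos_nonneg mult_pos_pos mult_nonneg_nonneg) (auto intro!: add_pos_pos mult_pos_pos)
  finally show ?case using elim m_pos by (simp add: Vinf_def)
qed

lemma V_tendsto: "AE w in M. (\<lambda>n. urn_V a b N X A B n w) \<longlonglongrightarrow> Vinf w"
  using empirical_mean_additions[of "\<lambda>i j. real i", OF EA_lim[unfolded EA_def]]
    empirical_mean_additions[of "\<lambda>i j. (real i)\<^sup>2", OF EAA_lim[unfolded EAA_def]]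
    empirical_mean_additions[of "\<lambda>i j. (real j)\<^sup>2", OF EBB_lim[unfolded EBB_def]]
    empirical_mean_additions[of "\<lambda>i j. real i * real j", OF EAB_lim[unfolded EAB_def]]
    empirical_mean_N empirical_mean_N_square Z_lim Ninf_pos
proof eventually_elim
  case (elim w)
  have "(m * Ninf w)\<^sup>2 \<noteq> 0" using elim(8) m_pos by simp
  then show ?case
    unfolding urn_V_def Let_def Vinf_def \<beta>_def by (intro tendsto_intros elim(1-7))
qed

text \<open>Z_n - Z'_n = (S_n - H_n) / (S_n (S_n - 1)) is at most 1/(n+1) by the growth of S_n, so
  the removed ball has no influence on the limit variance.\<close>

lemma Z'_tendsto: "AE w in M. (\<lambda>n. Z' n w) \<longlonglongrightarrow> Zinf w"
  using Z_lim AE_path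
proof eventually_elim
  case (elim w)
  have "(\<lambda>n. Z n w - Z' n w) \<longlonglongrightarrow> 0"
  proof (rule tendsto_sandwich[OF _ _ tendsto_const LIMSEQ_inverse_real_of_nat])
    have b: "0 \<le> Z n w - Z' n w \<and> Z n w - Z' n w \<le> inverse (real (Suc n))" for n
    proof -
      have s: "real n + 2 \<le> real (S n w)" by (rule path_S[OF elim(2)])
      have h: "real (H n w) \<le> real (S n w)" using H_le_S[of n w] by simp
      have "Z n w - Z' n w = (real (S n w) - real (H n w)) / (real (S n w) * (real (S n w) - 1))"
        using s by (simp add: urn_Z_def Z'_def field_simps)
      moreover have "(real (S n w) - real (H n w)) / (real (S n w) * (real (S n w) - 1))
        \<le> real (S n w) / (real (S n w) * real (Suc n))"
        using s h by (intro frac_le mult_left_mono) auto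
      moreover have "0 \<le> (real (S n w) - real (H n w)) / (real (S n w) * (real (S n w) - 1))"
        using s h by (intro divide_nonneg_nonneg mult_nonneg_nonneg) auto
      moreover have "real (S n w) / (real (S n w) * real (Suc n)) = inverse (real (Suc n))"
        using s by (simp add: divide_simps)
      ultimately show ?thesis by simp
    qed
    show "\<forall>\<^sub>F n in sequentially. 0 \<le> Z n w - Z' n w" "\<forall>\<^sub>F n in sequentially. Z n w - Z' n w \<le> inverse (real (Suc n))"
      using b by auto
  qed
  from tendsto_diff[OF elim(1) this] show ?case by simp
qed

lemma v_tendsto: "AE w in M. (\<lambda>n. v n w) \<longlonglongrightarrow> Zinf w * (1 - Zinf w) * \<beta> w"
  using Z_lim Z'_tendsto \<nu>_lim \<theta>_lim
proof eventually_elim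
  case (elim w)
  let ?z = "Zinf w"
  define x where "x = ?z * Ninf w + ?z * ?z * (Qinf w - Ninf w)"
  have \<xi>: "(\<lambda>n. \<xi> n w) \<longlonglongrightarrow> x" unfolding \<xi>_def x_def by (intro tendsto_intros elim)
  have "(\<lambda>n. v n w) \<longlonglongrightarrow> (1 - ?z)\<^sup>2 * qA * x + ?z\<^sup>2 * qB * (Qinf w - 2 * (?z * Qinf w) + x)
    - 2 * ?z * (1 - ?z) * qAB * (?z * Qinf w - x)"
    unfolding v_def by (intro tendsto_intros elim \<xi> EAA_lim EBB_lim EAB_lim)
  also have "(1 - ?z)\<^sup>2 * qA * x + ?z\<^sup>2 * qB * (Qinf w - 2 * (?z * Qinf w) + x)
    - 2 * ?z * (1 - ?z) * qAB * (?z * Qinf w - x) = ?z * (1 - ?z) * \<beta> w"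
    by (simp add: x_def \<beta>_def power2_eq_square algebra_simps)
  finally show ?case .
qed

text \<open>Here d_j^2 = D_j^2 u_j / ((j+1)(j+2)), where u_j tends to 1/(m N)^2. The averages of
  D_j^2 converge by the law of large numbers, the bounded factor D_j^2 allows u_j to be replaced by
  its limit, and \<open>Cesaro_imp_scaled_tail\<close> passes from averages to tails.\<close>

lemma squared_increments_tail:
  assumes k: "\<And>n. n\<^sup>2 \<le> k n"
  shows "AE w in M. (\<lambda>n. real n * (\<Sum>j=n..<k n. (d j w)\<^sup>2)) \<longlonglongrightarrow> Vinf w"
proof -
  have "AE w in M. (\<lambda>n. (\<Sum>j<n. (D j w)\<^sup>2) / real n) \<longlonglongrightarrow> Zinf w * (1 - Zinf w) * \<beta> w"
  proof (rule averages_of_cond_mean[OF borel_measurable_power[OF F_measurable_D] _ cond_mean_D_square v_tendsto])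
    show "\<bar>(D n w)\<^sup>2\<bar> \<le> \<kappa>\<^sup>2" if "path w" for n w
      using path_D[OF that, of n] \<kappa>_nonneg by (simp add: power2_le_iff_abs_le)
  qed
  then show ?thesis using S_over_n Ninf_pos AE_path
  proof eventually_elim
    case (elim w)
    let ?s = "m * Ninf w" and ?D = "\<lambda>j. (D j w)\<^sup>2"
    define u where "u j = real (j + 1) * real (j + 2) / (real (S j w))\<^sup>2" for j
    have s: "?s \<noteq> 0" using elim m_pos by simp
    have "(\<lambda>j. (real (j + 1) / real j) * (real (j + 2) / real j) / (real (S j w) / real j)\<^sup>2) \<longlonglongrightarrow> 1 * 1 / ?s\<^sup>2"
    proof (intro tendsto_divide tendsto_mult tendsto_power elim)
      show "(\<lambda>j. real (j + 1) / real j) \<longlonglongrightarrow> 1" "(\<lambda>j. real (j + 2) / real j) \<longlonglongrightarrow> 1" by real_asymp+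
    qed (use s in simp)
    moreover have "\<forall>\<^sub>F j in sequentially. (real (j + 1) / real j) * (real (j + 2) / real j) / (real (S j w) / real j)\<^sup>2 = u j"
      using eventually_gt_at_top[of "0::nat"]
      by eventually_elim (simp add: u_def power2_eq_square)
    ultimately have u: "u \<longlonglongrightarrow> 1 * 1 / ?s\<^sup>2" by (rule Lim_transform_eventually)
    have "(\<lambda>j. ?D j * (u j - 1 * 1 / ?s\<^sup>2)) \<longlonglongrightarrow> 0"
    proof (rule Lim_null_comparison)
      have "(\<lambda>j. \<kappa>\<^sup>2 * \<bar>u j - 1 * 1 / ?s\<^sup>2\<bar>) \<longlonglongrightarrow> \<kappa>\<^sup>2 * \<bar>1 * 1 / ?s\<^sup>2 - 1 * 1 / ?s\<^sup>2\<bar>"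
        by (intro tendsto_intros u)
      then show "(\<lambda>j. \<kappa>\<^sup>2 * \<bar>u j - 1 * 1 / ?s\<^sup>2\<bar>) \<longlonglongrightarrow> 0" by simp
      have "?D j \<le> \<kappa>\<^sup>2" for j using path_D[OF elim(4), of j] \<kappa>_nonneg by (simp add: power2_le_iff_abs_le)
      then show "\<forall>\<^sub>F j in sequentially. norm (?D j * (u j - 1 * 1 / ?s\<^sup>2)) \<le> \<kappa>\<^sup>2 * \<bar>u j - 1 * 1 / ?s\<^sup>2\<bar>"
        by (intro always_eventually allI) (simp add: abs_mult mult_right_mono)
    qed
    from tendsto_add[OF Cesaro_mean[OF this] tendsto_mult_right[OF elim(1), of "1 * 1 / ?s\<^sup>2"]]
    have "(\<lambda>n. (\<Sum>j<n. ?D j * (u j - 1 * 1 / ?s\<^sup>2)) / real n + (\<Sum>j<n. ?D j) / real n * (1 * 1 / ?s\<^sup>2))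
      \<longlonglongrightarrow> 0 + Zinf w * (1 - Zinf w) * \<beta> w * (1 * 1 / ?s\<^sup>2)" .
    moreover have "(\<Sum>j<n. ?D j * (u j - 1 * 1 / ?s\<^sup>2)) / real n + (\<Sum>j<n. ?D j) / real n * (1 * 1 / ?s\<^sup>2)
      = (\<Sum>j<n. ?D j * u j) / real n" for n
    proof -
      have "(\<Sum>j<n. ?D j * (u j - 1 * 1 / ?s\<^sup>2)) = (\<Sum>j<n. ?D j * u j) - (\<Sum>j<n. ?D j) * (1 * 1 / ?s\<^sup>2)"
        by (simp only: right_diff_distrib sum_subtractf sum_distrib_right)
      then show ?thesis by (simp add: diff_divide_distrib)
    qed
    ultimately have "(\<lambda>n. (\<Sum>j<n. ?D j * u j) / real n) \<longlonglongrightarrow> Vinf w" by (simp add: Vinf_def)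
    from Cesaro_imp_scaled_tail[OF this k]
    show ?case by (simp add: u_def d_def power_mult_distrib power_divide)
  qed
qed

lemma F_measurable_V: "urn_V a b N X A B n \<in> borel_measurable (F n)"
proof -
  have var: "(\<lambda>w. real (N j w)) \<in> borel_measurable (F n)" "(\<lambda>w. real (A j w)) \<in> borel_measurable (F n)"
    "(\<lambda>w. real (B j w)) \<in> borel_measurable (F n)" if j: "j \<in> {1..n}" for j
  proof -
    obtain i where i: "j = Suc i" using j by (cases j) auto
    show "(\<lambda>w. real (N j w)) \<in> borel_measurable (F n)" "(\<lambda>w. real (A j w)) \<in> borel_measurable (F n)"
      "(\<lambda>w. real (B j w)) \<in> borel_measurable (F n)"
      using j unfolding i by (intro F_measurable_mono[OF F_measurable_variables_real(1)]
        F_measurable_mono[OF F_measurable_variables_real(3)] F_measurable_mono[OF F_measurable_variables_real(4)]; simp)+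
  qed
  have mean: "empirical_mean Y n \<in> borel_measurable (F n)" if "\<And>j. j \<in> {1..n} \<Longrightarrow> Y j \<in> borel_measurable (F n)" for Y
    unfolding empirical_mean_def[abs_def] by (intro borel_measurable_divide borel_measurable_sum that borel_measurable_const)
  have [measurable]: "empirical_mean (\<lambda>j w. real (A j w)) n \<in> borel_measurable (F n)"
    "empirical_mean (\<lambda>j w. real (N j w)) n \<in> borel_measurable (F n)"
    "empirical_mean (\<lambda>j w. (real (A j w))\<^sup>2) n \<in> borel_measurable (F n)"
    "empirical_mean (\<lambda>j w. (real (B j w))\<^sup>2) n \<in> borel_measurable (F n)"
    "empirical_mean (\<lambda>j w. (real (N j w))\<^sup>2) n \<in> borel_measurable (F n)"
    "empirical_mean (\<lambda>j w. real (A j w) * real (B j w)) n \<in> borel_measurable (F n)"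
    by (intro mean var borel_measurable_power borel_measurable_times; assumption)+
  note F_measurable_Z[of n, measurable]
  show ?thesis unfolding urn_V_def[abs_def] Let_def by measurable
qed

lemma Z_dist_integrable: "integrable M (\<lambda>w. \<bar>Z n w - Zinf w\<bar>)"
  and Z_dist_lim: "(\<lambda>n. \<integral>w. \<bar>Z n w - Zinf w\<bar> \<partial>M) \<longlonglongrightarrow> 0"
proof -
  have bound: "AE w in M. norm \<bar>Z n w - Zinf w\<bar> \<le> 1" for n
    using Zinf_pos Zinf_less_1
  proof eventually_elim
    case (elim w)
    then show ?case using Z_bounds[of n w] by auto
  qed
  show "integrable M (\<lambda>w. \<bar>Z n w - Zinf w\<bar>)"
    by (rule integrable_AE_bounded[OF _ bound]) measurable
  have "(\<lambda>n. \<integral>w. \<bar>Z n w - Zinf w\<bar> \<partial>M) \<longlonglongrightarrow> (\<integral>w. 0 \<partial>M)"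
  proof (rule integral_dominated_convergence[where w = "\<lambda>_. 1", OF _ _ _ _ bound])
    show "AE w in M. (\<lambda>n. \<bar>Z n w - Zinf w\<bar>) \<longlonglongrightarrow> 0"
      using Z_lim by eventually_elim (simp add: tendsto_rabs_zero_iff LIM_zero_iff)
  qed auto
  then show "(\<lambda>n. \<integral>w. \<bar>Z n w - Zinf w\<bar> \<partial>M) \<longlonglongrightarrow> 0" by simp
qed

lemma central_limit_theorem:
  fixes t \<delta> :: real
  assumes \<delta>: "0 < \<delta>"
  defines "V \<equiv> urn_V a b N X A B"
  shows "(\<lambda>n. (\<integral>w. iexp (t * (sqrt (real n) * (Z n w - Zinf w) / sqrt (max (V n w) \<delta>))) \<partial>M)
    - (\<integral>w. of_real (exp (- (t\<^sup>2 * (max (V n w) 0 / max (V n w) \<delta>)) / 2)) \<partial>M)) \<longlonglongrightarrow> (0 :: complex)"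
proof -
  \<comment> \<open>The horizon satisfies n^2 <= k for \<open>squared_increments_tail\<close>, and
    is so late that the mean distance of Z_k from the limit is negligible even against 1/sqrt
    n.\<close>
  have "\<exists>k. n\<^sup>2 \<le> k \<and> n \<le> k \<and> (\<integral>w. \<bar>Z k w - Zinf w\<bar> \<partial>M) \<le> 1 / real (n + 1)" for n
  proof -
    have "\<forall>\<^sub>F k in sequentially. (\<integral>w. \<bar>Z k w - Zinf w\<bar> \<partial>M) < 1 / real (n + 1)"
      by (rule order_tendstoD(2)[OF Z_dist_lim]) simp
    then have "\<forall>\<^sub>F k in sequentially. n\<^sup>2 \<le> k \<and> n \<le> k \<and> (\<integral>w. \<bar>Z k w - Zinf w\<bar> \<partial>M) \<le> 1 / real (n + 1)"
      using eventually_ge_at_top[of "n\<^sup>2"] eventually_ge_at_top[of n] by eventually_elim auto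
    then show ?thesis by (auto simp: eventually_sequentially)
  qed
  then obtain k where k: "\<And>n. n\<^sup>2 \<le> k n" "\<And>n. n \<le> k n" "\<And>n. (\<integral>w. \<bar>Z (k n) w - Zinf w\<bar> \<partial>M) \<le> 1 / real (n + 1)"
    by metis
  \<comment> \<open>The sign is negative because the tail sum of the \<open>d j\<close> approximates
    Z - Z_n, the opposite of the studentized difference.\<close>
  define s where "s n w = - t / sqrt (max (V n w) \<delta>)" for n w
  \<comment> \<open>The positive part keeps \<open>L n w\<close> in [0,1] whatever the sign of
    \<open>V n w\<close>.\<close>
  define L where "L n w = exp (- (t\<^sup>2 * (max (V n w) 0 / max (V n w) \<delta>)) / 2)" for n w
  define \<sigma> where "\<sigma> = \<bar>t\<bar> / sqrt \<delta>"
  have \<sigma>: "0 \<le> \<sigma>" using \<delta> by (simp add: \<sigma>_def)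
  have s_bound: "\<bar>s n w\<bar> \<le> \<sigma>" for n w
    unfolding s_def \<sigma>_def using \<delta> by (auto simp: abs_divide intro!: divide_left_mono mult_pos_pos)
  note F_measurable_V[folded V_def, measurable]
  interpret tail_increments M F d \<kappa> s L \<sigma> k
  proof
    fix n w
    show "s n \<in> borel_measurable (F n)" unfolding s_def[abs_def] by measurable
    show "L n \<in> borel_measurable (F n)" unfolding L_def[abs_def] by measurable
    show "0 \<le> L n w" "L n w \<le> 1"
      using \<delta> by (auto simp: L_def zero_le_divide_iff zero_le_mult_iff le_max_iff_disj)
  qed (use s_bound k in auto)
  have main: "(\<lambda>n. (\<integral>w. iexp (sqrt (real n) * s n w * (\<Sum>j=n..<k n. d j w)) \<partial>M) - (\<integral>w. of_real (L n w) \<partial>M)) \<longlonglongrightarrow> 0"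
  proof (rule mixed_central_limit)
    \<comment> \<open>The scaled tail of squares and V_n have the common limit
      \<open>Vinf w\<close>, so both exponentials do too; its positivity makes
      \<open>max (Vinf w) 0\<close> equal to it.\<close>
    show "AE w in M. (\<lambda>n. exp (- (real n * (s n w)\<^sup>2 * (\<Sum>j=n..<k n. (d j w)\<^sup>2)) / 2) - L n w) \<longlonglongrightarrow> 0"
      using squared_increments_tail[OF k(1)] V_tendsto Vinf_pos
    proof eventually_elim
      case (elim w)
      have nz: "max (Vinf w) \<delta> \<noteq> 0" using \<delta> by auto
      have V: "(\<lambda>n. V n w) \<longlonglongrightarrow> Vinf w" using elim(2) by (simp add: V_def)
      have "(\<lambda>n. exp (- (t\<^sup>2 / max (V n w) \<delta> * (real n * (\<Sum>j=n..<k n. (d j w)\<^sup>2))) / 2) - L n w)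
        \<longlonglongrightarrow> exp (- (t\<^sup>2 / max (Vinf w) \<delta> * Vinf w) / 2) - exp (- (t\<^sup>2 * (max (Vinf w) 0 / max (Vinf w) \<delta>)) / 2)"
        unfolding L_def by (intro tendsto_intros elim(1) V nz) simp_all
      moreover have "(s n w)\<^sup>2 = t\<^sup>2 / max (V n w) \<delta>" for n
        using \<delta> by (simp add: s_def power_divide)
      ultimately show ?case using elim(3) by (simp add: mult_ac)
    qed
  qed
  \<comment> \<open>Up to the horizon \<open>Z_remainder\<close> leaves at most \<kappa>^2/(n+1),
    beyond it |Z_k - Z| remains with mean at most 1/(n+1). Both are multiplied by at most \<sigma>
    sqrt n, and x -> exp(ix) is 1-Lipschitz.\<close>
  have close: "cmod ((\<integral>w. iexp (t * (sqrt (real n) * (Z n w - Zinf w) / sqrt (max (V n w) \<delta>))) \<partial>M)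
    - (\<integral>w. iexp (sqrt (real n) * s n w * (\<Sum>j=n..<k n. d j w)) \<partial>M)) \<le> \<sigma> * (\<kappa>\<^sup>2 + 1) * (sqrt (real n) / real (n + 1))" for n
  proof -
    define f where "f w = t * (sqrt (real n) * (Z n w - Zinf w) / sqrt (max (V n w) \<delta>))" for w
    define g where "g w = sqrt (real n) * s n w * (\<Sum>j=n..<k n. d j w)" for w
    have [measurable]: "V n \<in> borel_measurable M" unfolding V_def by (rule F_measurable[OF F_measurable_V])
    have [measurable]: "f \<in> borel_measurable M" "g \<in> borel_measurable M"
      unfolding f_def[abs_def] g_def[abs_def] by measurable
    have int: "integrable M (\<lambda>w. iexp (f w))" "integrable M (\<lambda>w. iexp (g w))"
      by (intro integrable_const_bound[where B = 1]; simp)+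
    have "cmod (\<integral>w. iexp (f w) - iexp (g w) \<partial>M)
      \<le> (\<integral>w. sqrt (real n) * \<sigma> * (\<kappa>\<^sup>2 / real (n + 1)) + sqrt (real n) * \<sigma> * \<bar>Z (k n) w - Zinf w\<bar> \<partial>M)"
    proof (rule order_trans[OF integral_norm_bound], rule integral_mono_AE)
      show "integrable M (\<lambda>w. cmod (iexp (f w) - iexp (g w)))"
        by (intro integrable_norm Bochner_Integration.integrable_diff int)
      show "integrable M (\<lambda>w. sqrt (real n) * \<sigma> * (\<kappa>\<^sup>2 / real (n + 1)) + sqrt (real n) * \<sigma> * \<bar>Z (k n) w - Zinf w\<bar>)"
        by (intro Bochner_Integration.integrable_add integrable_const integrable_mult_right Z_dist_integrable)
      show "AE w in M. cmod (iexp (f w) - iexp (g w))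
        \<le> sqrt (real n) * \<sigma> * (\<kappa>\<^sup>2 / real (n + 1)) + sqrt (real n) * \<sigma> * \<bar>Z (k n) w - Zinf w\<bar>"
        using AE_path
      proof eventually_elim
        case (elim w)
        let ?r = "Z (k n) w - Z n w - (\<Sum>j=n..<k n. d j w)"
        have "f w - g w = sqrt (real n) * s n w * (?r + (Zinf w - Z (k n) w))"
          unfolding f_def g_def s_def by (simp add: algebra_simps diff_divide_distrib add_divide_distrib)
        then have "\<bar>f w - g w\<bar> = sqrt (real n) * \<bar>s n w\<bar> * \<bar>?r + (Zinf w - Z (k n) w)\<bar>" by (simp add: abs_mult)
        also have "\<dots> \<le> sqrt (real n) * \<sigma> * (\<kappa>\<^sup>2 / real (n + 1) + \<bar>Z (k n) w - Zinf w\<bar>)"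
        proof (intro mult_mono mult_left_mono s_bound)
          show "\<bar>?r + (Zinf w - Z (k n) w)\<bar> \<le> \<kappa>\<^sup>2 / real (n + 1) + \<bar>Z (k n) w - Zinf w\<bar>"
            using Z_remainder[OF elim k(2), of n] by linarith
        qed (use \<sigma> in auto)
        also have "\<dots> = sqrt (real n) * \<sigma> * (\<kappa>\<^sup>2 / real (n + 1)) + sqrt (real n) * \<sigma> * \<bar>Z (k n) w - Zinf w\<bar>"
          by (rule distrib_left)
        finally have "\<bar>f w - g w\<bar> \<le> sqrt (real n) * \<sigma> * (\<kappa>\<^sup>2 / real (n + 1)) + sqrt (real n) * \<sigma> * \<bar>Z (k n) w - Zinf w\<bar>" .
        moreover have "cmod (iexp (f w) - iexp (g w)) \<le> \<bar>f w - g w\<bar>"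
        proof -
          have "iexp (f w) - iexp (g w) = iexp (g w) * (iexp (f w - g w) - 1)"
            by (simp add: right_diff_distrib exp_diff exp_minus)
          then have "cmod (iexp (f w) - iexp (g w)) = cmod (iexp (f w - g w) - 1)"
            by (simp only: norm_mult norm_exp_i_times mult_1)
          also have "\<dots> \<le> \<bar>f w - g w\<bar>" using iexp_approx1[of "f w - g w" 0] by simp
          finally show ?thesis .
        qed
        ultimately show ?case by linarith
      qed
    qed
    also have "\<dots> = sqrt (real n) * \<sigma> * (\<kappa>\<^sup>2 / real (n + 1)) + sqrt (real n) * \<sigma> * (\<integral>w. \<bar>Z (k n) w - Zinf w\<bar> \<partial>M)"
      using Z_dist_integrable[of "k n"] by (simp add: prob_space)
    also have "\<dots> \<le> sqrt (real n) * \<sigma> * (\<kappa>\<^sup>2 / real (n + 1)) + sqrt (real n) * \<sigma> * (1 / real (n + 1))"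
      using k(3)[of n] \<sigma> by (intro add_left_mono mult_left_mono) auto
    also have "\<dots> = \<sigma> * (\<kappa>\<^sup>2 + 1) * (sqrt (real n) / real (n + 1))"
      by (simp add: distrib_left distrib_right add_divide_distrib mult_ac)
    finally show ?thesis by (simp only: Bochner_Integration.integral_diff[OF int] f_def[symmetric] g_def[symmetric])
  qed
  have "(\<lambda>n. sqrt (real n) / real (n + 1)) \<longlonglongrightarrow> 0" by real_asymp
  from tendsto_mult_right_zero[OF this, of "\<sigma> * (\<kappa>\<^sup>2 + 1)"]
  have "(\<lambda>n. (\<integral>w. iexp (t * (sqrt (real n) * (Z n w - Zinf w) / sqrt (max (V n w) \<delta>))) \<partial>M)
    - (\<integral>w. iexp (sqrt (real n) * s n w * (\<Sum>j=n..<k n. d j w)) \<partial>M)) \<longlonglongrightarrow> 0"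
    by (rule Lim_null_comparison[rotated]) (intro always_eventually allI close)
  from tendsto_add[OF this main] show ?thesis by (simp add: L_def)
qed

lemma asymptotic_confidence_interval:
  assumes \<alpha>: "0 < \<alpha>" "\<alpha> < 1"
  shows "(\<lambda>n. prob {w \<in> space M. \<bar>Z n w - Zinf w\<bar> \<le>
    quantile std_normal_distribution (1 - \<alpha> / 2) * sqrt (urn_V a b N X A B n w / real n)}) \<longlonglongrightarrow> 1 - \<alpha>"
proof (rule Lim_transform_eventually)
  let ?q = "quantile std_normal_distribution (1 - \<alpha> / 2)"
  have VM: "urn_V a b N X A B n \<in> borel_measurable M" for n by (rule F_measurable[OF F_measurable_V])
  have WM: "(\<lambda>w. sqrt (real n) * (Z n w - Zinf w)) \<in> borel_measurable M" for n by measurable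
  show "(\<lambda>n. prob {w \<in> space M. \<bar>sqrt (real n) * (Z n w - Zinf w)\<bar> \<le> ?q * sqrt (urn_V a b N X A B n w)}) \<longlonglongrightarrow> 1 - \<alpha>"
    by (rule studentized_coverage[OF WM VM Vinf_M V_tendsto Vinf_pos central_limit_theorem \<alpha>])
  show "\<forall>\<^sub>F n in sequentially. prob {w \<in> space M. \<bar>sqrt (real n) * (Z n w - Zinf w)\<bar> \<le> ?q * sqrt (urn_V a b N X A B n w)}
    = prob {w \<in> space M. \<bar>Z n w - Zinf w\<bar> \<le> ?q * sqrt (urn_V a b N X A B n w / real n)}"
    using eventually_gt_at_top[of "0::nat"]
  proof eventually_elim
    case (elim n)
    then have "\<bar>sqrt (real n) * (Z n w - Zinf w)\<bar> \<le> ?q * sqrt (urn_V a b N X A B n w)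
      \<longleftrightarrow> \<bar>Z n w - Zinf w\<bar> \<le> ?q * sqrt (urn_V a b N X A B n w / real n)" for w
      by (simp add: abs_mult real_sqrt_divide pos_le_divide_eq mult.commute)
    then show ?case by simp
  qed
qed

end

end

theorem mainTheorem6:
  fixes M :: "'a measure"
    and a b C :: nat
    and N X A B :: "nat \<Rightarrow> 'a \<Rightarrow> nat"
    and ms :: "nat \<Rightarrow> real" and m qA qB qAB :: real
    and Ninf Qinf :: "'a \<Rightarrow> real"
  assumes "urn_model M a b N X A B"
    and "\<And>n. 1 \<le> n \<Longrightarrow> AE \<omega> in M. max (max (A n \<omega>) (B n \<omega>)) (N n \<omega>) \<le> C"
    and "\<And>n. 1 \<le> n \<Longrightarrow> (\<integral>\<omega>. real (A n \<omega>) \<partial>M) = ms n"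
    and "\<And>n. 1 \<le> n \<Longrightarrow> (\<integral>\<omega>. real (B n \<omega>) \<partial>M) = ms n"
    and "ms \<longlonglongrightarrow> m" and "0 < m"
    and "Ninf \<in> borel_measurable M" and "AE \<omega> in M. 0 < Ninf \<omega>"
    and "Qinf \<in> borel_measurable M" and "AE \<omega> in M. 0 < Qinf \<omega>"
    and "AE \<omega> in M. (\<lambda>n. real_cond_exp M (urn_filtration M N X A B (n - 1))
           (\<lambda>\<omega>. real (N n \<omega>)) \<omega>) \<longlonglongrightarrow> Ninf \<omega>"
    and "AE \<omega> in M. (\<lambda>n. real_cond_exp M (urn_filtration M N X A B (n - 1))
           (\<lambda>\<omega>. (real (N n \<omega>))\<^sup>2) \<omega>) \<longlonglongrightarrow> Qinf \<omega>"
    and "(\<lambda>n. \<integral>\<omega>. (real (A n \<omega>))\<^sup>2 \<partial>M) \<longlonglongrightarrow> qA" and "0 < qA"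
    and "(\<lambda>n. \<integral>\<omega>. (real (B n \<omega>))\<^sup>2 \<partial>M) \<longlonglongrightarrow> qB" and "0 < qB"
    and "(\<lambda>n. \<integral>\<omega>. real (A n \<omega>) * real (B n \<omega>) \<partial>M) \<longlonglongrightarrow> qAB" and "0 < qAB"
  shows "(\<exists>Z \<in> borel_measurable M. AE \<omega> in M. (\<lambda>n. urn_Z a b N X A B n \<omega>) \<longlonglongrightarrow> Z \<omega>) \<and>
    (\<forall>Z \<in> borel_measurable M. (AE \<omega> in M. (\<lambda>n. urn_Z a b N X A B n \<omega>) \<longlonglongrightarrow> Z \<omega>) \<longrightarrow>
      (\<forall>\<alpha>. 0 < \<alpha> \<and> \<alpha> < 1 \<longrightarrow>
        (\<lambda>n. measure M {\<omega> \<in> space M. \<bar>urn_Z a b N X A B n \<omega> - Z \<omega>\<bar> \<le>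
            quantile std_normal_distribution (1 - \<alpha> / 2) * sqrt (urn_V a b N X A B n \<omega> / real n)})
          \<longlonglongrightarrow> 1 - \<alpha>))"
proof -
  interpret urn_model M a b N X A B by fact
  interpret U: bounded_urn M a b N X A B C
  proof
    fix n
    have "AE \<omega> in M. max (max (A (Suc n) \<omega>) (B (Suc n) \<omega>)) (N (Suc n) \<omega>) \<le> C" by (rule assms(2)) simp
    then show "AE \<omega> in M. A (Suc n) \<omega> \<le> C \<and> B (Suc n) \<omega> \<le> C \<and> N (Suc n) \<omega> \<le> C"
      by eventually_elim simp
  qed
  interpret U: balanced_urn M a b N X A B C m qA qB qAB Ninf Qinf
  proof
    show "U.EA n = U.EB n" for n using assms(3,4)[of "Suc n"] by (simp add: U.EA_def U.EB_def)
    \<comment> \<open>The hypotheses are indexed by the draw, the locale by the time before it;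
      \<open>LIMSEQ_Suc\<close> performs this shift here and for the limits below.\<close>
    have "U.EA = (\<lambda>n. ms (Suc n))" using assms(3) by (simp add: U.EA_def fun_eq_iff)
    with LIMSEQ_Suc[OF assms(5)] show "U.EA \<longlonglongrightarrow> m" by simp
    show "U.EAA \<longlonglongrightarrow> qA" using LIMSEQ_Suc[OF assms(13)] by (simp add: U.EAA_def[abs_def])
    show "U.EBB \<longlonglongrightarrow> qB" using LIMSEQ_Suc[OF assms(15)] by (simp add: U.EBB_def[abs_def])
    show "U.EAB \<longlonglongrightarrow> qAB" using LIMSEQ_Suc[OF assms(17)] by (simp add: U.EAB_def[abs_def])
    show "AE \<omega> in M. (\<lambda>n. U.\<nu> n \<omega>) \<longlonglongrightarrow> Ninf \<omega>"
      using assms(11)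
    proof eventually_elim
      case (elim \<omega>)
      from LIMSEQ_Suc[OF elim] show ?case by (simp add: U.\<nu>_def)
    qed
    show "AE \<omega> in M. (\<lambda>n. U.\<theta> n \<omega>) \<longlonglongrightarrow> Qinf \<omega>"
      using assms(12)
    proof eventually_elim
      case (elim \<omega>)
      from LIMSEQ_Suc[OF elim] show ?case by (simp add: U.\<theta>_def)
    qed
  qed (fact assms)+
  show ?thesis
    using U.Z_limit_exists U.asymptotic_confidence_interval by blast
qed

end
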